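(* Let $(\mathbb{T},w,x,o)$ be a unimodular Bienaymé-Galton-Watson tree with reproduction law $\pi$, with i.i.d. edge weights $(w(e))_{e\in E(\mathbb{T})}$ of distribution $\omega$ and i.i.d. vertex weights $(x(v))_{v\in V(\mathbb{T})}$ of distribution $\xi$ (tree, edge weights and vertex weights independent of each other). Assume that: (i) $\xi$ is lower bounded; in addition it is either continuous (no atoms) or its only atom is at its minimum $m_\xi\in\mathbb{R}$; (ii) $\omega$ is continuous (no atoms), and its support is locally convex under its maximum $M_\omega\in\mathbb{R}\cup\{+\infty\}$; (iii) $\pi$ has a finite second moment. Then there almost surely exists a unique optimal monomer-dimer configuration $\mathbb{MD}$ on $(\mathbb{T},w,x,o)$ in the following sense. There is an (almost surely unique) random monomer-dimer configuration $\mathbb{MD}$ on $(\mathbb{T},w,x,o)$ such that, whenever $(G_n,w_n,x_n,o_n)_{n\in\mathbb{N}}$ is a sequence of finite weighted random rooted graphs converging locally to $(\mathbb{T},w,x,o)$ and $\mathrm{MD}_n$ is any optimal monomer-dimer configuration on $(G_n,w_n,x_n)$, then $(G_n,w_n,x_n,\mathrm{MD}_n,o_n)$ converges locally to $(\mathbb{T},w,x,\mathbb{MD},o)$.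
   Context: Unimodular Bienaymé-Galton-Watson (UBGW) tree with reproduction law $\pi$: $\pi$ is a probability measure on $\mathbb{N}_0=\{0,1,2,\dots\}$ with finite mean $E>0$; $\hat\pi(k)=\frac{(k+1)\pi(k+1)}{E}$ for $k\in\mathbb{N}_0$. The UBGW tree $(\mathbb{T},o)$ is the random rooted tree in which the numbers of children of all vertices are independent, the root $o$ has a number of children distributed as $\pi$, and every non-root vertex has a number of children distributed as $\hat\pi$. "The support of $\omega$ is locally convex under its maximum $M_\omega$" ($M_\omega$ being the supremum of the support) means that the support contains a non-empty open interval with right endpoint $M_\omega$: $(M_\omega-\varepsilon,M_\omega)$ for some $\varepsilon>0$ if $M_\omega<\infty$, or $(A,+\infty)$ for some $A\in\mathbb{R}$ if $M_\omega=+\infty$. A weighted graph $(G,w,x)$ is a locally finite graph with $w:E(G)\to\mathbb{R}$, $x:V(G)\to\mathbb{R}$. A monomer-dimer configuration on $G$ is a set $\mathrm{MD}\subseteq E(G)$ such that every vertex is incident to at most one edge of $\mathrm{MD}$; elements of $\mathrm{MD}$ are called dimers, and vertices incident to no edge of $\mathrm{MD}$ are called monomers. On a finite weighted graph, $\mathrm{MD}$ is optimal if it maximises $\sum_{e\text{ dimer}}w(e)+\sum_{v\text{ monomer}}x(v)$ among all monomer-dimer configurations. For a rooted graph $(G,o)$ and $H\in\mathbb{N}_0$, $B_H(G,o)$ is the subgraph induced on the vertices at distance at most $H+1$ from $o$, rooted at $o$ (and carrying the restricted weights and restricted configuration when $G$ carries them). $\cong$ denotes root-preserving graph isomorphism which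 also preserves edge weights, vertex weights and membership of edges in the configuration exactly, when present. A sequence of rooted (weighted, decorated) graphs converges locally to a limit if for every $H\in\mathbb{N}_0$ there is $N\in\mathbb{N}$ such that for all $n\ge N$ the ball $B_H$ of the $n$-th graph is isomorphic ($\cong$) to the ball $B_H$ of the limit. For random graphs, local convergence means that all objects are defined on a common probability space and this convergence holds almost surely. *)

theory Defs
  imports "HOL-Probability.Probability"
begin

section \<open>Rooted weighted graphs\<close>

text \<open>Graphs are simple and undirected: an edge is a two-element set of vertices.  The weight
  functions are total, but only their values on edges and on vertices carry meaning.\<close>

record 'v wgraph =
  verts :: "'v set"
  edges :: "'v set set"
  ew :: "'v set \<Rightarrow> real"
  vw :: "'v \<Rightarrow> real"
  root :: 'v

definition weighted_graph :: "'v wgraph \<Rightarrow> bool" where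
  "weighted_graph G \<longleftrightarrow>
     edges G \<subseteq> {{u, v} |u v. u \<in> verts G \<and> v \<in> verts G \<and> u \<noteq> v} \<and>
     (\<forall>v\<in>verts G. finite {e \<in> edges G. v \<in> e}) \<and>
     root G \<in> verts G"

definition md_config :: "'v wgraph \<Rightarrow> 'v set set \<Rightarrow> bool" where
  "md_config G D \<longleftrightarrow>
     D \<subseteq> edges G \<and>
     (\<forall>v\<in>verts G. \<forall>e\<in>D. \<forall>e'\<in>D. v \<in> e \<and> v \<in> e' \<longrightarrow> e = e')"

definition monomers :: "'v wgraph \<Rightarrow> 'v set set \<Rightarrow> 'v set" where
  "monomers G D = {v \<in> verts G. \<forall>e\<in>D. v \<notin> e}"

text \<open>The next two definitions are meant for finite graphs only.\<close>

definition md_weight :: "'v wgraph \<Rightarrow> 'v set set \<Rightarrow> real" where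
  "md_weight G D = (\<Sum>e\<in>D. ew G e) + (\<Sum>v\<in>monomers G D. vw G v)"

definition optimal_md :: "'v wgraph \<Rightarrow> 'v set set \<Rightarrow> bool" where
  "optimal_md G D \<longleftrightarrow>
     md_config G D \<and> (\<forall>D'. md_config G D' \<longrightarrow> md_weight G D' \<le> md_weight G D)"

section \<open>Local convergence\<close>

definition gdist :: "'v wgraph \<Rightarrow> 'v \<Rightarrow> 'v \<Rightarrow> enat" where
  "gdist G u v = (INF j\<in>{j. (u, v) \<in> {(a, b). {a, b} \<in> edges G} ^^ j}. enat j)"

text \<open>The ball of index \<open>H\<close> has radius \<open>H + 1\<close>.\<close>

definition ball_verts :: "nat \<Rightarrow> 'v wgraph \<Rightarrow> 'v set" where
  "ball_verts H G = {v \<in> verts G. gdist G (root G) v \<le> enat (H + 1)}"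

definition gball :: "nat \<Rightarrow> 'v wgraph \<Rightarrow> 'v wgraph" where
  "gball H G = G\<lparr>verts := ball_verts H G, edges := {e \<in> edges G. e \<subseteq> ball_verts H G}\<rparr>"

definition config_ball :: "nat \<Rightarrow> 'v wgraph \<Rightarrow> 'v set set \<Rightarrow> 'v set set" where
  "config_ball H G D = {e \<in> D. e \<subseteq> ball_verts H G}"

definition wgraph_iso :: "('u \<Rightarrow> 'v) \<Rightarrow> 'u wgraph \<Rightarrow> 'v wgraph \<Rightarrow> bool" where
  "wgraph_iso f G G' \<longleftrightarrow>
     bij_betw f (verts G) (verts G') \<and>
     f (root G) = root G' \<and>
     (\<forall>u\<in>verts G. \<forall>v\<in>verts G. {u, v} \<in> edges G \<longleftrightarrow> {f u, f v} \<in> edges G') \<and>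
     (\<forall>e\<in>edges G. ew G e = ew G' (f ` e)) \<and>
     (\<forall>v\<in>verts G. vw G v = vw G' (f v))"

definition wgraph_isomorphic :: "'u wgraph \<Rightarrow> 'v wgraph \<Rightarrow> bool" where
  "wgraph_isomorphic G G' \<longleftrightarrow> (\<exists>f. wgraph_iso f G G')"

definition decorated_isomorphic ::
    "'u wgraph \<Rightarrow> 'u set set \<Rightarrow> 'v wgraph \<Rightarrow> 'v set set \<Rightarrow> bool" where
  "decorated_isomorphic G D G' D' \<longleftrightarrow>
     (\<exists>f. wgraph_iso f G G' \<and> (\<forall>e\<in>edges G. e \<in> D \<longleftrightarrow> f ` e \<in> D'))"

definition converges_locally :: "(nat \<Rightarrow> 'u wgraph) \<Rightarrow> 'v wgraph \<Rightarrow> bool" where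
  "converges_locally G L \<longleftrightarrow>
     (\<forall>H. \<exists>N. \<forall>n\<ge>N. wgraph_isomorphic (gball H (G n)) (gball H L))"

definition decorated_converges_locally ::
    "(nat \<Rightarrow> 'u wgraph) \<Rightarrow> (nat \<Rightarrow> 'u set set) \<Rightarrow> 'v wgraph \<Rightarrow> 'v set set \<Rightarrow> bool" where
  "decorated_converges_locally G D L D' \<longleftrightarrow>
     (\<forall>H. \<exists>N. \<forall>n\<ge>N. decorated_isomorphic
        (gball H (G n)) (config_ball H (G n) (D n)) (gball H L) (config_ball H L D'))"

section \<open>Random graphs and random configurations\<close>

text \<open>Every finite graph has a copy with vertices in \<open>nat\<close>, so random finite graphs are taken
  there; measurability is that of all presence events, of the root, and of all weights.\<close>

definition random_finite_graph :: "'s measure \<Rightarrow> ('s \<Rightarrow> nat wgraph) \<Rightarrow> bool" where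
  "random_finite_graph M G \<longleftrightarrow>
     (\<forall>z\<in>space M. weighted_graph (G z) \<and> finite (verts (G z))) \<and>
     (\<forall>v. {z \<in> space M. v \<in> verts (G z)} \<in> sets M) \<and>
     (\<forall>e. {z \<in> space M. e \<in> edges (G z)} \<in> sets M) \<and>
     (\<forall>v. {z \<in> space M. root (G z) = v} \<in> sets M) \<and>
     (\<forall>e. (\<lambda>z. if e \<in> edges (G z) then ew (G z) e else 0) \<in> borel_measurable M) \<and>
     (\<forall>v. (\<lambda>z. if v \<in> verts (G z) then vw (G z) v else 0) \<in> borel_measurable M)"

definition random_config ::
    "'s measure \<Rightarrow> ('s \<Rightarrow> 'v wgraph) \<Rightarrow> ('s \<Rightarrow> 'v set set) \<Rightarrow> bool" where
  "random_config M G D \<longleftrightarrow>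
     (\<forall>z\<in>space M. md_config (G z) (D z)) \<and>
     (\<forall>e. {z \<in> space M. e \<in> D z} \<in> sets M)"

text \<open>The approximating graphs, their optima and the limit all live on the same probability space
  \<open>M\<close>, and local convergence is almost sure.  The joint law of graph and root is arbitrary.\<close>

definition limit_of_optima ::
    "'s measure \<Rightarrow> ('s \<Rightarrow> 'v wgraph) \<Rightarrow> ('s \<Rightarrow> 'v set set) \<Rightarrow> bool" where
  "limit_of_optima M L D \<longleftrightarrow>
     (\<forall>(G :: nat \<Rightarrow> 's \<Rightarrow> nat wgraph) Dn.
        (\<forall>n. random_finite_graph M (G n)) \<and>
        (AE z in M. converges_locally (\<lambda>n. G n z) (L z)) \<and>
        (\<forall>n. random_config M (G n) (Dn n)) \<and>
        (\<forall>n. AE z in M. optimal_md (G n z) (Dn n z)) \<longrightarrow>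
        (AE z in M. decorated_converges_locally (\<lambda>n. G n z) (\<lambda>n. Dn n z) (L z) (D z)))"

section \<open>Supports and atoms\<close>

definition msupport :: "real measure \<Rightarrow> real set" where
  "msupport \<mu> = {a. \<forall>U. open U \<and> a \<in> U \<longrightarrow> 0 < emeasure \<mu> U}"

definition atoms :: "real measure \<Rightarrow> real set" where
  "atoms \<mu> = {a. 0 < emeasure \<mu> {a}}"

definition support_max :: "real measure \<Rightarrow> ereal" where
  "support_max \<mu> = (SUP a\<in>msupport \<mu>. ereal a)"

definition locally_convex_under_max :: "real measure \<Rightarrow> bool" where
  "locally_convex_under_max \<mu> \<longleftrightarrow>
     (\<exists>a. ereal a < support_max \<mu> \<and> {t. a < t \<and> ereal t < support_max \<mu>} \<subseteq> msupport \<mu>)"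

section \<open>The weighted unimodular Bienayme-Galton-Watson tree\<close>

definition size_biased :: "nat pmf \<Rightarrow> nat pmf" where
  "size_biased p =
     embed_pmf (\<lambda>k. real (k + 1) * pmf p (k + 1) / measure_pmf.expectation p real)"

lemma pmf_size_biased:
  assumes int: "integrable (measure_pmf p) real" and pos: "0 < measure_pmf.expectation p real"
  shows "pmf (size_biased p) k = real (k + 1) * pmf p (k + 1) / measure_pmf.expectation p real"
  unfolding size_biased_def
proof (rule pmf_embed_pmf)
  let ?E = "measure_pmf.expectation p real"
  show "0 \<le> real (k + 1) * pmf p (k + 1) / ?E" for k
    using pos by simp
  have "ennreal ?E = (\<integral>\<^sup>+ k. ennreal (real k) \<partial>measure_pmf p)"
    using nn_integral_eq_integral[OF int] by simp
  also have "\<dots> = (\<Sum>k. ennreal (pmf p k) * ennreal (real k))"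
    by (simp add: nn_integral_measure_pmf nn_integral_count_space_nat)
  also have "\<dots> = (\<Sum>k. ennreal (pmf p (k + 1)) * ennreal (real (k + 1)))"
    using suminf_offset[of "\<lambda>k. ennreal (pmf p k) * ennreal (real k)" 1] by simp
  finally have *: "ennreal ?E = (\<Sum>k. ennreal (pmf p (k + 1)) * ennreal (real (k + 1)))" .
  have "(\<integral>\<^sup>+ k. ennreal (real (k + 1) * pmf p (k + 1) / ?E) \<partial>count_space UNIV)
      = (\<Sum>k. ennreal (pmf p (k + 1)) * ennreal (real (k + 1)) * ennreal (1 / ?E))"
    unfolding nn_integral_count_space_nat using pos
    by (intro suminf_cong) (simp only: ennreal_mult'[symmetric] pmf_nonneg of_nat_0_le_iff
          zero_le_divide_1_iff mult_nonneg_nonneg less_imp_le, simp add: mult.commute)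
  also have "\<dots> = ennreal ?E * ennreal (1 / ?E)"
    unfolding * by (rule ennreal_suminf_multc)
  also have "\<dots> = 1"
    using pos by (subst ennreal_mult'[symmetric]) auto
  finally show "(\<integral>\<^sup>+ k. ennreal (real (k + 1) * pmf p (k + 1) / ?E) \<partial>count_space UNIV) = 1" .
qed

text \<open>Ulam-Harris encoding: vertices are words, the children of \<open>u\<close> are the words \<open>u @ [i]\<close>.  A
  triple \<open>(c, w, x)\<close> gives each word its number of children, the weight of the edge to its
  parent (irrelevant for the root \<open>[]\<close>) and its vertex weight.  Values at words that are not
  vertices of the tree are never used.\<close>

type_synonym uh_labels = "(nat list \<Rightarrow> nat) \<times> (nat list \<Rightarrow> real) \<times> (nat list \<Rightarrow> real)"

definition uh_verts :: "(nat list \<Rightarrow> nat) \<Rightarrow> nat list set" where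
  "uh_verts c = {u. \<forall>k<length u. u ! k < c (take k u)}"

definition uh_graph :: "uh_labels \<Rightarrow> nat list wgraph" where
  "uh_graph = (\<lambda>(c, w, x).
     \<lparr> verts = uh_verts c,
       edges = {{butlast u, u} |u. u \<in> uh_verts c \<and> u \<noteq> []},
       ew = (\<lambda>e. w (THE u. u \<noteq> [] \<and> e = {butlast u, u})),
       vw = x,
       root = [] \<rparr>)"

definition ubgw_law :: "nat pmf \<Rightarrow> real measure \<Rightarrow> real measure \<Rightarrow> uh_labels measure" where
  "ubgw_law p \<omega> \<xi> =
     (\<Pi>\<^sub>M u\<in>UNIV. measure_pmf (if u = [] then p else size_biased p)) \<Otimes>\<^sub>M
     ((\<Pi>\<^sub>M u\<in>UNIV. \<omega>) \<Otimes>\<^sub>M (\<Pi>\<^sub>M u\<in>UNIV. \<xi>))"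

definition weighted_ubgw_tree ::
    "nat pmf \<Rightarrow> real measure \<Rightarrow> real measure \<Rightarrow> 's measure \<Rightarrow> ('s \<Rightarrow> uh_labels) \<Rightarrow> bool" where
  "weighted_ubgw_tree p \<omega> \<xi> M T \<longleftrightarrow>
     T \<in> measurable M (ubgw_law p \<omega> \<xi>) \<and> distr M (ubgw_law p \<omega> \<xi>) T = ubgw_law p \<omega> \<xi>"

lemma uh_verts_snoc: "u @ [i] \<in> uh_verts c \<longleftrightarrow> u \<in> uh_verts c \<and> i < c u"
  unfolding uh_verts_def by (simp add: nth_append less_Suc_eq all_conj_distrib)

lemma uh_edge_child_unique:
  assumes "u \<noteq> []" "v \<noteq> []" "{butlast u, u} = {butlast v, v}"
  shows "u = v"
proof (rule ccontr)
  assume "u \<noteq> v"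
  with assms(3) have "butlast u = v" "butlast v = u"
    by (auto simp: doubleton_eq_iff)
  then have "length u - 1 = length v" "length v - 1 = length u"
    by (metis length_butlast)+
  with assms(1,2) show False
    by (cases u; cases v) auto
qed

lemma uh_edge_weight: "ew (uh_graph (c, w, x)) {u, u @ [i]} = w (u @ [i])"
proof -
  have "(THE v. v \<noteq> [] \<and> {u, u @ [i]} = {butlast v, v}) = u @ [i]"
  proof (rule the_equality)
    show "v = u @ [i]" if "v \<noteq> [] \<and> {u, u @ [i]} = {butlast v, v}" for v
      using that uh_edge_child_unique[of v "u @ [i]"] by simp
  qed simp
  then show ?thesis
    by (simp add: uh_graph_def)
qed

lemma weighted_graph_uh_graph: "weighted_graph (uh_graph L)"
proof -
  obtain c w x where L: "L = (c, w, x)" by (cases L) auto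
  have up: "butlast u \<in> uh_verts c" if "u \<in> uh_verts c" for u
    using that uh_verts_snoc[of "butlast u" "last u" c] by (cases "u = []") auto
  have "finite {e \<in> edges (uh_graph L). v \<in> e}" for v
  proof (rule finite_subset)
    show "{e \<in> edges (uh_graph L). v \<in> e} \<subseteq>
        insert {butlast v, v} ((\<lambda>i. {v, v @ [i]}) ` {..<c v})"
    proof
      fix e assume "e \<in> {e \<in> edges (uh_graph L). v \<in> e}"
      then obtain u where u: "e = {butlast u, u}" "u \<in> uh_verts c" "u \<noteq> []" "v \<in> e"
        by (auto simp: L uh_graph_def)
      from u(1,4) have "v = u \<or> v = butlast u"
        by blast
      then show "e \<in> insert {butlast v, v} ((\<lambda>i. {v, v @ [i]}) ` {..<c v})"
      proof
        assume "v = butlast u"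
        then have snoc: "u = v @ [last u]"
          using u(3) by simp
        with u(2) have "last u < c v"
          using uh_verts_snoc[of v "last u" c] by simp
        moreover have "e = {v, v @ [last u]}"
          using u(1) \<open>v = butlast u\<close> snoc by simp
        ultimately show ?thesis by blast
      qed (use u(1) in simp)
    qed
  qed auto
  moreover have "edges (uh_graph L) \<subseteq>
      {{u, v} |u v. u \<in> verts (uh_graph L) \<and> v \<in> verts (uh_graph L) \<and> u \<noteq> v}"
  proof
    fix e assume "e \<in> edges (uh_graph L)"
    then obtain u where u: "e = {butlast u, u}" "u \<in> uh_verts c" "u \<noteq> []"
      by (auto simp: L uh_graph_def)
    moreover have "butlast u \<noteq> u"
      using u(3) by (cases u rule: rev_cases) auto
    ultimately show "e \<in> {{u, v} |u v. u \<in> verts (uh_graph L) \<and> v \<in> verts (uh_graph L) \<and> u \<noteq> v}"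
      using up by (auto simp: L uh_graph_def)
  qed
  ultimately show ?thesis
    by (auto simp: weighted_graph_def L uh_graph_def uh_verts_def)
qed

end

theory Submission
  imports Defs "HOL-Library.Sublist"
begin

text \<open>The gain \<open>z(u)\<close> brought by leaving a vertex \<open>u\<close> available to its own subtree satisfies
  \<open>z(u) = max(x(u), max\<^sub>i(w(ui) - z(ui)))\<close>.  Iterating this antitone recursion from the leaves at depth
  \<open>n\<close> gives increasing lower bounds for even \<open>n\<close> and decreasing upper bounds for odd \<open>n\<close>, whatever lies
  beyond depth \<open>n\<close>; their limits \<open>lo\<close> and \<open>up\<close> are exchanged by the recursion.  If \<open>lo = up\<close> and
  there are no ties, then every optimum of a finite graph that looks like the tree near the root makes the same
  choice at each vertex, namely the best one for the common limit, which yields the limiting configuration.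

  That \<open>lo = up\<close> almost surely is shown on the level of laws.  Let \<open>a\<close> and \<open>b\<close> be the
  distribution functions of \<open>w - up\<close> and \<open>w - lo\<close>, so \<open>b \<le> a\<close>.  Both probabilities that a
  root with offspring law \<open>\<pi>\<close> is matched, computed with \<open>up\<close> or with \<open>lo\<close> at its children,
  equal \<open>E P(w > lo + up)\<close> with independent \<open>w\<close>, \<open>lo\<close>, \<open>up\<close>, because
  size-biasing turns the matched child into a uniformly chosen edge.  Hence \<open>a = b\<close> on the support of
  \<open>\<xi>\<close>, in particular at its minimum \<open>m\<close>.  The recursion propagates the equality from
  \<open>t\<close> to \<open>w - t > m\<close> for every \<open>w\<close> in the support of \<open>\<omega>\<close>, and since this
  support contains an interval below its maximum, the equality reaches all relevant \<open>t\<close>.\<close>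

section \<open>The fixed point equation for laws\<close>

text \<open>On a fixed tree \<open>lo\<close> and \<open>up\<close> may well differ: on an infinite
  path with all w = 1 and x = 0 they are 0 and 1. Only randomness can exclude such a two-cycle of
  the antitone recursion. Equality of the two matching probabilities is one scalar identity; it
  becomes an identity of functions because \<open>b \<le> a\<close> gives the difference of the
  integrands a sign. The propagation has to stay above \<open>m\<close> because the distribution
  function of a message contains that of \<open>\<xi>\<close> as a factor: where this factor
  vanishes, equal messages say nothing about \<open>a\<close> and \<open>b\<close>. Non-root
  vertices share one law and the root does not, so \<open>lo = up\<close> is proved off the root
  only. This suffices, since choices are made from the root downwards and consult only messages of
  children. Uniqueness needs its own construction: a limit is constrained only through approximating
  sequences, so one with measurable optima has to be exhibited. Truncations of the tree, copied into
  the naturals, provide it, and almost surely distinct edge weights prevent isomorphisms of balls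
  from permuting edges.\<close>

definition gf :: "nat pmf \<Rightarrow> real \<Rightarrow> real" where
  "gf q s = measure_pmf.expectation q (\<lambda>k. s ^ k)"

lemma integrable_pmf_power:
  fixes s :: real
  assumes "0 \<le> s" "s \<le> 1"
  shows "integrable (measure_pmf q) (\<lambda>k. s ^ k)"
  by (rule measure_pmf.integrable_const_bound[where B = 1])
    (use assms in \<open>auto intro!: power_le_one\<close>)

lemma gf_nonneg: "0 \<le> s \<Longrightarrow> 0 \<le> gf q s"
  unfolding gf_def by (rule integral_nonneg_AE) auto

lemma gf_mono: "0 \<le> s \<Longrightarrow> s \<le> t \<Longrightarrow> t \<le> 1 \<Longrightarrow> gf q s \<le> gf q t"
  unfolding gf_def by (rule integral_mono) (auto intro!: integrable_pmf_power power_mono)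

lemma gf_le_1: "0 \<le> s \<Longrightarrow> s \<le> 1 \<Longrightarrow> gf q s \<le> 1"
  using gf_mono[of s 1 q] by (simp add: gf_def)

lemma ennreal_gf:
  assumes "0 \<le> s" "s \<le> 1"
  shows "ennreal (gf q s) = (\<Sum>k. ennreal (pmf q k * s ^ k))"
proof -
  have "ennreal (gf q s) = (\<integral>\<^sup>+ k. ennreal (s ^ k) \<partial>measure_pmf q)"
    unfolding gf_def using assms
    by (subst nn_integral_eq_integral) (auto intro!: integrable_pmf_power)
  then show ?thesis
    using assms by (simp add: nn_integral_measure_pmf nn_integral_count_space_nat ennreal_mult)
qed

text \<open>The nonnegative variable \<open>t ^ k - s ^ k\<close> has mean 0, so it vanishes at
  every point of the support; one positive exponent there allows a root to be taken.\<close>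

lemma gf_eq_imp_eq:
  assumes "0 \<le> s" "s \<le> t" "t \<le> 1" "gf q s = gf q t" "k \<in> set_pmf q" "0 < k"
  shows "s = t"
proof -
  have int: "integrable (measure_pmf q) (\<lambda>k. t ^ k - s ^ k)"
    using assms by (intro Bochner_Integration.integrable_diff integrable_pmf_power) auto
  have "(\<integral>k. t ^ k - s ^ k \<partial>measure_pmf q) = 0"
    using assms(4) unfolding gf_def
    by (subst Bochner_Integration.integral_diff) (use assms in \<open>auto intro!: integrable_pmf_power\<close>)
  then have "AE k in measure_pmf q. t ^ k - s ^ k = 0"
    using integral_nonneg_eq_0_iff_AE[OF int] assms(1,2) by (auto simp: power_mono)
  then have "t ^ k = s ^ k"
    using assms(5) by (auto simp: AE_measure_pmf_iff)
  then show ?thesis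
    using assms power_eq_imp_eq_base[of s k t] by auto
qed

text \<open>The proof transports \<open>\<alpha>\<close> to the unit interval by the quantile function of its distribution
  function, which is a right inverse because there are no atoms.\<close>

lemma nn_integral_power_cdf:
  assumes "real_distribution \<alpha>" and atomless: "\<And>x. measure \<alpha> {x} = 0"
  shows "(\<integral>\<^sup>+ s. ennreal (real (Suc k) * cdf \<alpha> s ^ k) * indicator {x<..} s \<partial>\<alpha>) =
    ennreal (1 - cdf \<alpha> x ^ Suc k)"
proof -
  interpret cdf_distribution \<alpha>
    using assms(1) by (simp add: cdf_distribution_def)
  have cdf01: "0 \<le> C y" "C y \<le> 1" for y
    using cdf_nonneg[of y] cdf_bounded_prob[of y] by auto
  \<comment> \<open>One inequality is the Galois property of the quantile. For the other,
    \<open>C\<close> is at most \<open>r\<close> to the left of \<open>I r\<close>, and without an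
    atom the left limit at \<open>I r\<close> is the value there.\<close>
  have inv: "C (I r) = r" if r: "0 < r" "r < 1" for r
  proof (rule antisym)
    show "r \<le> C (I r)" by (rule pseudoinverse[OF r, THEN iffD2]) (rule order_refl)
    have "\<forall>\<^sub>F y in at_left (I r). C y \<le> r"
      unfolding eventually_at_left_field
    proof (intro exI[of _ "I r - 1"] conjI allI impI)
      fix y assume "y < I r"
      then show "C y \<le> r" using pseudoinverse[OF r, of y] by linarith
    qed simp
    then have "measure \<alpha> {..<I r} \<le> r"
      by (rule tendsto_upperbound[OF cdf_at_left]) simp
    moreover have "C (I r) = measure \<alpha> {..<I r} + measure \<alpha> {I r}"
      unfolding cdf_def ivl_disj_un(2)[symmetric] by (rule finite_measure_Union) auto
    ultimately show "C (I r) \<le> r" using atomless by simp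
  qed
  have "(\<integral>\<^sup>+ s. ennreal (real (Suc k) * C s ^ k) * indicator {x<..} s \<partial>\<alpha>) =
      (\<integral>\<^sup>+ r. ennreal (real (Suc k) * C (I r) ^ k) * indicator {x<..} (I r)
         \<partial>restrict_space lborel {0<..<1})"
    by (subst distr_I_eq_M[symmetric], subst nn_integral_distr) auto
  also have "\<dots> = (\<integral>\<^sup>+ r. ennreal (real (Suc k) * C (I r) ^ k) * indicator {x<..} (I r)
         * indicator {0<..<1} r \<partial>lborel)"
    by (subst nn_integral_restrict_space) auto
  also have "\<dots> = (\<integral>\<^sup>+ r. ennreal (real (Suc k) * r ^ k) * indicator {C x..1} r \<partial>lborel)"
  proof (rule nn_integral_cong_AE)
    \<comment> \<open>The excluded points are those where open and closed ends differ: 0 and 1 bound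
      the domain of the quantile, and \<open>x < I r\<close> is the strict inequality
      \<open>C x < r\<close>.\<close>
    show "AE r in lborel. ennreal (real (Suc k) * C (I r) ^ k) * indicator {x<..} (I r)
         * indicator {0<..<1} r = ennreal (real (Suc k) * r ^ k) * indicator {C x..1} r"
      using AE_lborel_singleton[of 0] AE_lborel_singleton[of 1] AE_lborel_singleton[of "C x"]
    proof eventually_elim
      case (elim r)
      show ?case
      proof (cases "0 < r \<and> r < 1")
        case True
        then have "x < I r \<longleftrightarrow> C x < r"
          using pseudoinverse[of r x] by linarith
        then show ?thesis
          using True elim inv[of r] by (auto simp: indicator_def)
      next
        case False
        then show ?thesis
          using elim cdf01[of x] by (auto simp: indicator_def)
      qed
    qed
  qed
  also have "\<dots> = ennreal (1 ^ Suc k - C x ^ Suc k)"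
  proof (rule nn_integral_FTC_Icc)
    show "((\<lambda>r. r ^ Suc k) has_real_derivative real (Suc k) * r ^ k) (at r)" for r
      using DERIV_pow[of "Suc k" r UNIV] by simp
  qed (use cdf01[of x] in \<open>auto intro: order_trans[OF cdf01(1)[of x]]\<close>)
  finally show ?thesis by simp
qed

section \<open>Laws of offers \<open>w - z\<close> and the size-biasing identity\<close>

definition diff_law :: "real measure \<Rightarrow> real measure \<Rightarrow> real measure" where
  "diff_law \<omega> \<nu> = distr (\<omega> \<Otimes>\<^sub>M \<nu>) borel (\<lambda>(w, z). w - z)"

lemma real_distribution_diff_law:
  assumes "real_distribution \<omega>" "real_distribution \<nu>"
  shows "real_distribution (diff_law \<omega> \<nu>)"
proof -
  interpret \<omega>: real_distribution \<omega> by fact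
  interpret \<nu>: real_distribution \<nu> by fact
  interpret P: pair_prob_space \<omega> \<nu> ..
  show ?thesis unfolding diff_law_def by (rule P.real_distribution_distr) measurable
qed

lemma emeasure_diff_law:
  assumes "real_distribution \<omega>" "real_distribution \<nu>" "A \<in> sets borel"
  shows "emeasure (diff_law \<omega> \<nu>) A = (\<integral>\<^sup>+ z. emeasure \<omega> {w. w - z \<in> A} \<partial>\<nu>)"
    and "emeasure (diff_law \<omega> \<nu>) A = (\<integral>\<^sup>+ w. emeasure \<nu> {z. w - z \<in> A} \<partial>\<omega>)"
proof -
  interpret \<omega>: real_distribution \<omega> by fact
  interpret \<nu>: real_distribution \<nu> by fact
  interpret P: pair_prob_space \<omega> \<nu> ..
  note [measurable] = assms(3)
  have "{p. (case p of (w, z) \<Rightarrow> w - z) \<in> A} \<in> sets (\<omega> \<Otimes>\<^sub>M \<nu>)"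
  proof -
    have "{p \<in> space (\<omega> \<Otimes>\<^sub>M \<nu>). (case p of (w, z) \<Rightarrow> w - z) \<in> A} \<in> sets (\<omega> \<Otimes>\<^sub>M \<nu>)"
      by measurable
    then show ?thesis by (simp add: space_pair_measure)
  qed
  moreover have "emeasure (diff_law \<omega> \<nu>) A =
      emeasure (\<omega> \<Otimes>\<^sub>M \<nu>) {p. (case p of (w, z) \<Rightarrow> w - z) \<in> A}"
    unfolding diff_law_def by (subst emeasure_distr) (auto simp: space_pair_measure vimage_def)
  ultimately show "emeasure (diff_law \<omega> \<nu>) A = (\<integral>\<^sup>+ z. emeasure \<omega> {w. w - z \<in> A} \<partial>\<nu>)"
    and "emeasure (diff_law \<omega> \<nu>) A = (\<integral>\<^sup>+ w. emeasure \<nu> {z. w - z \<in> A} \<partial>\<omega>)"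
    using P.emeasure_pair_measure_alt2[of "{p. (case p of (w, z) \<Rightarrow> w - z) \<in> A}"]
      \<nu>.emeasure_pair_measure_alt[of "{p. (case p of (w, z) \<Rightarrow> w - z) \<in> A}" \<omega>]
    by (auto simp: vimage_def)
qed

text \<open>For a fixed subtrahend the difference hits \<open>x\<close> at one weight only, which is
  no atom of \<open>\<omega>\<close>. This gives the continuity of the distribution functions and,
  later, the absence of ties.\<close>

lemma diff_law_atomless:
  assumes "real_distribution \<omega>" "real_distribution \<nu>" "atoms \<omega> = {}"
  shows "measure (diff_law \<omega> \<nu>) {x} = 0"
proof -
  have "emeasure \<omega> {y} = 0" for y
    using assms(3) by (auto simp: atoms_def zero_less_iff_neq_zero)
  moreover have "{w. w - z = x} = {z + x}" for z by auto
  ultimately have "emeasure (diff_law \<omega> \<nu>) {x} = 0"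
    using emeasure_diff_law(1)[OF assms(1,2), of "{x}"] by simp
  then show ?thesis by (simp add: measure_def)
qed

lemma measure_lessThan_eq_cdf:
  assumes "real_distribution \<alpha>" "measure \<alpha> {x} = 0"
  shows "measure \<alpha> {..<x} = cdf \<alpha> x"
proof -
  interpret real_distribution \<alpha> by fact
  have "measure \<alpha> ({..<x} \<union> {x}) = measure \<alpha> {..<x} + measure \<alpha> {x}"
    by (rule finite_measure_Union) auto
  then show ?thesis using assms(2) by (simp only: cdf_def ivl_disj_un(2) add_0_right)
qed

text \<open>The fixed point equations are stated for mass strictly below a point, and
  \<open>w - z \<le> t\<close> is the complement of \<open>z < w - t\<close>.\<close>

lemma cdf_diff_law:
  assumes "real_distribution \<omega>" "real_distribution \<nu>"
  shows "cdf (diff_law \<omega> \<nu>) t = (\<integral> w. 1 - measure \<nu> {..<w - t} \<partial>\<omega>)"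
proof -
  interpret \<omega>: real_distribution \<omega> by fact
  interpret \<nu>: real_distribution \<nu> by fact
  have *: "emeasure \<nu> {z. w - z \<in> {..t}} = ennreal (1 - measure \<nu> {..<w - t})" for w
  proof -
    have "{z. w - z \<in> {..t}} = space \<nu> - {..<w - t}" by auto
    then show ?thesis
      using \<nu>.prob_compl[of "{..<w - t}"] by (simp add: \<nu>.emeasure_eq_measure)
  qed
  have "mono (\<lambda>w. measure \<nu> {..<w - t})"
    by (intro monoI \<nu>.finite_measure_mono) auto
  then have [measurable]: "(\<lambda>w. measure \<nu> {..<w - t}) \<in> borel_measurable borel"
    by (rule borel_measurable_mono)
  show ?thesis
    using emeasure_diff_law(2)[OF assms, of "{..t}"]
    unfolding * cdf_def measure_def[of "diff_law \<omega> \<nu>"]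
    by (subst integral_eq_nn_integral) (auto simp: \<nu>.prob_le_1)
qed

text \<open>Among \<open>k\<close> independent variables of law \<open>\<alpha>\<close>, condition
  on the largest, with value \<open>s\<close> beyond \<open>x\<close>: there are \<open>k\<close>
  choices for it, and the other k - 1 stay below \<open>s\<close>. The weight
  \<open>k * pmf p k\<close> is the mean times the size-biased mass at k - 1, so the remaining
  children look like the offspring of a non-root vertex.\<close>

lemma one_minus_gf:
  assumes "integrable (measure_pmf p) real" "0 < measure_pmf.expectation p real"
    and "real_distribution \<alpha>" and atomless: "\<And>x. measure \<alpha> {x} = 0"
  shows "ennreal (1 - gf p (cdf \<alpha> x)) = (\<integral>\<^sup>+ s. ennreal (measure_pmf.expectation p real) *
      ennreal (gf (size_biased p) (cdf \<alpha> s)) * indicator {x<..} s \<partial>\<alpha>)"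
proof -
  interpret cdf_distribution \<alpha>
    using assms(3) by (simp add: cdf_distribution_def)
  let ?E = "measure_pmf.expectation p real"
  have cdf01: "0 \<le> C y" "C y \<le> 1" for y
    using cdf_nonneg[of y] cdf_bounded_prob[of y] by auto
  have pow1: "C y ^ k \<le> 1" for y k
    using cdf01 by (simp add: power_le_one)
  have "1 - gf p (C x) = measure_pmf.expectation p (\<lambda>k. 1 - C x ^ k)"
    unfolding gf_def using cdf01
    by (subst Bochner_Integration.integral_diff) (auto intro!: integrable_pmf_power)
  then have "ennreal (1 - gf p (C x)) = (\<integral>\<^sup>+ k. ennreal (1 - C x ^ k) \<partial>measure_pmf p)"
    using pow1 cdf01
    by (subst nn_integral_eq_integral) (auto intro!: integrable_pmf_power)
  also have "\<dots> = (\<Sum>k. ennreal (pmf p k) * ennreal (1 - C x ^ k))"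
    by (simp add: nn_integral_measure_pmf nn_integral_count_space_nat)
  \<comment> \<open>The term of index 0 vanishes, so nothing is lost by the shift, which matches the
    one in \<open>size_biased\<close>.\<close>
  also have "\<dots> = (\<Sum>k. ennreal (pmf p (Suc k)) * ennreal (1 - C x ^ Suc k))"
    using suminf_offset[of "\<lambda>k. ennreal (pmf p k) * ennreal (1 - C x ^ k)" 1] by simp
  also have "\<dots> = (\<Sum>k. \<integral>\<^sup>+ s. ennreal (pmf p (Suc k)) *
      (ennreal (real (Suc k) * C s ^ k) * indicator {x<..} s) \<partial>\<alpha>)"
    unfolding nn_integral_power_cdf[OF assms(3,4), symmetric]
    by (subst nn_integral_cmult) auto
  also have "\<dots> = (\<integral>\<^sup>+ s. (\<Sum>k. ennreal (pmf p (Suc k)) *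
      (ennreal (real (Suc k) * C s ^ k) * indicator {x<..} s)) \<partial>\<alpha>)"
    by (subst nn_integral_suminf) auto
  also have "\<dots> = (\<integral>\<^sup>+ s. ennreal ?E * ennreal (gf (size_biased p) (C s)) * indicator {x<..} s \<partial>\<alpha>)"
  proof (rule nn_integral_cong)
    fix s
    have "ennreal ?E * ennreal (gf (size_biased p) (C s)) =
        (\<Sum>k. ennreal ?E * ennreal (pmf (size_biased p) k * C s ^ k))"
      using ennreal_gf[OF cdf01[of s]] by simp
    also have "\<dots> = (\<Sum>k. ennreal (pmf p (Suc k)) * ennreal (real (Suc k) * C s ^ k))"
      using assms(2) cdf01[of s]
      by (intro suminf_cong)
        (simp add: pmf_size_biased[OF assms(1,2)] mult_ac flip: ennreal_mult)
    finally show "(\<Sum>k. ennreal (pmf p (Suc k)) *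
      (ennreal (real (Suc k) * C s ^ k) * indicator {x<..} s)) =
      ennreal ?E * ennreal (gf (size_biased p) (C s)) * indicator {x<..} s"
      by (simp split: split_indicator)
  qed
  finally show ?thesis .
qed


text \<open>Mass transport: the left-hand side is the probability that a vertex with offspring law \<open>p\<close>
  is matched downwards, and the right-hand side counts the edges along which this happens.\<close>

lemma mass_transport:
  assumes p: "integrable (measure_pmf p) real" "0 < measure_pmf.expectation p real"
    and rd: "real_distribution \<omega>" "real_distribution \<xi>" "real_distribution \<mu>" "real_distribution \<nu>"
    and "atoms \<omega> = {}"
    and \<mu>: "\<And>t. measure \<mu> {..<t} =
      measure \<xi> {..<t} * gf (size_biased p) (cdf (diff_law \<omega> \<nu>) t)"
  shows "(\<integral>\<^sup>+ x. ennreal (1 - gf p (cdf (diff_law \<omega> \<nu>) x)) \<partial>\<xi>) =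
    ennreal (measure_pmf.expectation p real) *
      (\<integral>\<^sup>+ w. emeasure (\<nu> \<Otimes>\<^sub>M \<mu>) {(y, z). y + z < w} \<partial>\<omega>)"
proof -
  let ?\<alpha> = "diff_law \<omega> \<nu>"
  let ?E = "measure_pmf.expectation p real"
  interpret \<omega>: real_distribution \<omega> by fact
  interpret \<xi>: real_distribution \<xi> by fact
  interpret \<mu>: real_distribution \<mu> by fact
  interpret \<nu>: real_distribution \<nu> by fact
  interpret \<alpha>: cdf_distribution ?\<alpha>
    using real_distribution_diff_law[OF rd(1,4)] by (simp add: cdf_distribution_def)
  interpret X: pair_prob_space \<xi> ?\<alpha> ..
  interpret P: pair_prob_space \<nu> \<mu> ..
  note atomless = diff_law_atomless[OF rd(1,4) assms(7)]
  have cdf01: "0 \<le> cdf ?\<alpha> y" "cdf ?\<alpha> y \<le> 1" for y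
    using \<alpha>.cdf_nonneg[of y] \<alpha>.cdf_bounded_prob[of y] by auto
  have gf_meas [measurable]: "(\<lambda>s. gf (size_biased p) (cdf ?\<alpha> s)) \<in> borel_measurable borel"
    by (intro borel_measurable_mono monoI gf_mono cdf01 \<alpha>.cdf_nondecreasing)
  have "mono (\<lambda>w. measure \<mu> {..<w})"
    by (intro monoI \<mu>.finite_measure_mono) auto
  then have [measurable]: "(\<lambda>w. measure \<mu> {..<w}) \<in> borel_measurable borel"
    by (rule borel_measurable_mono)
  have "(\<integral>\<^sup>+ x. ennreal (1 - gf p (cdf ?\<alpha> x)) \<partial>\<xi>) = (\<integral>\<^sup>+ x. \<integral>\<^sup>+ s. ennreal ?E *
      ennreal (gf (size_biased p) (cdf ?\<alpha> s)) * indicator {p. fst p < snd p} (x, s) \<partial>?\<alpha> \<partial>\<xi>)"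
    by (simp add: one_minus_gf[OF p \<alpha>.real_distribution_axioms atomless] indicator_def)
  also have "\<dots> = (\<integral>\<^sup>+ s. \<integral>\<^sup>+ x. ennreal ?E *
      ennreal (gf (size_biased p) (cdf ?\<alpha> s)) * indicator {p. fst p < snd p} (x, s) \<partial>\<xi> \<partial>?\<alpha>)"
    by (rule X.Fubini'[symmetric]) measurable
  also have "\<dots> = (\<integral>\<^sup>+ s. ennreal ?E * ennreal (gf (size_biased p) (cdf ?\<alpha> s)) *
      emeasure \<xi> {..<s} \<partial>?\<alpha>)"
  proof (rule nn_integral_cong)
    fix s
    have "indicator {p. fst p < snd p} (x, s) = (indicator {..<s} x :: ennreal)" for x :: real
      by (simp add: indicator_def)
    then show "(\<integral>\<^sup>+ x. ennreal ?E * ennreal (gf (size_biased p) (cdf ?\<alpha> s)) *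
        indicator {p. fst p < snd p} (x, s) \<partial>\<xi>) =
      ennreal ?E * ennreal (gf (size_biased p) (cdf ?\<alpha> s)) * emeasure \<xi> {..<s}"
      by (simp add: nn_integral_cmult_indicator)
  qed
  \<comment> \<open>Here the vertex weight and all remaining offers lie below \<open>s\<close>; by
    the fixed point equation this has the probability that a message of law \<open>\<mu>\<close>
    lies below \<open>s\<close>.\<close>
  also have "\<dots> = (\<integral>\<^sup>+ s. ennreal ?E * ennreal (measure \<mu> {..<s}) \<partial>?\<alpha>)"
    using p(2) cdf01
    by (simp add: \<mu> \<xi>.emeasure_eq_measure ennreal_mult gf_nonneg mult_ac)
  also have "\<dots> = ennreal ?E * (\<integral>\<^sup>+ s. ennreal (measure \<mu> {..<s}) \<partial>?\<alpha>)"
    by (subst nn_integral_cmult) auto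
  also have "(\<integral>\<^sup>+ s. ennreal (measure \<mu> {..<s}) \<partial>?\<alpha>) =
      (\<integral>\<^sup>+ w. \<integral>\<^sup>+ y. ennreal (measure \<mu> {..<w - y}) \<partial>\<nu> \<partial>\<omega>)"
    unfolding diff_law_def
    by (subst nn_integral_distr)
      (auto simp: case_prod_beta \<nu>.nn_integral_fst[symmetric])
  also have "\<dots> = (\<integral>\<^sup>+ w. emeasure (\<nu> \<Otimes>\<^sub>M \<mu>) {(y, z). y + z < w} \<partial>\<omega>)"
  proof (rule nn_integral_cong)
    fix w
    have "{p \<in> space (\<nu> \<Otimes>\<^sub>M \<mu>). fst p + snd p < w} \<in> sets (\<nu> \<Otimes>\<^sub>M \<mu>)" by measurable
    then have "{(y, z). y + z < w} \<in> sets (\<nu> \<Otimes>\<^sub>M \<mu>)"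
      by (simp add: space_pair_measure case_prod_unfold)
    from \<mu>.emeasure_pair_measure_alt[OF this]
    have "emeasure (\<nu> \<Otimes>\<^sub>M \<mu>) {(y, z). y + z < w} = (\<integral>\<^sup>+ y. emeasure \<mu> {z. y + z < w} \<partial>\<nu>)"
      by (simp add: vimage_def)
    moreover have "{z. y + z < w} = {..<w - y}" for y by auto
    ultimately show "(\<integral>\<^sup>+ y. ennreal (measure \<mu> {..<w - y}) \<partial>\<nu>) =
        emeasure (\<nu> \<Otimes>\<^sub>M \<mu>) {(y, z). y + z < w}"
      by (simp add: \<mu>.emeasure_eq_measure)
  qed
  finally show ?thesis .
qed

text \<open>The right-hand side of \<open>mass_transport\<close> depends on the laws at the two ends
  of an edge only through this quantity. Its symmetry is what equates the two matching
  probabilities.\<close>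

lemma emeasure_pair_measure_sum_commute:
  assumes "real_distribution \<mu>" "real_distribution \<nu>"
  shows "emeasure (\<nu> \<Otimes>\<^sub>M \<mu>) {(y, z). y + z < w} = emeasure (\<mu> \<Otimes>\<^sub>M \<nu>) {(y, z). y + z < (w::real)}"
proof -
  interpret \<mu>: real_distribution \<mu> by fact
  interpret \<nu>: real_distribution \<nu> by fact
  interpret P: pair_prob_space \<nu> \<mu> ..
  interpret Q: pair_prob_space \<mu> \<nu> ..
  have "{p \<in> space (\<mu> \<Otimes>\<^sub>M \<nu>). fst p + snd p < w} \<in> sets (\<mu> \<Otimes>\<^sub>M \<nu>)" by measurable
  then have "{(y, z). y + z < w} \<in> sets (\<mu> \<Otimes>\<^sub>M \<nu>)"
    by (simp add: space_pair_measure case_prod_unfold)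
  moreover have "{p \<in> space (\<nu> \<Otimes>\<^sub>M \<mu>). fst p + snd p < w} \<in> sets (\<nu> \<Otimes>\<^sub>M \<mu>)" by measurable
  then have "{(y, z). y + z < w} \<in> sets (\<nu> \<Otimes>\<^sub>M \<mu>)"
    by (simp add: space_pair_measure case_prod_unfold)
  ultimately show ?thesis
    using P.emeasure_pair_measure_alt2[of "{(y, z). y + z < w}"]
      \<nu>.emeasure_pair_measure_alt[of "{(y, z). y + z < w}" \<mu>]
    by (simp add: vimage_def add.commute)
qed

text \<open>By continuity the points of \<open>U\<close> where \<open>f\<close> and \<open>g\<close>
  differ form an open set, and an open set that meets the support has positive mass. The set
  \<open>U\<close> allows a comparison only where the recursion is informative.\<close>

lemma msupport_eqI_AE:
  fixes f g :: "real \<Rightarrow> real"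
  assumes "AE x in \<mu>. x \<in> U \<longrightarrow> f x = g x" "open U" "sets \<mu> = sets borel"
    and "continuous_on U f" "continuous_on U g" and t: "t \<in> msupport \<mu>" "t \<in> U"
  shows "f t = g t"
proof (rule ccontr)
  assume "f t \<noteq> g t"
  let ?N = "{x \<in> U. f x - g x \<in> - {0}}"
  have "open ((\<lambda>x. f x - g x) -` (- {0}) \<inter> U)"
    using continuous_on_diff[OF assms(4,5)] unfolding continuous_on_open_vimage[OF assms(2)]
    by blast
  then have "open ?N" by (simp add: vimage_def Int_def conj_commute)
  then have "0 < emeasure \<mu> ?N"
    using t \<open>f t \<noteq> g t\<close> by (auto simp: msupport_def)
  moreover have "?N \<in> sets \<mu>" using \<open>open ?N\<close> assms(3) by simp
  then have "emeasure \<mu> ?N = 0"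
    using assms(1) by (subst (asm) AE_iff_measurable[where N = ?N])
      (use sets_eq_imp_space_eq[OF assms(3)] in auto)
  ultimately show False by simp
qed

text \<open>The complement of the support is a union of open null sets, and by Lindelof countably
  many of them suffice.\<close>

lemma AE_msupport:
  assumes "real_distribution \<mu>"
  shows "AE x in \<mu>. x \<in> msupport \<mu>"
proof -
  interpret real_distribution \<mu> by fact
  define F where "F = {U. open U \<and> emeasure \<mu> U = 0}"
  obtain F' where F': "F' \<subseteq> F" "countable F'" "\<Union>F' = \<Union>F"
    using Lindelof[of F] by (auto simp: F_def)
  have "AE x in \<mu>. \<forall>U\<in>F'. x \<notin> U"
    using F'(1,2) by (subst AE_ball_countable)
      (auto simp: F_def subset_iff intro!: AE_not_in null_setsI)
  then show ?thesis
  proof eventually_elim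
    case (elim x)
    then have "x \<notin> \<Union>F" using F'(3) by blast
    then show ?case by (auto simp: F_def msupport_def zero_less_iff_neq_zero)
  qed
qed


text \<open>Shifting twice by weights of the interval \<open>(a, M)\<close> moves a point of \<open>A\<close> by any amount less
  than \<open>M - a\<close>.\<close>

lemma reflection_closed_covers:
  fixes A :: "real set" and M :: ereal
  assumes "m \<in> A" "ereal a < M"
    and step: "\<And>t w. t \<in> A \<Longrightarrow> m < w - t \<Longrightarrow> a < w \<Longrightarrow> ereal w < M \<Longrightarrow> w - t \<in> A"
    and "m < s" "ereal (s + m) < M"
  shows "s \<in> A"
proof (cases "M = \<infinity>")
  case True
  \<comment> \<open>Reflect \<open>m\<close> by \<open>w\<close> and the result by
    \<open>s + (w - m)\<close>, which lands on \<open>s\<close>. The size of \<open>w\<close> puts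
    both weights above \<open>a\<close> and the first image above \<open>m\<close>.\<close>
  define w where "w = \<bar>a\<bar> + 2 * \<bar>m\<bar> + \<bar>s\<bar> + 1"
  have "w - m \<in> A"
    by (rule step) (use assms(1) True in \<open>auto simp: w_def\<close>)
  with step[of "w - m" "s + (w - m)"] have "(s + (w - m)) - (w - m) \<in> A"
    using assms(4) True by (simp add: w_def)
  then show ?thesis by simp
next
  case False
  with assms(2) obtain M' where M: "M = ereal M'"
    by (cases M) auto
  have aM: "a < M'" and sM: "s + m < M'"
    using assms(2,5) M by auto
  \<comment> \<open>Left ends of intervals that reach up to \<open>M' - m\<close> inside
    \<open>A\<close>. Reflecting \<open>m\<close> itself fills such an interval, so \<open>B\<close>
    is non-empty; it remains to see that its infimum is \<open>m\<close>.\<close>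
  define B where "B = {l. m < l \<and> l < M' - m \<and> (\<forall>r. l \<le> r \<and> r < M' - m \<longrightarrow> r \<in> A)}"
  have first: "r \<in> A" if "m < r" "a - m < r" "r < M' - m" for r
    using step[of m "r + m"] that assms(1) M by auto
  define l0 where "l0 = (max (max m (a - m)) s + (M' - m)) / 2"
  have l0: "m < l0" "a - m < l0" "l0 < M' - m" "s < l0"
    using aM sM assms(4) by (auto simp: l0_def max_def field_simps split: if_splits)
  have "l0 \<in> B"
    using l0 first by (auto simp: B_def)
  define L where "L = Inf B"
  have bdd: "bdd_below B" by (auto simp: B_def intro!: bdd_belowI[of _ m])
  have L: "m \<le> L" "L \<le> l0"
    unfolding L_def using \<open>l0 \<in> B\<close> bdd by (auto simp: B_def intro!: cInf_greatest cInf_lower)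
  have inA: "r \<in> A" if "L < r" "r < M' - m" for r
  proof -
    obtain l where "l \<in> B" "l < r"
      using \<open>L < r\<close> \<open>l0 \<in> B\<close> bdd unfolding L_def by (subst (asm) cInf_less_iff) auto
    then show ?thesis using that by (auto simp: B_def)
  qed
  have "L = m"
  proof (rule ccontr)
    assume "L \<noteq> m"
    then have "m < L" using L by simp
    \<comment> \<open>Small enough that the window of radius \<open>d\<close> around
      \<open>L\<close> stays inside (m, M' - m) and that both reflections below use weights between
      \<open>a\<close> and \<open>M'\<close>. The window then extends the interval below its
      infimum.\<close>
    define d where "d = min (L - m) (min (M' - m - L) (M' - a)) / 4"
    have d: "0 < d" "4 * d \<le> L - m" "4 * d \<le> M' - m - L" "4 * d \<le> M' - a"
      using \<open>m < L\<close> L l0 aM by (auto simp: d_def min_def field_simps split: if_splits)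
    have near: "r \<in> A" if r: "L - d \<le> r" "r \<le> L + d" for r
    proof -
      define t where "t = L + d"
      have "t \<in> A" using d by (intro inA) (auto simp: t_def)
      \<comment> \<open>\<open>u\<close> is the image of \<open>t\<close> and then the base point
        for every \<open>r\<close> of the window. The constraints leave an open interval for it;
        this is the midpoint.\<close>
      define u where "u = max (a - L + d) m / 2 + (M' - L - d) / 2"
      have u: "a - L + d < u" "m < u" "u < M' - L - d"
        using d by (auto simp: u_def max_def field_simps split: if_splits)
      have "(u + t) - t \<in> A"
        using d u \<open>t \<in> A\<close> M by (intro step) (auto simp: t_def)
      then have "(r + u) - u \<in> A"
        using d u r M by (intro step) auto
      then show ?thesis by simp
    qed
    have "r \<in> A" if "L - d \<le> r" "r < M' - m" for r
      using near[of r] inA[of r] d that by (cases "r \<le> L + d") auto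
    then have "L - d \<in> B"
      using d by (auto simp: B_def)
    then have "L \<le> L - d" unfolding L_def by (rule cInf_lower[OF _ bdd])
    then show False using d by simp
  qed
  then show ?thesis
    using inA[of s] assms(4) sM by auto
qed


theorem alternating_fixed_point_unique:
  assumes p: "integrable (measure_pmf p) real" "0 < measure_pmf.expectation p real"
    and rd: "real_distribution \<omega>" "real_distribution \<xi>" "real_distribution \<mu>" "real_distribution \<nu>"
    and \<omega>: "atoms \<omega> = {}" "locally_convex_under_max \<omega>"
    and \<xi>: "bdd_below (msupport \<xi>)"
    and \<mu>: "\<And>t. measure \<mu> {..<t} =
      measure \<xi> {..<t} * gf (size_biased p) (cdf (diff_law \<omega> \<nu>) t)"
    and \<nu>: "\<And>t. measure \<nu> {..<t} =
      measure \<xi> {..<t} * gf (size_biased p) (cdf (diff_law \<omega> \<mu>) t)"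
    and le: "\<And>t. measure \<nu> {..<t} \<le> measure \<mu> {..<t}"
  shows "measure \<mu> {..<t} = measure \<nu> {..<t}"
\<comment> \<open>If non-root vertices have no children, \<open>gf\<close> is the constant 1 and
  cannot be inverted, but then both laws have the distribution function of
  \<open>\<xi>\<close>.\<close>
proof (cases "size_biased p = return_pmf 0")
  case True
  then show ?thesis by (simp add: \<mu> \<nu> gf_def)
next
  case False
  interpret \<omega>: real_distribution \<omega> by fact
  interpret \<xi>: real_distribution \<xi> by fact
  interpret \<mu>: real_distribution \<mu> by fact
  interpret \<nu>: real_distribution \<nu> by fact
  define a where "a = cdf (diff_law \<omega> \<nu>)"
  define b where "b = cdf (diff_law \<omega> \<mu>)"
  interpret a: real_distribution "diff_law \<omega> \<nu>" by (rule real_distribution_diff_law) fact+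
  interpret b: real_distribution "diff_law \<omega> \<mu>" by (rule real_distribution_diff_law) fact+
  have ab01: "0 \<le> a t" "a t \<le> 1" "0 \<le> b t" "b t \<le> 1" for t
    unfolding a_def b_def using a.cdf_nonneg b.cdf_nonneg a.cdf_bounded_prob b.cdf_bounded_prob
    by auto
  have cont: "continuous_on UNIV a" "continuous_on UNIV b"
    unfolding a_def b_def
    by (auto intro!: continuous_at_imp_continuous_on
        simp: a.isCont_cdf b.isCont_cdf diff_law_atomless rd \<omega>)
  have measN: "(\<lambda>w. measure \<nu> {..<w - t}) \<in> borel_measurable borel" for t
    by (intro borel_measurable_mono monoI \<nu>.finite_measure_mono) auto
  have measM: "(\<lambda>w. measure \<mu> {..<w - t}) \<in> borel_measurable borel" for t
    by (intro borel_measurable_mono monoI \<mu>.finite_measure_mono) auto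
  have intN: "integrable \<omega> (\<lambda>w. measure \<nu> {..<w - t})" for t
    by (rule \<omega>.integrable_const_bound[where B = 1]) (use measN in \<open>auto simp: \<nu>.prob_le_1\<close>)
  have intM: "integrable \<omega> (\<lambda>w. measure \<mu> {..<w - t})" for t
    by (rule \<omega>.integrable_const_bound[where B = 1]) (use measM in \<open>auto simp: \<mu>.prob_le_1\<close>)
  have diff: "a t - b t = (\<integral>w. measure \<mu> {..<w - t} - measure \<nu> {..<w - t} \<partial>\<omega>)" for t
    unfolding a_def b_def cdf_diff_law[OF rd(1,4)] cdf_diff_law[OF rd(1,3)]
    using intN intM by (simp add: \<omega>.prob_space)
  have ba: "b t \<le> a t" for t
  proof -
    have "0 \<le> (\<integral>w. measure \<mu> {..<w - t} - measure \<nu> {..<w - t} \<partial>\<omega>)"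
      using le by (intro integral_nonneg_AE) auto
    then show ?thesis using diff[of t] by simp
  qed
  have gf_ab: "a t = b t" if "gf q (a t) = gf q (b t)" "k \<in> set_pmf q" "0 < k" for q k t
    using gf_eq_imp_eq[of "b t" "a t" q k] that ba ab01 by auto
  \<comment> \<open>Two generating functions get inverted, that of \<open>p\<close> after the mass
    transport and that of \<open>size_biased p\<close> in the recursion; each law must charge a
    positive number of children.\<close>
  obtain k where "k \<in> set_pmf p" "0 < k"
  proof -
    have "\<not> (AE k in measure_pmf p. real k = 0)"
      using p(2) integral_cong_AE[of real "measure_pmf p" "\<lambda>_. 0"] by auto
    then show ?thesis using that by (auto simp: AE_measure_pmf_iff)
  qed
  note k = this
  obtain k' where k': "k' \<in> set_pmf (size_biased p)" "0 < k'"
    using False set_pmf_subset_singleton[of "size_biased p" 0] by auto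
  have "AE x in \<xi>. a x = b x"
  proof -
    have gm: "(\<lambda>x. gf p (a x)) \<in> borel_measurable borel" "(\<lambda>x. gf p (b x)) \<in> borel_measurable borel"
      by (auto intro!: borel_measurable_mono monoI gf_mono ab01
          simp: a_def b_def a.cdf_nondecreasing b.cdf_nondecreasing
            a.cdf_nonneg b.cdf_nonneg a.cdf_bounded_prob b.cdf_bounded_prob)
    have int: "integrable \<xi> (\<lambda>x. gf p (a x))" "integrable \<xi> (\<lambda>x. gf p (b x))"
      by (rule \<xi>.integrable_const_bound[where B = 1]; use gm in \<open>simp add: gf_nonneg gf_le_1 ab01\<close>)+
    have "(\<integral>\<^sup>+ x. ennreal (1 - gf p (a x)) \<partial>\<xi>) = (\<integral>\<^sup>+ x. ennreal (1 - gf p (b x)) \<partial>\<xi>)"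
      unfolding a_def b_def mass_transport[OF p rd \<omega>(1) \<mu>]
        mass_transport[OF p rd(1,2) rd(4,3) \<omega>(1) \<nu>]
      by (simp only: emeasure_pair_measure_sum_commute[OF rd(3,4)])
    then have "(\<integral>x. 1 - gf p (a x) \<partial>\<xi>) = (\<integral>x. 1 - gf p (b x) \<partial>\<xi>)"
      using gm by (simp add: integral_eq_nn_integral gf_le_1 ab01)
    then have "(\<integral>x. gf p (a x) - gf p (b x) \<partial>\<xi>) = 0"
      using int by (simp add: \<xi>.prob_space)
    then have "AE x in \<xi>. gf p (a x) - gf p (b x) = 0"
      using int by (subst (asm) integral_nonneg_eq_0_iff_AE) (auto intro!: gf_mono ab01 ba)
    then show ?thesis
      by eventually_elim (use k gf_ab in auto)
  qed
  then have on_supp: "a x = b x" if "x \<in> msupport \<xi>" for x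
    using msupport_eqI_AE[where \<mu> = \<xi> and U = UNIV and f = a and g = b and t = x] that cont by auto
  define m where "m = Inf (msupport \<xi>)"
  have ne: "msupport \<xi> \<noteq> {}"
  proof
    assume "msupport \<xi> = {}"
    then have "AE x in \<xi>. False" using AE_msupport[OF rd(2)] by simp
    then show False by (simp add: \<xi>.prob_space)
  qed
  have pos: "0 < measure \<xi> {..<s}" if ms: "m < s" for s
  proof -
    obtain x where "x \<in> msupport \<xi>" "x < s"
      using ms ne \<xi> unfolding m_def by (subst (asm) cInf_less_iff) auto
    then have "0 < emeasure \<xi> {..<s}"
      by (auto simp: msupport_def)
    then show ?thesis by (simp add: \<xi>.emeasure_eq_measure)
  qed
  have zero: "measure \<xi> {..<s} = 0" if "s \<le> m" for s
  proof -
    have "AE x in \<xi>. x \<notin> {..<s}"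
      using AE_msupport[OF rd(2)]
    proof eventually_elim
      case (elim x)
      then have "m \<le> x" unfolding m_def using \<xi> by (rule cInf_lower)
      then show ?case using that by simp
    qed
    then show ?thesis
      by (subst (asm) \<xi>.prob_eq_0[symmetric]) auto
  qed
  \<comment> \<open>The support contains its infimum, so \<open>a\<close> and \<open>b\<close> agree
    at \<open>m\<close>, where the propagation starts.\<close>
  have "m \<in> msupport \<xi>"
    unfolding msupport_def
  proof (intro CollectI allI impI)
    fix U :: "real set" assume U: "open U \<and> m \<in> U"
    then obtain e where e: "0 < e" "\<And>y. dist y m < e \<Longrightarrow> y \<in> U"
      by (auto simp: open_dist)
    obtain x where "x \<in> msupport \<xi>" "x < m + e"
      using e ne \<xi> unfolding m_def by (metis cInf_less_iff less_add_same_cancel1)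
    moreover have "m \<le> x"
      unfolding m_def using \<open>x \<in> msupport \<xi>\<close> \<xi> by (rule cInf_lower)
    ultimately show "0 < emeasure \<xi> U"
      using e U by (auto simp: msupport_def dist_real_def)
  qed
  \<comment> \<open>By \<open>diff\<close>, equality at \<open>t\<close> makes a nonnegative
    integrand vanish, so the laws of the messages agree at \<open>w - t\<close> for almost every
    \<open>w\<close>. For \<open>m < w - t\<close> the common factor from \<open>\<xi>\<close> is
    positive and can be cancelled before \<open>gf\<close> is inverted; continuity then reaches
    every \<open>w\<close> in the support.\<close>
  have step: "a (w - t) = b (w - t)" if t: "a t = b t" and w: "m < w - t" "w \<in> msupport \<omega>" for t w
  proof (rule msupport_eqI_AE[where \<mu> = \<omega> and U = "{w. m < w - t}" and f = "\<lambda>w. a (w - t)"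
        and g = "\<lambda>w. b (w - t)"])
    have "AE w in \<omega>. measure \<mu> {..<w - t} - measure \<nu> {..<w - t} = 0"
      using diff[of t] intM[of t] intN[of t] le t
      by (subst integral_nonneg_eq_0_iff_AE[symmetric]) auto
    then show "AE w in \<omega>. w \<in> {w. m < w - t} \<longrightarrow> a (w - t) = b (w - t)"
    proof eventually_elim
      case (elim w)
      show ?case
      proof
        assume "w \<in> {w. m < w - t}"
        then have "0 < measure \<xi> {..<w - t}" using pos by simp
        then show "a (w - t) = b (w - t)"
          using elim k' by (intro gf_ab) (auto simp: \<mu> \<nu> a_def b_def)
      qed
    qed
    show "open {w. m < w - t}" by (intro open_Collect_less continuous_intros)
    show "continuous_on {w. m < w - t} (\<lambda>w. a (w - t))" "continuous_on {w. m < w - t} (\<lambda>w. b (w - t))"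
      by (auto intro!: continuous_on_compose2[OF cont(1)] continuous_on_compose2[OF cont(2)]
          continuous_intros)
  qed (use w in auto)
  obtain a0 where a0: "ereal a0 < support_max \<omega>"
      "\<And>w. a0 < w \<Longrightarrow> ereal w < support_max \<omega> \<Longrightarrow> w \<in> msupport \<omega>"
    using \<omega>(2) unfolding locally_convex_under_max_def by blast
  show ?thesis
  proof (cases "t \<le> m")
    case True
    then show ?thesis by (simp add: \<mu> \<nu> zero)
  next
    case False
    have "a t = b t"
    proof (cases "ereal (t + m) < support_max \<omega>")
      case True
      have "t \<in> {t. a t = b t}"
        by (rule reflection_closed_covers[OF _ a0(1) _ _ True])
          (use False on_supp \<open>m \<in> msupport \<xi>\<close> step a0(2) in auto)
      then show ?thesis by simp
    next
      \<comment> \<open>Now every weight satisfies \<open>w - t \<le> m\<close>, where both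
        distribution functions vanish, so no propagation is required.\<close>
      case le_tm: False
      have "AE w in \<omega>. measure \<mu> {..<w - t} - measure \<nu> {..<w - t} = 0"
        using AE_msupport[OF rd(1)]
      proof eventually_elim
        case (elim w)
        then have "ereal w \<le> support_max \<omega>" unfolding support_max_def by (rule SUP_upper)
        also have "\<dots> \<le> ereal (t + m)" using le_tm by simp
        finally have "w - t \<le> m" by simp
        then show ?case by (simp add: \<mu> \<nu> zero)
      qed
      then have "(\<integral>w. measure \<mu> {..<w - t} - measure \<nu> {..<w - t} \<partial>\<omega>) = 0"
        by (rule integral_eq_zero_AE)
      then show ?thesis using diff[of t] by simp
    qed
    then show ?thesis by (simp add: \<mu> \<nu> a_def b_def)
  qed
qed

section \<open>Messages and exchanges\<close>

definition relax ::
    "(nat list \<Rightarrow> nat) \<Rightarrow> (nat list \<Rightarrow> real) \<Rightarrow> (nat list \<Rightarrow> real) \<Rightarrow>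
      (nat list \<Rightarrow> real) \<Rightarrow> nat list \<Rightarrow> real" where
  "relax c w x g u = Max (insert (x u) ((\<lambda>i. w (u @ [i]) - g (u @ [i])) ` {..<c u}))"

text \<open>\<open>msg c w x n u\<close> is the optimum of the subtree of \<open>u\<close> cut at depth \<open>n\<close> minus its optimum
  without \<open>u\<close>.\<close>

primrec msg ::
    "(nat list \<Rightarrow> nat) \<Rightarrow> (nat list \<Rightarrow> real) \<Rightarrow> (nat list \<Rightarrow> real) \<Rightarrow>
      nat \<Rightarrow> nat list \<Rightarrow> real" where
  "msg c w x 0 = x"
| "msg c w x (Suc n) = relax c w x (msg c w x n)"

definition lo where "lo c w x u = (SUP n. msg c w x (2 * n) u)"
definition up where "up c w x u = (INF n. msg c w x (Suc (2 * n)) u)"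

lemma relax_le_iff: "relax c w x g u \<le> t \<longleftrightarrow> x u \<le> t \<and> (\<forall>i<c u. w (u @ [i]) - g (u @ [i]) \<le> t)"
  unfolding relax_def by (subst Max_le_iff) auto

lemma relax_less_iff: "relax c w x g u < t \<longleftrightarrow> x u < t \<and> (\<forall>i<c u. w (u @ [i]) - g (u @ [i]) < t)"
  unfolding relax_def by (subst Max_less_iff) auto

lemma le_relax_vertex: "x u \<le> relax c w x g u"
  and le_relax_child: "i < c u \<Longrightarrow> w (u @ [i]) - g (u @ [i]) \<le> relax c w x g u"
  using relax_le_iff[of c w x g u "relax c w x g u"] by auto

lemma relax_cases:
  obtains "relax c w x g u = x u" | i where "i < c u" "relax c w x g u = w (u @ [i]) - g (u @ [i])"
proof -
  have "relax c w x g u \<in> insert (x u) ((\<lambda>i. w (u @ [i]) - g (u @ [i])) ` {..<c u})"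
    unfolding relax_def by (rule Max_in) auto
  then show ?thesis using that by auto
qed

lemma relax_antimono: "(\<And>u. g u \<le> h u) \<Longrightarrow> relax c w x h u \<le> relax c w x g u"
  unfolding relax_le_iff
  by (meson diff_left_mono le_relax_child le_relax_vertex order_trans)

lemma msg_ge: "x u \<le> msg c w x n u"
  by (cases n) (auto simp: le_relax_vertex)

text \<open>The message of index 0 is \<open>x\<close>, which lies below all messages. Applying the
  antitone recursion \<open>n\<close> times to this comparison flips it according to the parity of
  \<open>n\<close>.\<close>

lemma msg_alternating:
  "if even n then msg c w x n u \<le> msg c w x (n + k) u else msg c w x (n + k) u \<le> msg c w x n u"
proof (induction n arbitrary: u)
  case (Suc n)
  then show ?case by (cases "even n") (auto intro!: relax_antimono)
qed (simp add: msg_ge)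

lemma msg_even_mono: "even n \<Longrightarrow> n \<le> k \<Longrightarrow> msg c w x n u \<le> msg c w x k u"
  using msg_alternating[of n c w x u "k - n"] by simp

lemma msg_odd_antimono: "odd n \<Longrightarrow> n \<le> k \<Longrightarrow> msg c w x k u \<le> msg c w x n u"
  using msg_alternating[of n c w x u "k - n"] by simp

lemma msg_even_le_odd: "even n \<Longrightarrow> odd k \<Longrightarrow> msg c w x n u \<le> msg c w x k u"
  using msg_even_mono[of n k] msg_odd_antimono[of k n] by (cases "n \<le> k") auto

lemma bdd_msg:
  "bdd_above (range (\<lambda>n. msg c w x (2 * n) u))" "bdd_below (range (\<lambda>n. msg c w x (Suc (2 * n)) u))"
  by (rule bdd_aboveI2[of _ _ "msg c w x 1 u"], rule msg_even_le_odd; simp)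
    (rule bdd_belowI2[of _ "msg c w x 0 u"], rule msg_even_le_odd; simp)

lemma msg_tendsto_lo: "(\<lambda>n. msg c w x (2 * n) u) \<longlonglongrightarrow> lo c w x u"
  unfolding lo_def by (rule LIMSEQ_incseq_SUP[OF bdd_msg(1)]) (auto simp: incseq_def msg_even_mono)

lemma msg_tendsto_up: "(\<lambda>n. msg c w x (Suc (2 * n)) u) \<longlonglongrightarrow> up c w x u"
  unfolding up_def by (rule LIMSEQ_decseq_INF[OF bdd_msg(2)])
    (auto simp: decseq_def intro!: msg_odd_antimono simp del: msg.simps)

lemma lo_le_up: "lo c w x u \<le> up c w x u"
  by (rule LIMSEQ_le[OF msg_tendsto_lo msg_tendsto_up]) (auto intro!: msg_even_le_odd simp del: msg.simps)

text \<open>A maximum over finitely many children is continuous: lower bounds come from the entry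
  that attains it, upper bounds from finitely many eventual inequalities.\<close>

lemma tendsto_relax:
  assumes "\<And>u. (\<lambda>n. g n u) \<longlonglongrightarrow> h u"
  shows "(\<lambda>n. relax c w x (g n) u) \<longlonglongrightarrow> relax c w x h u"
proof (rule order_tendstoI)
  fix t assume t: "t < relax c w x h u"
  show "\<forall>\<^sub>F n in sequentially. t < relax c w x (g n) u"
  proof (cases rule: relax_cases[of c w x h u])
    case 1
    then show ?thesis using t le_relax_vertex[of x u c w] by (auto intro!: always_eventually intro: less_le_trans)
  next
    case (2 i)
    have "(\<lambda>n. w (u @ [i]) - g n (u @ [i])) \<longlonglongrightarrow> w (u @ [i]) - h (u @ [i])"
      by (intro tendsto_intros assms)
    then have "\<forall>\<^sub>F n in sequentially. t < w (u @ [i]) - g n (u @ [i])"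
      using t 2 by (intro order_tendstoD) auto
    then show ?thesis
      by eventually_elim (use 2 in \<open>auto intro: less_le_trans le_relax_child\<close>)
  qed
next
  fix t assume t: "relax c w x h u < t"
  have "\<forall>\<^sub>F n in sequentially. w (u @ [i]) - g n (u @ [i]) < t" if "i < c u" for i
  proof -
    have "(\<lambda>n. w (u @ [i]) - g n (u @ [i])) \<longlonglongrightarrow> w (u @ [i]) - h (u @ [i])"
      by (intro tendsto_intros assms)
    then show ?thesis
      using t that by (intro order_tendstoD) (auto simp: relax_less_iff)
  qed
  then have "\<forall>\<^sub>F n in sequentially. \<forall>i\<in>{..<c u}. w (u @ [i]) - g n (u @ [i]) < t"
    by (intro eventually_ball_finite) auto
  then show "\<forall>\<^sub>F n in sequentially. relax c w x (g n) u < t"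
    by eventually_elim (use t in \<open>auto simp: relax_less_iff\<close>)
qed

lemma up_eq_relax_lo: "up c w x u = relax c w x (lo c w x) u"
proof -
  have "(\<lambda>n. relax c w x (msg c w x (2 * n)) u) \<longlonglongrightarrow> relax c w x (lo c w x) u"
    by (intro tendsto_relax msg_tendsto_lo)
  moreover have "(\<lambda>n. relax c w x (msg c w x (2 * n)) u) \<longlonglongrightarrow> up c w x u"
    using msg_tendsto_up[of c w x u] by simp
  ultimately show ?thesis by (metis LIMSEQ_unique)
qed

lemma lo_eq_relax_up: "lo c w x u = relax c w x (up c w x) u"
proof -
  have "(\<lambda>n. msg c w x (2 * Suc n) u) \<longlonglongrightarrow> lo c w x u"
    using msg_tendsto_lo by (rule LIMSEQ_Suc)
  then have "(\<lambda>n. relax c w x (msg c w x (Suc (2 * n))) u) \<longlonglongrightarrow> lo c w x u" by simp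
  moreover have "(\<lambda>n. relax c w x (msg c w x (Suc (2 * n))) u) \<longlonglongrightarrow> relax c w x (up c w x) u"
    by (intro tendsto_relax msg_tendsto_up)
  ultimately show ?thesis by (metis LIMSEQ_unique)
qed

text \<open>The strict inequalities make the preferred child unique, so that
  \<open>tree_config\<close> is a configuration for all labels, even with ties.\<close>

definition prefers ::
    "(nat list \<Rightarrow> nat) \<Rightarrow> (nat list \<Rightarrow> real) \<Rightarrow> (nat list \<Rightarrow> real) \<Rightarrow>
      (nat list \<Rightarrow> real) \<Rightarrow> nat list \<Rightarrow> nat \<Rightarrow> bool" where
  "prefers c w x g u i \<longleftrightarrow> i < c u \<and> x u < w (u @ [i]) - g (u @ [i]) \<and>
    (\<forall>j<c u. j \<noteq> i \<longrightarrow> w (u @ [j]) - g (u @ [j]) < w (u @ [i]) - g (u @ [i]))"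

lemma prefers_unique:
  assumes "prefers c w x g u i" "prefers c w x g u j"
  shows "i = j"
proof (rule ccontr)
  assume "i \<noteq> j"
  then have "w (u @ [j]) - g (u @ [j]) < w (u @ [i]) - g (u @ [i])"
    "w (u @ [i]) - g (u @ [i]) < w (u @ [j]) - g (u @ [j])"
    using assms unfolding prefers_def by auto
  then show False by (rule less_asym)
qed

text \<open>\<open>taken c w x u\<close> means that \<open>u\<close> is matched to its parent.\<close>

function taken where
  "taken c w x u =
     (if u = [] then False
      else \<not> taken c w x (butlast u) \<and> prefers c w x (lo c w x) (butlast u) (last u))"
  by auto
termination by (relation "Wellfounded.measure (\<lambda>(c, w, x, u). length u)") auto

declare taken.simps [simp del]

lemma taken_Nil [simp]: "\<not> taken c w x []"
  by (subst taken.simps) simp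

lemma taken_snoc: "taken c w x (u @ [i]) \<longleftrightarrow> \<not> taken c w x u \<and> prefers c w x (lo c w x) u i"
  by (subst taken.simps) simp

text \<open>The word \<open>[]\<close> contributes no singleton, because \<open>taken\<close> is
  false there.\<close>

definition tree_config :: "uh_labels \<Rightarrow> nat list set set" where
  "tree_config = (\<lambda>(c, w, x). {{butlast u, u} |u. u \<in> uh_verts c \<and> taken c w x u})"

lemma edge_mem_tree_config:
  "{u, u @ [i]} \<in> tree_config (c, w, x) \<longleftrightarrow> u @ [i] \<in> uh_verts c \<and> taken c w x (u @ [i])"
proof
  assume "{u, u @ [i]} \<in> tree_config (c, w, x)"
  then obtain v where v: "{u, u @ [i]} = {butlast v, v}" "v \<in> uh_verts c" "taken c w x v"
    by (auto simp: tree_config_def)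
  from v(3) have "v \<noteq> []" by (rule contrapos_pn) simp
  with v uh_edge_child_unique[of v "u @ [i]"] have "v = u @ [i]" by simp
  with v show "u @ [i] \<in> uh_verts c \<and> taken c w x (u @ [i])" by simp
next
  assume u: "u @ [i] \<in> uh_verts c \<and> taken c w x (u @ [i])"
  show "{u, u @ [i]} \<in> tree_config (c, w, x)"
    unfolding tree_config_def using u by (auto intro!: exI[of _ "u @ [i]"])
qed

lemma edges_uh_graph: "edges (uh_graph (c, w, x)) = {{u, u @ [i]} |u i. u @ [i] \<in> uh_verts c}"
proof (intro equalityI subsetI)
  fix e assume "e \<in> edges (uh_graph (c, w, x))"
  then obtain u where "e = {butlast u, u}" "u \<in> uh_verts c" "u \<noteq> []"
    by (auto simp: uh_graph_def)
  then show "e \<in> {{u, u @ [i]} |u i. u @ [i] \<in> uh_verts c}"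
    by (cases u rule: rev_cases) auto
next
  fix e assume "e \<in> {{u, u @ [i]} |u i. u @ [i] \<in> uh_verts c}"
  then obtain u i where "e = {u, u @ [i]}" "u @ [i] \<in> uh_verts c" by auto
  then show "e \<in> edges (uh_graph (c, w, x))"
    by (auto simp: uh_graph_def intro!: exI[of _ "u @ [i]"])
qed

lemma verts_uh_graph [simp]: "verts (uh_graph (c, w, x)) = uh_verts c"
  and vw_uh_graph [simp]: "vw (uh_graph (c, w, x)) = x"
  and root_uh_graph [simp]: "root (uh_graph (c, w, x)) = []"
  by (simp_all add: uh_graph_def)

text \<open>Two chosen edges with a common vertex have the same lower end, or the same upper end,
  where the preference is unique, or are consecutive, where choosing the upper one forbids the lower
  one.\<close>

lemma md_config_tree_config: "md_config (uh_graph L) (tree_config L)"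
proof -
  obtain c w x where L: "L = (c, w, x)" by (cases L) auto
  have edge: "\<exists>u i. e = {u, u @ [i]} \<and> u @ [i] \<in> uh_verts c \<and> taken c w x (u @ [i])"
    if "e \<in> tree_config L" for e
  proof -
    from that obtain u where "e = {butlast u, u}" "u \<in> uh_verts c" "taken c w x u"
      by (auto simp: L tree_config_def)
    then show ?thesis by (cases u rule: rev_cases) auto
  qed
  show ?thesis
    unfolding md_config_def
  proof (intro conjI ballI impI)
    show "tree_config L \<subseteq> edges (uh_graph L)"
      using edge by (fastforce simp: L edges_uh_graph)
    fix v e e' assume "e \<in> tree_config L" "e' \<in> tree_config L" and v: "v \<in> e \<and> v \<in> e'"
    then obtain u i u' j where e: "e = {u, u @ [i]}" "taken c w x (u @ [i])"
      and e': "e' = {u', u' @ [j]}" "taken c w x (u' @ [j])"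
      using edge by meson
    have p: "\<not> taken c w x u" "prefers c w x (lo c w x) u i"
        "\<not> taken c w x u'" "prefers c w x (lo c w x) u' j"
      using e(2) e'(2) by (simp_all add: taken_snoc)
    have "v = u \<or> v = u @ [i]" "v = u' \<or> v = u' @ [j]"
      using v e(1) e'(1) by blast+
    then consider "u = u'" | "u = u' @ [j]" | "u' = u @ [i]" | "u @ [i] = u' @ [j]"
      by metis
    then have "u = u' \<and> i = j"
    proof cases
      case 1
      then show ?thesis using p(2,4) prefers_unique by metis
    next
      case 2
      then show ?thesis using p(1) e'(2) by metis
    next
      case 3
      then show ?thesis using p(3) e(2) by metis
    qed simp
    then show "e = e'" using e e' by simp
  qed
qed


section \<open>Adding and removing one dimer in a finite graph\<close>

lemma edge_subset_verts: "weighted_graph G \<Longrightarrow> e \<in> edges G \<Longrightarrow> e \<subseteq> verts G"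
  unfolding weighted_graph_def by (drule conjunct1, drule subsetD) auto

lemma finite_md_config:
  assumes "weighted_graph G" "finite (verts G)" "md_config G D"
  shows "finite D"
proof (rule finite_subset)
  show "D \<subseteq> Pow (verts G)"
    using assms(3) edge_subset_verts[OF assms(1)] unfolding md_config_def by blast
qed (use assms(2) in simp)

lemma edge_verts:
  assumes "weighted_graph G" "{a, b} \<in> edges G"
  shows "a \<in> verts G" "b \<in> verts G" "a \<noteq> b"
proof -
  have "{a, b} \<in> {{u, v} |u v. u \<in> verts G \<and> v \<in> verts G \<and> u \<noteq> v}"
    using assms unfolding weighted_graph_def by blast
  then show "a \<in> verts G" "b \<in> verts G" "a \<noteq> b"
    by (auto simp: doubleton_eq_iff)
qed

lemma md_config_mono: "md_config G D \<Longrightarrow> D' \<subseteq> D \<Longrightarrow> md_config G D'"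
  unfolding md_config_def by (meson order_trans subsetD)

lemma md_config_unique:
  assumes "weighted_graph G" "md_config G D" "e \<in> D" "e' \<in> D" "v \<in> e" "v \<in> e'"
  shows "e = e'"
proof -
  have "v \<in> verts G"
    using assms(2,3,5) edge_subset_verts[OF assms(1)] unfolding md_config_def by blast
  then show ?thesis using assms(2-) unfolding md_config_def by meson
qed

lemma md_config_insert:
  assumes "md_config G D" "{a, b} \<in> edges G" "\<forall>e\<in>D. a \<notin> e" "\<forall>e\<in>D. b \<notin> e"
  shows "md_config G (insert {a, b} D)"
  unfolding md_config_def
proof (intro conjI ballI impI)
  show "insert {a, b} D \<subseteq> edges G" using assms(1,2) by (auto simp: md_config_def)
  fix v e e' assume v: "v \<in> verts G" "v \<in> e \<and> v \<in> e'"
    and e: "e \<in> insert {a, b} D" "e' \<in> insert {a, b} D"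
  from e consider "e \<in> D" "e' \<in> D" | "e = {a, b}" "e' \<in> D" | "e \<in> D" "e' = {a, b}"
    | "e = {a, b}" "e' = {a, b}" by blast
  then show "e = e'"
  proof cases
    case 1
    then show ?thesis using assms(1) v unfolding md_config_def by meson
  qed (use v assms(3,4) in auto)
qed

lemma md_weight_insert:
  assumes "weighted_graph G" "finite (verts G)" "md_config G D" "{a, b} \<in> edges G"
    and "\<forall>e\<in>D. a \<notin> e" "\<forall>e\<in>D. b \<notin> e"
  shows "md_weight G (insert {a, b} D) = md_weight G D + ew G {a, b} - vw G a - vw G b"
proof -
  have "monomers G D = insert a (insert b (monomers G (insert {a, b} D)))"
    using assms edge_verts[OF assms(1,4)] by (auto simp: monomers_def)
  moreover have "a \<notin> insert b (monomers G (insert {a, b} D))" "b \<notin> monomers G (insert {a, b} D)"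
    using edge_verts[OF assms(1,4)] by (auto simp: monomers_def)
  moreover have "finite (monomers G (insert {a, b} D))"
    using assms(2) by (simp add: monomers_def)
  ultimately have "(\<Sum>v\<in>monomers G D. vw G v) =
      vw G a + (vw G b + (\<Sum>v\<in>monomers G (insert {a, b} D). vw G v))"
    by simp
  moreover have "{a, b} \<notin> D" using assms by blast
  ultimately show ?thesis
    using finite_md_config[OF assms(1-3)] by (simp add: md_weight_def)
qed

lemma md_weight_remove:
  assumes G: "weighted_graph G" "finite (verts G)" "md_config G D" and e: "{a, b} \<in> D"
  shows "md_config G (D - {{a, b}})"
    and "\<forall>e\<in>D - {{a, b}}. a \<notin> e" "\<forall>e\<in>D - {{a, b}}. b \<notin> e"
    and "md_weight G (D - {{a, b}}) = md_weight G D - ew G {a, b} + vw G a + vw G b"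
proof -
  show c: "md_config G (D - {{a, b}})" by (rule md_config_mono[OF G(3)]) blast
  show ab: "\<forall>e\<in>D - {{a, b}}. a \<notin> e" "\<forall>e\<in>D - {{a, b}}. b \<notin> e"
    using md_config_unique[OF G(1,3) _ e] by blast+
  have "insert {a, b} (D - {{a, b}}) = D" using e by blast
  moreover have "{a, b} \<in> edges G" using G(3) e unfolding md_config_def by blast
  ultimately show "md_weight G (D - {{a, b}}) = md_weight G D - ew G {a, b} + vw G a + vw G b"
    using md_weight_insert[OF G(1,2) c _ ab] by simp
qed

text \<open>\<open>g\<close> embeds the tree down to depth \<open>R + 1\<close>, but the incident
  edges are fully known only down to depth \<open>R\<close>: a vertex on the boundary may have
  further edges, and the rest of \<open>G\<close> is arbitrary.\<close>

locale tree_like =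
  fixes G :: "'u wgraph" and c :: "nat list \<Rightarrow> nat" and w x :: "nat list \<Rightarrow> real"
    and g :: "nat list \<Rightarrow> 'u" and R :: nat
  assumes wg: "weighted_graph G" and fin: "finite (verts G)"
    and inj: "inj_on g {u \<in> uh_verts c. length u \<le> R + 1}"
    and incident: "\<And>u e. u \<in> uh_verts c \<Longrightarrow> length u \<le> R \<Longrightarrow> e \<in> edges G \<Longrightarrow> g u \<in> e \<Longrightarrow>
      (\<exists>i<c u. e = {g u, g (u @ [i])}) \<or> (u \<noteq> [] \<and> e = {g (butlast u), g u})"
    and edge: "\<And>u i. u \<in> uh_verts c \<Longrightarrow> length u \<le> R \<Longrightarrow> i < c u \<Longrightarrow> {g u, g (u @ [i])} \<in> edges G"
    and ew: "\<And>u i. u \<in> uh_verts c \<Longrightarrow> length u \<le> R \<Longrightarrow> i < c u \<Longrightarrow>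
      ew G {g u, g (u @ [i])} = w (u @ [i])"
    and vw: "\<And>u. u \<in> uh_verts c \<Longrightarrow> length u \<le> R + 1 \<Longrightarrow> vw G (g u) = x u"
begin

text \<open>The edges that an exchange started at \<open>u\<close> may alter, cut off at the
  boundary of the known region.\<close>

definition below :: "nat list \<Rightarrow> 'u set set" where
  "below u = {{g v, g (v @ [i])} |v i. prefix u v \<and> v @ [i] \<in> uh_verts c \<and> length v \<le> R}"

definition agree :: "nat list \<Rightarrow> 'u set set \<Rightarrow> 'u set set \<Rightarrow> bool" where
  "agree u D D' \<longleftrightarrow> D - below u = D' - below u"

definition uncovered :: "'u set set \<Rightarrow> nat list \<Rightarrow> bool" where
  "uncovered D u \<longleftrightarrow> (\<forall>e\<in>D. g u \<notin> e)"

definition free :: "'u set set \<Rightarrow> nat list \<Rightarrow> bool" where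
  "free D u \<longleftrightarrow> u = [] \<or> {g (butlast u), g u} \<notin> D"

lemma g_eq_iff:
  "u \<in> uh_verts c \<Longrightarrow> v \<in> uh_verts c \<Longrightarrow> length u \<le> R + 1 \<Longrightarrow> length v \<le> R + 1 \<Longrightarrow>
    g u = g v \<longleftrightarrow> u = v"
  using inj by (auto dest: inj_onD)

lemma below_child: "below (u @ [i]) \<subseteq> below u"
  unfolding below_def by (auto dest: append_prefixD)

text \<open>Ends of edges below \<open>v\<close> are images of descendants of \<open>v\<close>, and
  \<open>g\<close> is injective. Hence an exchange below a child cannot cover its parent
  again.\<close>

lemma not_in_below:
  assumes "u \<in> uh_verts c" "length u \<le> R + 1" "\<not> prefix v u" "e \<in> below v"
  shows "g u \<notin> e"
proof
  assume "g u \<in> e"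
  obtain v' j where e: "e = {g v', g (v' @ [j])}" "prefix v v'" "v' @ [j] \<in> uh_verts c" "length v' \<le> R"
    using assms(4) by (auto simp: below_def)
  then have "v' \<in> uh_verts c" using uh_verts_snoc by blast
  with e \<open>g u \<in> e\<close> assms(1,2) have "u = v' \<or> u = v' @ [j]"
    by (auto simp: g_eq_iff)
  then show False using e(2) assms(3) by auto
qed

lemma agree_parent:
  assumes "agree (u @ [i]) D D'" "D1 - below u = D - below u"
  shows "agree u D1 D'"
  using assms below_child[of u i] unfolding agree_def by blast

lemma uncovered_agree:
  assumes "agree v D D'" "u \<in> uh_verts c" "length u \<le> R + 1" "\<not> prefix v u" "uncovered D u"
  shows "uncovered D' u"
  using assms not_in_below[OF assms(2-4)] unfolding uncovered_def agree_def by blast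

lemma child_edge_in_below:
  "u \<in> uh_verts c \<Longrightarrow> length u \<le> R \<Longrightarrow> i < c u \<Longrightarrow> {g u, g (u @ [i])} \<in> below u"
  unfolding below_def by (auto simp: uh_verts_snoc)

lemma free_child_iff: "free D (u @ [i]) \<longleftrightarrow> {g u, g (u @ [i])} \<notin> D"
  by (simp add: free_def)

lemma covered_by_child:
  assumes "md_config G D" "u \<in> uh_verts c" "length u \<le> R" "free D u" "\<not> uncovered D u"
  obtains i where "i < c u" "{g u, g (u @ [i])} \<in> D"
proof -
  obtain e where "e \<in> D" "g u \<in> e" using assms(5) by (auto simp: uncovered_def)
  moreover have "e \<in> edges G" using \<open>e \<in> D\<close> assms(1) unfolding md_config_def by blast
  ultimately show ?thesis
    using incident[of u e] assms that by (auto simp: free_def)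
qed

text \<open>Uncovering a vertex that is not matched to its parent costs at most its message of odd index,
  and covering it again brings in at least its message of even index; each change stays below the
  vertex.\<close>

lemma exchange:
  assumes "u \<in> uh_verts c" "length u + k \<le> R + 1" "md_config G D"
  shows "odd k \<Longrightarrow> free D u \<Longrightarrow> \<exists>D'. md_config G D' \<and> uncovered D' u \<and> agree u D D' \<and>
      md_weight G D - msg c w x k u \<le> md_weight G D' - x u"
    and "even k \<Longrightarrow> uncovered D u \<Longrightarrow> \<exists>D'. md_config G D' \<and> agree u D D' \<and>
      md_weight G D + msg c w x k u - x u \<le> md_weight G D'"
  using assms
proof (induction k arbitrary: u D)
  case 0
  {
    case 1
    then show ?case by simp
  next
    case 2
    then show ?case by (intro exI[of _ D]) (auto simp: agree_def)
  }
next
  case (Suc k)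
  {
    case 1
    then have u: "u \<in> uh_verts c" "length u \<le> R" "length u \<le> R + 1" by auto
    show ?case
    proof (cases "uncovered D u")
      case True
      then show ?thesis
        using 1 msg_ge[of x u c w "Suc k"] by (intro exI[of _ D]) (auto simp: agree_def)
    next
      case False
      then obtain i where i: "i < c u" "{g u, g (u @ [i])} \<in> D"
        using covered_by_child[OF \<open>md_config G D\<close> u(1,2) \<open>free D u\<close>] by metis
      \<comment> \<open>Removing the dimer uncovers both ends. The child is then covered again from
        below, which returns at least its message of even index \<open>k\<close>.\<close>
      let ?D = "D - {{g u, g (u @ [i])}}"
      note rem = md_weight_remove[OF wg fin \<open>md_config G D\<close> i(2)]
      have ui: "u @ [i] \<in> uh_verts c" using u i by (simp add: uh_verts_snoc)
      have "\<exists>D'. md_config G D' \<and> agree (u @ [i]) ?D D' \<and>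
          md_weight G ?D + msg c w x k (u @ [i]) - x (u @ [i]) \<le> md_weight G D'"
        using 1 ui rem by (intro Suc.IH(2)) (auto simp: uncovered_def)
      then obtain D' where D': "md_config G D'" "agree (u @ [i]) ?D D'"
        "md_weight G ?D + msg c w x k (u @ [i]) - x (u @ [i]) \<le> md_weight G D'" by blast
      have "uncovered D' u"
        by (rule uncovered_agree[OF D'(2) u(1,3)]) (use rem in \<open>auto simp: uncovered_def\<close>)
      moreover have "agree u D D'"
        by (rule agree_parent[OF D'(2)]) (use child_edge_in_below[OF u(1,2) i(1)] in auto)
      moreover have "w (u @ [i]) - msg c w x k (u @ [i]) \<le> msg c w x (Suc k) u"
        using le_relax_child[of i c u w "msg c w x k" x] i by simp
      ultimately show ?thesis
        using D' rem(4) ew[OF u(1,2) i(1)] vw[OF u(1,3)] vw[OF ui] u(2)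
        by (intro exI[of _ D']) auto
    qed
  next
    case 2
    then have u: "u \<in> uh_verts c" "length u \<le> R" "length u \<le> R + 1" by auto
    show ?case
    proof (cases rule: relax_cases[of c w x "msg c w x k" u])
      case 1
      then show ?thesis using 2 by (intro exI[of _ D]) (auto simp: agree_def)
    next
      case i: (2 i)
      have ui: "u @ [i] \<in> uh_verts c" using u i by (simp add: uh_verts_snoc)
      \<comment> \<open>The child realising the maximum is first freed from its own subtree, at a
        cost of at most its message of odd index \<open>k\<close>, and then matched to
        \<open>u\<close>.\<close>
      have "\<exists>D'. md_config G D' \<and> uncovered D' (u @ [i]) \<and> agree (u @ [i]) D D' \<and>
          md_weight G D - msg c w x k (u @ [i]) \<le> md_weight G D' - x (u @ [i])"
        using 2 ui by (intro Suc.IH(1)) (auto simp: free_child_iff uncovered_def)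
      then obtain D' where D': "md_config G D'" "uncovered D' (u @ [i])" "agree (u @ [i]) D D'"
          "md_weight G D - msg c w x k (u @ [i]) \<le> md_weight G D' - x (u @ [i])" by blast
      have unc: "uncovered D' u"
        by (rule uncovered_agree[OF D'(3) u(1,3)]) (use 2 in auto)
      note ins = md_config_insert[OF D'(1) edge[OF u(1,2) i(1)]]
        md_weight_insert[OF wg fin D'(1) edge[OF u(1,2) i(1)]]
      have "agree u D (insert {g u, g (u @ [i])} D')"
        using agree_parent[OF D'(3), of D] child_edge_in_below[OF u(1,2) i(1)]
        unfolding agree_def by blast
      then show ?thesis
        using D' unc ins ew[OF u(1,2) i(1)] vw[OF u(1,3)] vw[OF ui] u(2) i
        by (intro exI[of _ "insert {g u, g (u @ [i])} D'"]) (auto simp: uncovered_def)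
    qed
  }
qed

end

text \<open>\<open>decided c w x K u\<close>: the bounds of index \<open>K\<close> (lower) and \<open>K + 1\<close> (upper) on the messages of
  the children already single out the best choice at \<open>u\<close>.\<close>

definition decided where
  "decided c w x K u \<longleftrightarrow>
     (\<exists>i. prefers c w x (lo c w x) u i \<and> x u < w (u @ [i]) - msg c w x (Suc K) (u @ [i]) \<and>
       (\<forall>j<c u. j \<noteq> i \<longrightarrow> w (u @ [j]) - msg c w x K (u @ [j]) < w (u @ [i]) - msg c w x (Suc K) (u @ [i]))) \<or>
     (\<forall>j<c u. w (u @ [j]) - msg c w x K (u @ [j]) < x u \<and> \<not> prefers c w x (lo c w x) u j)"

context tree_like
begin

text \<open>Otherwise \<open>D\<close> can be improved: release \<open>u\<close> from its present
  partner \<open>j\<close>, if any, bounding the loss by the message of index \<open>K\<close> at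
  \<open>j\<close>, and match it to \<open>i\<close>, bounding the gain by the message of index
  \<open>K + 1\<close> at \<open>i\<close>. The strict gap between the offers is the net gain. The
  depth bound leaves room for \<open>K + 1\<close> levels below a child.\<close>

lemma optimal_child:
  assumes opt: "optimal_md G D" and u: "u \<in> uh_verts c" "free D u" and K: "even K" "length u + K + 1 \<le> R"
    and i: "i < c u" "x u < w (u @ [i]) - msg c w x (Suc K) (u @ [i])"
    and others: "\<And>j. j < c u \<Longrightarrow> j \<noteq> i \<Longrightarrow>
      w (u @ [j]) - msg c w x K (u @ [j]) < w (u @ [i]) - msg c w x (Suc K) (u @ [i])"
  shows "{g u, g (u @ [i])} \<in> D"
proof (rule ccontr)
  assume no: "{g u, g (u @ [i])} \<notin> D"
  have lu: "length u \<le> R" "length u \<le> R + 1" using K by auto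
  have ui: "u @ [i] \<in> uh_verts c" using u i by (simp add: uh_verts_snoc)
  have md: "md_config G D" and best: "\<And>D'. md_config G D' \<Longrightarrow> md_weight G D' \<le> md_weight G D"
    using opt by (auto simp: optimal_md_def)
  have match: "\<exists>D''. md_config G D'' \<and> md_weight G D' + w (u @ [i]) - x u -
      msg c w x (Suc K) (u @ [i]) \<le> md_weight G D''"
    if D': "md_config G D'" "uncovered D' u" for D'
  proof -
    have "\<exists>D''. md_config G D'' \<and> uncovered D'' (u @ [i]) \<and> agree (u @ [i]) D' D'' \<and>
        md_weight G D' - msg c w x (Suc K) (u @ [i]) \<le> md_weight G D'' - x (u @ [i])"
      using D' ui K by (intro exchange(1)) (auto simp: free_child_iff uncovered_def)
    then obtain D'' where D'': "md_config G D''" "uncovered D'' (u @ [i])" "agree (u @ [i]) D' D''"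
      "md_weight G D' - msg c w x (Suc K) (u @ [i]) \<le> md_weight G D'' - x (u @ [i])" by blast
    have "uncovered D'' u"
      by (rule uncovered_agree[OF D''(3) u(1) lu(2)]) (use D' in auto)
    then show ?thesis
      using D'' md_config_insert[OF D''(1) edge[OF u(1) lu(1) i(1)]]
        md_weight_insert[OF wg fin D''(1) edge[OF u(1) lu(1) i(1)]]
        ew[OF u(1) lu(1) i(1)] vw[OF u(1) lu(2)] vw[OF ui] lu(1)
      by (intro exI[of _ "insert {g u, g (u @ [i])} D''"]) (auto simp: uncovered_def)
  qed
  show False
  proof (cases "uncovered D u")
    case True
    then show False using match[OF md] best i(2) by force
  next
    case False
    then obtain j where j: "j < c u" "{g u, g (u @ [j])} \<in> D"
      using covered_by_child[OF md u(1) lu(1) u(2)] by metis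
    then have "j \<noteq> i" using no by auto
    have uj: "u @ [j] \<in> uh_verts c" using u j by (simp add: uh_verts_snoc)
    let ?D = "D - {{g u, g (u @ [j])}}"
    note rem = md_weight_remove[OF wg fin md j(2)]
    have "\<exists>D'. md_config G D' \<and> agree (u @ [j]) ?D D' \<and>
        md_weight G ?D + msg c w x K (u @ [j]) - x (u @ [j]) \<le> md_weight G D'"
      using K uj rem by (intro exchange(2)) (auto simp: uncovered_def)
    then obtain D' where D': "md_config G D'" "agree (u @ [j]) ?D D'"
      "md_weight G ?D + msg c w x K (u @ [j]) - x (u @ [j]) \<le> md_weight G D'" by blast
    have "uncovered D' u"
      by (rule uncovered_agree[OF D'(2) u(1) lu(2)]) (use rem in \<open>auto simp: uncovered_def\<close>)
    from match[OF D'(1) this] obtain D'' where "md_config G D''"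
      "md_weight G D' + w (u @ [i]) - x u - msg c w x (Suc K) (u @ [i]) \<le> md_weight G D''" by blast
    then show False
      using best[of D''] D'(3) rem(4) ew[OF u(1) lu(1) j(1)] vw[OF u(1) lu(2)] vw[OF uj] lu(1)
        others[OF j(1) \<open>j \<noteq> i\<close>] by simp
  qed
qed

text \<open>Otherwise dropping the dimer, leaving \<open>u\<close> a monomer and covering the child
  again from below would be strictly better.\<close>

lemma optimal_no_child:
  assumes opt: "optimal_md G D" and u: "u \<in> uh_verts c" and K: "even K" "length u + K + 1 \<le> R"
    and j: "j < c u" "w (u @ [j]) - msg c w x K (u @ [j]) < x u"
  shows "{g u, g (u @ [j])} \<notin> D"
proof
  assume e: "{g u, g (u @ [j])} \<in> D"
  have lu: "length u \<le> R" "length u \<le> R + 1" using K by auto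
  have uj: "u @ [j] \<in> uh_verts c" using u j by (simp add: uh_verts_snoc)
  have md: "md_config G D" and best: "\<And>D'. md_config G D' \<Longrightarrow> md_weight G D' \<le> md_weight G D"
    using opt by (auto simp: optimal_md_def)
  let ?D = "D - {{g u, g (u @ [j])}}"
  note rem = md_weight_remove[OF wg fin md e]
  have "\<exists>D'. md_config G D' \<and> agree (u @ [j]) ?D D' \<and>
      md_weight G ?D + msg c w x K (u @ [j]) - x (u @ [j]) \<le> md_weight G D'"
    using K uj rem by (intro exchange(2)) (auto simp: uncovered_def)
  then obtain D' where D': "md_config G D'"
    "md_weight G ?D + msg c w x K (u @ [j]) - x (u @ [j]) \<le> md_weight G D'" by blast
  then show False
    using best[of D'] rem(4) ew[OF u lu(1) j(1)] vw[OF u lu(2)] vw[OF uj] lu(1) j(2) by simp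
qed

text \<open>Induction from the root downwards. If \<open>u\<close> is matched to its parent, which
  the induction hypothesis settles for both configurations at once, neither may use an edge to a
  child; if it is free, \<open>decided\<close> forces the choice.\<close>

lemma optimal_eq_tree_config:
  assumes opt: "optimal_md G D" and K: "even K" "L + K + 1 \<le> R"
    and dec: "\<And>u. u \<in> uh_verts c \<Longrightarrow> length u < L \<Longrightarrow> decided c w x K u"
    and u: "u @ [i] \<in> uh_verts c" "length u < L"
  shows "{g u, g (u @ [i])} \<in> D \<longleftrightarrow> taken c w x (u @ [i])"
proof -
  have md: "md_config G D" using opt by (simp add: optimal_md_def)
  have decide: "{g u, g (u @ [i])} \<in> D \<longleftrightarrow> prefers c w x (lo c w x) u i"
    if ui: "u @ [i] \<in> uh_verts c" "length u < L" and free: "free D u" for u i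
  proof -
    have u: "u \<in> uh_verts c" "i < c u" using ui by (auto simp: uh_verts_snoc)
    have R: "length u + K + 1 \<le> R" "length u \<le> R" using ui K by auto
    from dec[OF u(1) ui(2)] show ?thesis
      unfolding decided_def
    proof (elim disjE exE conjE)
      fix i0
      assume i0: "prefers c w x (lo c w x) u i0" "x u < w (u @ [i0]) - msg c w x (Suc K) (u @ [i0])"
        "\<forall>j<c u. j \<noteq> i0 \<longrightarrow> w (u @ [j]) - msg c w x K (u @ [j]) < w (u @ [i0]) - msg c w x (Suc K) (u @ [i0])"
      have "i0 < c u" using i0(1) by (simp add: prefers_def)
      have e: "{g u, g (u @ [i0])} \<in> D"
        by (rule optimal_child[OF opt u(1) free K(1) R(1) \<open>i0 < c u\<close> i0(2)]) (use i0(3) in blast)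
      show ?thesis
      proof (cases "i = i0")
        case True
        then show ?thesis using e i0(1) by simp
      next
        case False
        have "g (u @ [i]) \<noteq> g (u @ [i0])"
          using False u R \<open>i0 < c u\<close> by (subst g_eq_iff) (auto simp: uh_verts_snoc)
        then have "{g u, g (u @ [i])} \<noteq> {g u, g (u @ [i0])}"
          by (auto simp: doubleton_eq_iff)
        then have "{g u, g (u @ [i])} \<notin> D"
          using md_config_unique[OF wg md e, of "{g u, g (u @ [i])}" "g u"] by auto
        then show ?thesis using False prefers_unique i0(1) by metis
      qed
    next
      assume none: "\<forall>j<c u. w (u @ [j]) - msg c w x K (u @ [j]) < x u \<and> \<not> prefers c w x (lo c w x) u j"
      then show ?thesis
        using optimal_no_child[OF opt u(1) K(1) R(1) u(2)] u(2) by auto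
    qed
  qed
  show ?thesis
    using u
proof (induction u arbitrary: i rule: rev_induct)
  case Nil
  have "free D []" by (simp add: free_def)
  then show ?case using decide[OF Nil] by (simp add: taken_snoc[of _ _ _ "[]", simplified])
next
  case (snoc j v)
  let ?u = "v @ [j]"
  have v: "v \<in> uh_verts c" "length v < L" "?u \<in> uh_verts c" "j < c v" and i: "i < c ?u"
    using snoc.prems uh_verts_snoc by (auto simp del: append_assoc)
  have IH: "{g v, g ?u} \<in> D \<longleftrightarrow> taken c w x ?u"
    using v by (intro snoc.IH) auto
  show ?case
  proof (cases "free D ?u")
    case True
    then show ?thesis using decide[OF snoc.prems] IH taken_snoc[of c w x "v @ [j]" i] by (simp add: free_child_iff)
  next
    case False
    then have e: "{g v, g ?u} \<in> D" and t: "taken c w x ?u"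
      using IH by (auto simp: free_child_iff)
    have "g (?u @ [i]) \<noteq> g v"
      using snoc.prems K v(1) by (subst g_eq_iff) auto
    then have "{g ?u, g (?u @ [i])} \<noteq> {g v, g ?u}"
      by (auto simp: doubleton_eq_iff)
    then have "{g ?u, g (?u @ [i])} \<notin> D"
      using md_config_unique[OF wg md e, of "{g ?u, g (?u @ [i])}" "g ?u"] by auto
    moreover have "\<not> taken c w x (?u @ [i])" using t taken_snoc by metis
    ultimately show ?thesis by simp
  qed
qed

qed

end

section \<open>Convergence of optima\<close>

abbreviation adj :: "'v wgraph \<Rightarrow> ('v \<times> 'v) set" where
  "adj G \<equiv> {(a, b). {a, b} \<in> edges G}"

section \<open>Distances in the tree, and graphs whose ball is isomorphic to a ball of it\<close>

lemma gdist_le_iff: "gdist G u v \<le> enat k \<longleftrightarrow> (\<exists>j\<le>k. (u, v) \<in> adj G ^^ j)"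
proof
  assume "gdist G u v \<le> enat k"
  then have "gdist G u v < enat (Suc k)"
    using le_less_trans enat_ord_simps(2) lessI by blast
  then obtain j where "(u, v) \<in> adj G ^^ j" "enat j < enat (Suc k)"
    unfolding gdist_def by (auto simp: INF_less_iff)
  then show "\<exists>j\<le>k. (u, v) \<in> adj G ^^ j" by (intro exI[of _ j]) auto
next
  assume "\<exists>j\<le>k. (u, v) \<in> adj G ^^ j"
  then obtain j where "j \<le> k" "(u, v) \<in> adj G ^^ j" by blast
  then have "gdist G u v \<le> enat j" unfolding gdist_def by (intro INF_lower) auto
  also have "\<dots> \<le> enat k" using \<open>j \<le> k\<close> by simp
  finally show "gdist G u v \<le> enat k" .
qed

lemma uh_edge_cases:
  assumes "{a, b} \<in> edges (uh_graph (c, w, x))"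
  obtains i where "b = a @ [i]" "i < c a" "a \<in> uh_verts c"
    | i where "a = b @ [i]" "i < c b" "b \<in> uh_verts c"
proof -
  obtain u i where "{a, b} = {u, u @ [i]}" "u @ [i] \<in> uh_verts c"
    using assms unfolding edges_uh_graph by blast
  then show ?thesis using that by (auto simp: doubleton_eq_iff uh_verts_snoc)
qed

lemma uh_edgeI: "u \<in> uh_verts c \<Longrightarrow> i < c u \<Longrightarrow> {u, u @ [i]} \<in> edges (uh_graph (c, w, x))"
  unfolding edges_uh_graph using uh_verts_snoc by blast

lemma adj_uh_graph_length:
  "(u, v) \<in> adj (uh_graph (c, w, x)) ^^ j \<Longrightarrow> length v \<le> length u + j"
proof (induction j arbitrary: v)
  case (Suc j)
  then obtain y where "(u, y) \<in> adj (uh_graph (c, w, x)) ^^ j" "{y, v} \<in> edges (uh_graph (c, w, x))"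
    by auto
  then show ?case using Suc.IH[of y] by (auto elim!: uh_edge_cases)
qed simp

lemma adj_uh_graph_root:
  "v \<in> uh_verts c \<Longrightarrow> ([], v) \<in> adj (uh_graph (c, w, x)) ^^ length v"
proof (induction v rule: rev_induct)
  case (snoc i u)
  then show ?case using uh_edgeI[of u c i w x] by (auto simp: uh_verts_snoc)
qed simp

lemma ball_verts_uh_graph:
  "ball_verts H (uh_graph (c, w, x)) = {u \<in> uh_verts c. length u \<le> H + 1}"
  unfolding ball_verts_def verts_uh_graph root_uh_graph gdist_le_iff
proof (intro Collect_cong conj_cong refl iffI)
  fix u assume "\<exists>j\<le>H + 1. ([], u) \<in> adj (uh_graph (c, w, x)) ^^ j"
  then show "length u \<le> H + 1"
    using adj_uh_graph_length[where u = "[]"] by fastforce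
next
  fix u assume "u \<in> uh_verts c" "length u \<le> H + 1"
  then show "\<exists>j\<le>H + 1. ([], u) \<in> adj (uh_graph (c, w, x)) ^^ j"
    using adj_uh_graph_root by blast
qed

lemma finite_uh_verts_le: "finite {u \<in> uh_verts c. length u \<le> n}"
proof (induction n)
  case (Suc n)
  have "{u \<in> uh_verts c. length u \<le> Suc n} \<subseteq>
      insert [] (\<Union>u\<in>{u \<in> uh_verts c. length u \<le> n}. (\<lambda>i. u @ [i]) ` {..<c u})"
  proof
    fix u assume "u \<in> {u \<in> uh_verts c. length u \<le> Suc n}"
    then show "u \<in> insert [] (\<Union>u\<in>{u \<in> uh_verts c. length u \<le> n}. (\<lambda>i. u @ [i]) ` {..<c u})"
      by (cases u rule: rev_cases) (auto simp: uh_verts_snoc)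
  qed
  then show ?case by (rule finite_subset) (use Suc in auto)
qed simp

lemma simps_gball [simp]:
  "verts (gball H G) = ball_verts H G" "edges (gball H G) = {e \<in> edges G. e \<subseteq> ball_verts H G}"
  "root (gball H G) = root G" "ew (gball H G) = ew G" "vw (gball H G) = vw G"
  by (simp_all add: gball_def)

text \<open>Provides the local picture of \<open>tree_like\<close>, with the inverse of
  \<open>f\<close> as embedding. The isomorphism concerns the induced ball only, whereas distances
  and incident edges are those of all of \<open>G\<close>.\<close>

locale ball_iso =
  fixes G :: "'u wgraph" and c :: "nat list \<Rightarrow> nat" and w x :: "nat list \<Rightarrow> real"
    and f :: "'u \<Rightarrow> nat list" and R :: nat
  assumes wg: "weighted_graph G" and fin: "finite (verts G)"
    and iso: "wgraph_iso f (gball R G) (gball R (uh_graph (c, w, x)))"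
begin

definition g where "g = inv_into (ball_verts R G) f"

lemma bij: "bij_betw f (ball_verts R G) {u \<in> uh_verts c. length u \<le> R + 1}"
  using iso by (simp add: wgraph_iso_def ball_verts_uh_graph)

lemma f_mem: "a \<in> ball_verts R G \<Longrightarrow> f a \<in> uh_verts c \<and> length (f a) \<le> R + 1"
  using bij_betwE[OF bij] by blast

lemma g_f: "a \<in> ball_verts R G \<Longrightarrow> g (f a) = a"
  unfolding g_def using bij by (simp add: bij_betw_def)

lemma f_g: "u \<in> uh_verts c \<Longrightarrow> length u \<le> R + 1 \<Longrightarrow> f (g u) = u"
  unfolding g_def using bij by (intro f_inv_into_f) (simp add: bij_betw_def)

lemma g_mem: "u \<in> uh_verts c \<Longrightarrow> length u \<le> R + 1 \<Longrightarrow> g u \<in> ball_verts R G"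
  unfolding g_def using bij by (intro inv_into_into) (simp add: bij_betw_def)

lemma f_root: "f (root G) = []"
  using iso by (simp add: wgraph_iso_def)

lemma root_mem: "root G \<in> ball_verts H G"
  using wg by (auto simp: ball_verts_def weighted_graph_def gdist_le_iff intro!: exI[of _ 0])

lemma g_root: "g [] = root G"
  using g_f[OF root_mem] f_root by simp

lemma edge_iff:
  assumes "a \<in> ball_verts R G" "b \<in> ball_verts R G"
  shows "{a, b} \<in> edges G \<longleftrightarrow> {f a, f b} \<in> edges (uh_graph (c, w, x))"
proof -
  have "{a, b} \<in> edges (gball R G) \<longleftrightarrow> {f a, f b} \<in> edges (gball R (uh_graph (c, w, x)))"
    using iso assms unfolding wgraph_iso_def by simp
  then show ?thesis
    using assms f_mem[of a] f_mem[of b] by (simp add: ball_verts_uh_graph)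
qed

lemma g_edge:
  assumes "u \<in> uh_verts c" "length u \<le> R" "i < c u"
  shows "{g u, g (u @ [i])} \<in> edges G"
proof -
  have "u @ [i] \<in> uh_verts c" using assms by (simp add: uh_verts_snoc)
  then show ?thesis
    using edge_iff[of "g u" "g (u @ [i])"] assms uh_edgeI[of u c i w x]
    by (simp add: f_g g_mem)
qed

lemma adj_root_g: "u \<in> uh_verts c \<Longrightarrow> length u \<le> R + 1 \<Longrightarrow> (root G, g u) \<in> adj G ^^ length u"
proof (induction u rule: rev_induct)
  case Nil
  then show ?case by (simp add: g_root)
next
  case (snoc i u)
  then show ?case using g_edge[of u i] by (auto simp: uh_verts_snoc)
qed

lemma adj_root_length:
  "(root G, v) \<in> adj G ^^ j \<Longrightarrow> j \<le> R + 1 \<Longrightarrow> v \<in> ball_verts R G \<and> length (f v) \<le> j"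
proof (induction j arbitrary: v)
  case 0
  then show ?case using root_mem f_root by simp
next
  case (Suc j)
  then obtain y where y: "(root G, y) \<in> adj G ^^ j" "{y, v} \<in> edges G" by auto
  then have IH: "y \<in> ball_verts R G" "length (f y) \<le> j" using Suc by auto
  have "v \<in> verts G" using edge_verts[OF wg y(2)] by simp
  moreover have "gdist G (root G) v \<le> enat (R + 1)"
    using Suc.prems unfolding gdist_le_iff by blast
  ultimately have v: "v \<in> ball_verts R G" by (simp add: ball_verts_def)
  have "{f y, f v} \<in> edges (uh_graph (c, w, x))" using edge_iff[OF IH(1) v] y(2) by simp
  then have "length (f v) \<le> length (f y) + 1" by (auto elim!: uh_edge_cases)
  then show ?case using v IH(2) by simp
qed

text \<open>\<open>f\<close> turns distance from the root into word length: short paths from the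
  root stay in the ball and can be transported in both directions.\<close>

lemma ball_verts_iff:
  assumes "H \<le> R"
  shows "v \<in> ball_verts H G \<longleftrightarrow> v \<in> ball_verts R G \<and> length (f v) \<le> H + 1"
proof
  assume "v \<in> ball_verts H G"
  then obtain j where "j \<le> H + 1" "(root G, v) \<in> adj G ^^ j"
    unfolding ball_verts_def gdist_le_iff by auto
  then show "v \<in> ball_verts R G \<and> length (f v) \<le> H + 1"
    using adj_root_length[of v j] assms by auto
next
  assume v: "v \<in> ball_verts R G \<and> length (f v) \<le> H + 1"
  then have "(root G, v) \<in> adj G ^^ length (f v)"
    using adj_root_g[of "f v"] f_mem g_f by simp
  then have "gdist G (root G) v \<le> enat (H + 1)"
    using v unfolding gdist_le_iff by blast
  then show "v \<in> ball_verts H G" using v by (simp add: ball_verts_def)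
qed

lemma ew_f: "e \<in> edges G \<Longrightarrow> e \<subseteq> ball_verts R G \<Longrightarrow> ew G e = ew (uh_graph (c, w, x)) (f ` e)"
  using iso by (simp add: wgraph_iso_def)

lemma vw_f: "v \<in> ball_verts R G \<Longrightarrow> vw G v = x (f v)"
  using iso by (simp add: wgraph_iso_def)

sublocale tree_like G c w x g R
proof
  show "inj_on g {u \<in> uh_verts c. length u \<le> R + 1}"
    by (rule inj_on_inverseI[of _ f]) (simp add: f_g)
  fix u assume u: "u \<in> uh_verts c" "length u \<le> R"
  then have gu: "g u \<in> ball_verts R G" "f (g u) = u" by (auto intro: g_mem f_g)
  show "{g u, g (u @ [i])} \<in> edges G" if "i < c u" for i
    using g_edge u that by blast
  show "ew G {g u, g (u @ [i])} = w (u @ [i])" if i: "i < c u" for i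
  proof -
    have "u @ [i] \<in> uh_verts c" using u i by (simp add: uh_verts_snoc)
    then show ?thesis
      using ew_f[OF g_edge[OF u i]] gu u uh_edge_weight[of c w x u i] by (simp add: g_mem f_g)
  qed
  show "(\<exists>i<c u. e = {g u, g (u @ [i])}) \<or> (u \<noteq> [] \<and> e = {g (butlast u), g u})"
    if e: "e \<in> edges G" "g u \<in> e" for e
  proof -
    have "e \<in> {{a, b} |a b. a \<in> verts G \<and> b \<in> verts G \<and> a \<noteq> b}"
      using wg e(1) by (auto simp: weighted_graph_def)
    then obtain b where b: "e = {g u, b}" using e(2) by auto
    \<comment> \<open>A neighbour of a vertex of depth at most \<open>R\<close> has distance at most
      \<open>R + 1\<close> from the root, so it still lies in the ball and the isomorphism sees the
      edge.\<close>
    have "(root G, b) \<in> adj G ^^ Suc (length u)"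
      using adj_root_g[of u] u b e(1) by auto
    then have "b \<in> ball_verts R G" using adj_root_length[of b "Suc (length u)"] u by simp
    moreover from this have "{u, f b} \<in> edges (uh_graph (c, w, x))"
      using edge_iff[OF gu(1), of b] gu(2) e(1) b by simp
    ultimately show ?thesis
    proof (elim uh_edge_cases)
      fix i assume "b \<in> ball_verts R G" "f b = u @ [i]" "i < c u"
      moreover from this have "b = g (u @ [i])" using g_f by metis
      ultimately show ?thesis using b by blast
    next
      fix i assume bu: "b \<in> ball_verts R G" "u = f b @ [i]"
      have "g (butlast u) = b" "u \<noteq> []" unfolding bu(2) using g_f[OF bu(1)] by simp_all
      then show ?thesis unfolding b by (metis insert_commute)
    qed
  qed
qed (auto simp: wg fin vw_f g_mem f_g)

text \<open>Choices near the root depend on labels further down, so the isomorphism at hand is one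
  of a larger ball and has to be restricted.\<close>

lemma iso_mono:
  assumes "H \<le> R"
  shows "wgraph_iso f (gball H G) (gball H (uh_graph (c, w, x)))"
proof -
  have sub: "ball_verts H G \<subseteq> ball_verts R G" using ball_verts_iff[OF assms] by blast
  have "f ` ball_verts H G = {u \<in> uh_verts c. length u \<le> H + 1}"
  proof (intro equalityI subsetI)
    fix u assume "u \<in> f ` ball_verts H G"
    then show "u \<in> {u \<in> uh_verts c. length u \<le> H + 1}"
      using ball_verts_iff[OF assms] f_mem by auto
  next
    fix u assume u: "u \<in> {u \<in> uh_verts c. length u \<le> H + 1}"
    then have "g u \<in> ball_verts H G" "f (g u) = u"
      using assms ball_verts_iff[OF assms, of "g u"] by (auto simp: f_g g_mem)
    then show "u \<in> f ` ball_verts H G" by (metis imageI)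
  qed
  then have "bij_betw f (ball_verts H G) (ball_verts H (uh_graph (c, w, x)))"
    using bij inj_on_subset[OF _ sub] by (auto simp: bij_betw_def ball_verts_uh_graph)
  moreover have "f a \<in> uh_verts c" "length (f a) \<le> Suc H" if "a \<in> ball_verts H G" for a
    using that sub f_mem ball_verts_iff[OF assms] by auto
  ultimately show ?thesis
    using sub edge_iff ew_f vw_f f_root
    unfolding wgraph_iso_def by (auto simp: subset_iff ball_verts_uh_graph)
qed

text \<open>The edges of the ball of radius \<open>H + 1\<close> have upper ends of depth at most
  \<open>H\<close>, so \<open>optimal_eq_tree_config\<close> is applied with
  \<open>L = H + 1\<close>; this is the origin of \<open>H + K + 2\<close>.\<close>

lemma decorated_isomorphic_optimum:
  assumes opt: "optimal_md G D" and K: "even K" "H + K + 2 \<le> R"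
    and dec: "\<And>u. u \<in> uh_verts c \<Longrightarrow> length u < H + 1 \<Longrightarrow> decided c w x K u"
  shows "decorated_isomorphic (gball H G) (config_ball H G D) (gball H (uh_graph (c, w, x)))
    (config_ball H (uh_graph (c, w, x)) (tree_config (c, w, x)))"
proof -
  let ?T = "uh_graph (c, w, x)"
  have HR: "H \<le> R" using K by simp
  have "e \<in> D \<longleftrightarrow> f ` e \<in> tree_config (c, w, x)" if e: "e \<in> edges G" "e \<subseteq> ball_verts H G" for e
  proof -
    have "e \<in> {{a, b} |a b. a \<in> verts G \<and> b \<in> verts G \<and> a \<noteq> b}"
      using wg e(1) by (auto simp: weighted_graph_def)
    then obtain a b where ab: "e = {a, b}" by blast
    have *: "e \<in> D \<longleftrightarrow> f ` e \<in> tree_config (c, w, x)"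
      if e: "e = {a, b}" "a \<in> ball_verts R G" "b \<in> ball_verts R G" and "length (f b) \<le> H + 1"
        and fb: "f b = f a @ [i]" "i < c (f a)" "f a \<in> uh_verts c" for a b i
    proof -
      have "{g (f a), g (f a @ [i])} \<in> D \<longleftrightarrow> taken c w x (f a @ [i])"
        by (rule optimal_eq_tree_config[OF opt K(1) _ dec, of "H + 1"])
          (use K that in \<open>auto simp: uh_verts_snoc\<close>)
      moreover have "g (f a) = a" "g (f a @ [i]) = b"
        using e g_f fb(1) by metis+
      ultimately show ?thesis
        using fb e(1) by (simp add: edge_mem_tree_config uh_verts_snoc)
    qed
    have "a \<in> ball_verts R G" "b \<in> ball_verts R G" "length (f a) \<le> H + 1" "length (f b) \<le> H + 1"
      using e ab ball_verts_iff[OF HR] by auto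
    moreover from this have "{f a, f b} \<in> edges ?T" using edge_iff e ab by blast
    note fab = calculation this
    from fab(5) show ?thesis
    proof (cases rule: uh_edge_cases)
      case (1 i)
      show ?thesis by (rule *[OF ab fab(1,2,4) 1])
    next
      case (2 i)
      have "e = {b, a}" using ab by blast
      then show ?thesis by (rule *[OF _ fab(2,1,3) 2])
    qed
  qed
  moreover have "f ` e \<subseteq> ball_verts H ?T" if "e \<subseteq> ball_verts H G" for e
    using that bij_betwE[of f "ball_verts H G" "ball_verts H ?T"] iso_mono[OF HR]
    by (auto simp: wgraph_iso_def)
  ultimately show ?thesis
    unfolding decorated_isomorphic_def config_ball_def
    by (intro exI[of _ f] conjI iso_mono[OF HR]) auto
qed

end

text \<open>The conditions range over all words, in the tree or not, so that each concerns fixed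
  coordinates. The root is exempt from \<open>lo = up\<close>, since no choice consults its
  message.\<close>

definition generic :: "uh_labels \<Rightarrow> bool" where
  "generic = (\<lambda>(c, w, x). (\<forall>u. u \<noteq> [] \<longrightarrow> lo c w x u = up c w x u) \<and>
     (\<forall>u i. w (u @ [i]) - lo c w x (u @ [i]) \<noteq> x u) \<and>
     (\<forall>u i j. i \<noteq> j \<longrightarrow> w (u @ [i]) - lo c w x (u @ [i]) \<noteq> w (u @ [j]) - lo c w x (u @ [j])))"

text \<open>Strict inequalities between limits hold between all late enough bounds. If no child is
  preferred, the absence of ties leaves \<open>x u\<close> as the strict maximum.\<close>

lemma eventually_decided:
  assumes "generic (c, w, x)"
  shows "\<forall>\<^sub>F n in sequentially. decided c w x (2 * n) u"
proof -
  let ?v = "\<lambda>i. w (u @ [i]) - lo c w x (u @ [i])"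
  have lo_up: "lo c w x (u @ [i]) = up c w x (u @ [i])"
    and ne: "?v i \<noteq> x u" "i \<noteq> j \<Longrightarrow> ?v i \<noteq> ?v j" for i j
    using assms by (auto simp: generic_def)
  have upper: "(\<lambda>n. w (u @ [i]) - msg c w x (2 * n) (u @ [i])) \<longlonglongrightarrow> ?v i" for i
    by (intro tendsto_intros msg_tendsto_lo)
  have lower: "(\<lambda>n. w (u @ [i]) - msg c w x (Suc (2 * n)) (u @ [i])) \<longlonglongrightarrow> ?v i" for i
    unfolding lo_up by (intro tendsto_intros msg_tendsto_up)
  show ?thesis
  proof (cases "\<exists>i. prefers c w x (lo c w x) u i")
    case True
    then obtain i where i: "prefers c w x (lo c w x) u i" by blast
    then have "\<forall>\<^sub>F n in sequentially. x u < w (u @ [i]) - msg c w x (Suc (2 * n)) (u @ [i])"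
      unfolding prefers_def by (intro order_tendstoD[OF lower]) auto
    moreover have "\<forall>\<^sub>F n in sequentially. \<forall>j\<in>{..<c u} - {i}.
        w (u @ [j]) - msg c w x (2 * n) (u @ [j]) < w (u @ [i]) - msg c w x (Suc (2 * n)) (u @ [i])"
    proof (intro eventually_ball_finite ballI)
      fix j assume "j \<in> {..<c u} - {i}"
      then have "?v j < ?v i" using i by (auto simp: prefers_def)
      then obtain s where s: "?v j < s" "s < ?v i" using dense by blast
      show "\<forall>\<^sub>F n in sequentially.
        w (u @ [j]) - msg c w x (2 * n) (u @ [j]) < w (u @ [i]) - msg c w x (Suc (2 * n)) (u @ [i])"
        using order_tendstoD(2)[OF upper s(1)] order_tendstoD(1)[OF lower s(2)]
        by eventually_elim (rule less_trans)
    qed simp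
    ultimately show ?thesis
      by eventually_elim (use i in \<open>auto simp: decided_def simp del: msg.simps\<close>)
  next
    case False
    have "relax c w x (lo c w x) u = x u"
    proof (cases rule: relax_cases[of c w x "lo c w x" u])
      case (2 i)
      have "x u < ?v i"
        using 2 le_relax_vertex[of x u c w "lo c w x"] ne(1)[of i] by simp
      moreover have "?v j < ?v i" if "j < c u" "j \<noteq> i" for j
        using 2 le_relax_child[of j c u w "lo c w x" x] ne(2)[of j i] that by simp
      ultimately have "prefers c w x (lo c w x) u i"
        using 2 by (simp add: prefers_def)
      then show ?thesis using False by blast
    qed
    then have lt: "?v j < x u" if "j < c u" for j
      using le_relax_child[of j c u w "lo c w x" x] ne(1)[of j] that by (simp add: less_le)
    have "\<forall>\<^sub>F n in sequentially. \<forall>j\<in>{..<c u}. w (u @ [j]) - msg c w x (2 * n) (u @ [j]) < x u"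
      by (intro eventually_ball_finite ballI order_tendstoD(2)[OF upper]) (use lt in auto)
    then show ?thesis
      by eventually_elim (use False in \<open>auto simp: decided_def simp del: msg.simps\<close>)
  qed
qed

theorem optima_converge_locally:
  fixes G :: "nat \<Rightarrow> 'u wgraph"
  assumes G: "\<And>n. weighted_graph (G n)" "\<And>n. finite (verts (G n))"
    and conv: "converges_locally G (uh_graph L)" and opt: "\<And>n. optimal_md (G n) (Dn n)"
    and gen: "generic L"
  shows "decorated_converges_locally G Dn (uh_graph L) (tree_config L)"
  unfolding decorated_converges_locally_def
proof
  fix H
  obtain c w x where L: "L = (c, w, x)" by (cases L) auto
  \<comment> \<open>Only finitely many vertices have depth at most \<open>H\<close>, so one even
    level \<open>2 * k\<close> decides them all, and the ball of index \<open>H + 2 * k + 2\<close>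
    contains all labels involved.\<close>
  have "\<forall>\<^sub>F n in sequentially. \<forall>u\<in>{u \<in> uh_verts c. length u \<le> H}. decided c w x (2 * n) u"
    using eventually_decided gen finite_uh_verts_le unfolding L by (intro eventually_ball_finite) auto
  then obtain k where k: "\<And>u. u \<in> uh_verts c \<Longrightarrow> length u \<le> H \<Longrightarrow> decided c w x (2 * k) u"
    by (auto simp: eventually_sequentially)
  obtain N where N: "\<And>n. n \<ge> N \<Longrightarrow>
      wgraph_isomorphic (gball (H + 2 * k + 2) (G n)) (gball (H + 2 * k + 2) (uh_graph L))"
    using conv unfolding converges_locally_def by blast
  show "\<exists>N. \<forall>n\<ge>N. decorated_isomorphic (gball H (G n)) (config_ball H (G n) (Dn n))
      (gball H (uh_graph L)) (config_ball H (uh_graph L) (tree_config L))"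
  proof (intro exI allI impI)
    fix n assume "N \<le> n"
    then obtain f where "wgraph_iso f (gball (H + 2 * k + 2) (G n)) (gball (H + 2 * k + 2) (uh_graph L))"
      using N by (auto simp: wgraph_isomorphic_def)
    then interpret ball_iso "G n" c w x f "H + 2 * k + 2"
      using G by unfold_locales (auto simp: L)
    show "decorated_isomorphic (gball H (G n)) (config_ball H (G n) (Dn n))
      (gball H (uh_graph L)) (config_ball H (uh_graph L) (tree_config L))"
      unfolding L by (rule decorated_isomorphic_optimum[OF opt, of "2 * k"]) (auto intro: k)
  qed
qed

section \<open>Independence of the labels\<close>

lemma gf_sums:
  assumes "0 \<le> s" "s \<le> 1"
  shows "(\<lambda>k. pmf q k * s ^ k) sums gf q s"
proof -
  have "(\<lambda>k. ennreal (pmf q k * s ^ k)) sums ennreal (gf q s)"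
    unfolding ennreal_gf[OF assms] by (rule summable_sums) simp
  then show ?thesis
    using assms by (subst (asm) sums_ennreal) (auto intro: gf_nonneg)
qed

text \<open>Degrees and both sorts of weights become one family of real variables, so that
  independence is a single statement that can be regrouped along arbitrary blocks of
  indices.\<close>

datatype kind = Deg | Edge | Vert

type_synonym coords = "kind \<times> nat list \<Rightarrow> real"

definition coords :: "uh_labels \<Rightarrow> coords" where
  "coords = (\<lambda>(c, w, x) (k, u). case k of Deg \<Rightarrow> real (c u) | Edge \<Rightarrow> w u | Vert \<Rightarrow> x u)"

definition degs :: "coords \<Rightarrow> nat list \<Rightarrow> nat" where "degs f u = nat \<lfloor>f (Deg, u)\<rfloor>"

definition coord_msg :: "nat \<Rightarrow> nat list \<Rightarrow> coords \<Rightarrow> real" where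
  "coord_msg n u f = msg (degs f) (\<lambda>u. f (Edge, u)) (\<lambda>u. f (Vert, u)) n u"

definition coord_lo :: "nat list \<Rightarrow> coords \<Rightarrow> real" where
  "coord_lo u f = lo (degs f) (\<lambda>u. f (Edge, u)) (\<lambda>u. f (Vert, u)) u"

definition coord_up :: "nat list \<Rightarrow> coords \<Rightarrow> real" where
  "coord_up u f = up (degs f) (\<lambda>u. f (Edge, u)) (\<lambda>u. f (Vert, u)) u"

text \<open>\<open>(Edge, u)\<close> belongs to the edge above \<open>u\<close>. Leaving it out
  makes this weight independent of the message from which it is compared.\<close>

definition subtree_coords :: "nat list \<Rightarrow> (kind \<times> nat list) set" where
  "subtree_coords u = {(k, v). prefix u v \<and> (k = Edge \<longrightarrow> v \<noteq> u)}"

definition shift :: "nat list \<Rightarrow> coords \<Rightarrow> coords" where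
  "shift u f = (\<lambda>(k, v). f (k, u @ v))"

text \<open>The first two clauses give independence over disjoint subtrees; the third gives equality
  in law at all non-root vertices.\<close>

definition subtree_fun :: "(nat list \<Rightarrow> coords \<Rightarrow> real) \<Rightarrow> bool" where
  "subtree_fun h \<longleftrightarrow>
     (\<forall>u K. subtree_coords u \<subseteq> K \<longrightarrow> h u \<in> borel_measurable (PiM K (\<lambda>_. borel))) \<and>
     (\<forall>u K f. subtree_coords u \<subseteq> K \<longrightarrow> h u (restrict f K) = h u f) \<and>
     (\<forall>u f. h u f = h [] (shift u f))"

lemma subtree_coords_child:
  "(Edge, u @ [i]) \<in> subtree_coords u" "subtree_coords (u @ [i]) \<subseteq> subtree_coords u"
  "(Deg, u) \<in> subtree_coords u" "(Vert, u) \<in> subtree_coords u"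
  by (auto simp: subtree_coords_def dest: append_prefixD)

lemma coord_msg_Suc: "coord_msg (Suc n) u f =
    Max (insert (f (Vert, u)) ((\<lambda>i. f (Edge, u @ [i]) - coord_msg n (u @ [i]) f) ` {..<degs f u}))"
  by (simp add: coord_msg_def relax_def)

text \<open>Measurability of a maximum over a random number of children is read off from its
  sublevel sets, which are countable conjunctions.\<close>

lemma coord_msg_Suc_le_iff:
  "coord_msg (Suc n) u f \<le> t \<longleftrightarrow> f (Vert, u) \<le> t \<and>
    (\<forall>i. i < degs f u \<longrightarrow> f (Edge, u @ [i]) - coord_msg n (u @ [i]) f \<le> t)"
  by (simp add: coord_msg_def relax_le_iff)

lemma measurable_degs:
  "(Deg, u) \<in> K \<Longrightarrow> (\<lambda>f. degs f u) \<in> measurable (PiM K (\<lambda>_. borel)) (count_space UNIV)"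
proof -
  assume [measurable]: "(Deg, u) \<in> K"
  show ?thesis unfolding degs_def by measurable
qed

lemma measurable_coord_msg:
  "subtree_coords u \<subseteq> K \<Longrightarrow> coord_msg n u \<in> borel_measurable (PiM K (\<lambda>_. borel))"
proof (induction n arbitrary: u)
  case 0
  then have [measurable]: "(Vert, u) \<in> K" using subtree_coords_child by blast
  have "(\<lambda>f. f (Vert, u)) \<in> borel_measurable (PiM K (\<lambda>_. borel))" by measurable
  then show ?case by (simp add: coord_msg_def[abs_def])
next
  case (Suc n)
  have [measurable]: "(Vert, u) \<in> K" "\<And>i. (Edge, u @ [i]) \<in> K" "(Deg, u) \<in> K"
    using Suc.prems subtree_coords_child by blast+
  have [measurable]: "coord_msg n (u @ [i]) \<in> borel_measurable (PiM K (\<lambda>_. borel))" for i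
    using Suc subtree_coords_child by (meson order_trans)
  have [measurable]: "(\<lambda>f. degs f u) \<in> measurable (PiM K (\<lambda>_. borel)) (count_space UNIV)"
    by (rule measurable_degs) fact
  show ?case
    by (rule borel_measurableI_le, unfold coord_msg_Suc_le_iff) measurable
qed

lemma coord_msg_restrict:
  "subtree_coords u \<subseteq> K \<Longrightarrow> coord_msg n u (restrict f K) = coord_msg n u f"
proof (induction n arbitrary: u)
  case 0
  then have "(Vert, u) \<in> K" using subtree_coords_child by blast
  then show ?case by (simp add: coord_msg_def)
next
  case (Suc n)
  have K: "(Vert, u) \<in> K" "\<And>i. (Edge, u @ [i]) \<in> K" "(Deg, u) \<in> K"
    using Suc.prems subtree_coords_child by blast+
  moreover have "coord_msg n (u @ [i]) (restrict f K) = coord_msg n (u @ [i]) f" for i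
    using Suc subtree_coords_child by (meson order_trans)
  moreover have "degs (restrict f K) u = degs f u" using K(3) by (simp add: degs_def)
  moreover have "restrict f K (Vert, u) = f (Vert, u)"
    "\<And>i. restrict f K (Edge, u @ [i]) = f (Edge, u @ [i])"
    using K by simp_all
  ultimately show ?case by (simp only: coord_msg_Suc)
qed

lemma coord_msg_shift: "coord_msg n (u @ v) f = coord_msg n v (shift u f)"
proof (induction n arbitrary: v)
  case (Suc n)
  then show ?case by (simp add: coord_msg_def relax_def degs_def shift_def)
qed (simp add: coord_msg_def shift_def)

lemma coord_lo_tendsto: "(\<lambda>n. coord_msg (2 * n) u f) \<longlonglongrightarrow> coord_lo u f"
  unfolding coord_msg_def coord_lo_def by (rule msg_tendsto_lo)

lemma coord_up_tendsto: "(\<lambda>n. coord_msg (Suc (2 * n)) u f) \<longlonglongrightarrow> coord_up u f"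
  unfolding coord_msg_def coord_up_def by (rule msg_tendsto_up)

lemma subtree_fun_limit:
  assumes "\<And>u f. (\<lambda>n. coord_msg (a n) u f) \<longlonglongrightarrow> h u f"
  shows "subtree_fun h"
  unfolding subtree_fun_def
proof (intro conjI allI impI)
  fix u K assume K: "subtree_coords u \<subseteq> K"
  show "h u \<in> borel_measurable (PiM K (\<lambda>_. borel))"
    by (rule borel_measurable_LIMSEQ_metric[OF measurable_coord_msg[OF K] assms])
  show "h u (restrict f K) = h u f" for f
    using assms[of u "restrict f K"] unfolding coord_msg_restrict[OF K]
    by (rule LIMSEQ_unique[OF _ assms])
next
  fix u f
  show "h u f = h [] (shift u f)"
    using assms[of "[]" "shift u f"] unfolding coord_msg_shift[symmetric]
    by (intro LIMSEQ_unique[OF assms[of u f]]) simp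
qed

lemma subtree_fun_lo: "subtree_fun coord_lo"
  and subtree_fun_up: "subtree_fun coord_up"
  by (rule subtree_fun_limit[OF coord_lo_tendsto], rule subtree_fun_limit[OF coord_up_tendsto])

lemma subtree_funD:
  assumes "subtree_fun h" "subtree_coords u \<subseteq> K"
  shows "h u \<in> borel_measurable (PiM K (\<lambda>_. borel))" "h u (restrict f K) = h u f"
  using assms unfolding subtree_fun_def by blast+

definition coord_law :: "nat pmf \<Rightarrow> real measure \<Rightarrow> real measure \<Rightarrow> kind \<times> nat list \<Rightarrow> real measure" where
  "coord_law p \<omega> \<xi> = (\<lambda>(k, u). case k of
     Deg \<Rightarrow> distr (measure_pmf (if u = [] then p else size_biased p)) borel real
   | Edge \<Rightarrow> \<omega> | Vert \<Rightarrow> \<xi>)"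

lemma prob_space_coord_law:
  "real_distribution \<omega> \<Longrightarrow> real_distribution \<xi> \<Longrightarrow> prob_space (coord_law p \<omega> \<xi> j)"
proof -
  assume "real_distribution \<omega>" "real_distribution \<xi>"
  then have "prob_space \<omega>" "prob_space \<xi>" by (simp_all add: real_distribution_def)
  moreover have "prob_space (distr (measure_pmf q) borel real)" for q :: "nat pmf"
    by (rule measure_pmf.prob_space_distr) simp
  ultimately show ?thesis
    unfolding coord_law_def by (cases j; cases "fst j") simp_all
qed

lemma sets_coord_law:
  "real_distribution \<omega> \<Longrightarrow> real_distribution \<xi> \<Longrightarrow> sets (coord_law p \<omega> \<xi> j) = sets borel"
proof -
  assume "real_distribution \<omega>" "real_distribution \<xi>"
  then have "sets \<omega> = sets borel" "sets \<xi> = sets borel"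
    by (simp_all add: real_distribution_def real_distribution_axioms_def)
  then show ?thesis
    unfolding coord_law_def by (cases j; cases "fst j") simp_all
qed

lemma coords_measurable [measurable]:
  assumes "real_distribution \<omega>" "real_distribution \<xi>"
  shows "coords \<in> measurable (ubgw_law p \<omega> \<xi>) (PiM UNIV (\<lambda>_. borel))"
proof (rule measurable_PiM_single')
  interpret \<omega>: real_distribution \<omega> by fact
  interpret \<xi>: real_distribution \<xi> by fact
  fix j :: "kind \<times> nat list"
  obtain k u where j: "j = (k, u)" by (cases j)
  show "(\<lambda>L. coords L j) \<in> borel_measurable (ubgw_law p \<omega> \<xi>)"
    by (cases k) (simp_all add: j coords_def case_prod_beta ubgw_law_def)
qed (auto simp: space_PiM)

text \<open>Cylinders determine a product measure. A finite set of indices splits by kind, so the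
  preimage of a cylinder is a product of three cylinders, one for each factor of
  \<open>ubgw_law\<close>.\<close>

lemma distr_coords:
  assumes rd: "real_distribution \<omega>" "real_distribution \<xi>"
  shows "distr (ubgw_law p \<omega> \<xi>) (PiM UNIV (\<lambda>_. borel)) coords = PiM UNIV (coord_law p \<omega> \<xi>)"
proof -
  interpret \<omega>: real_distribution \<omega> by fact
  interpret \<xi>: real_distribution \<xi> by fact
  interpret Q: product_prob_space "coord_law p \<omega> \<xi>" UNIV
    by (intro product_prob_spaceI prob_space_coord_law rd)
  let ?PC = "\<lambda>u. measure_pmf (if u = [] then p else size_biased p)"
  interpret C: product_prob_space ?PC "UNIV :: nat list set"
    by (intro product_prob_spaceI measure_pmf.prob_space_axioms)
  interpret W: product_prob_space "\<lambda>_. \<omega>" "UNIV :: nat list set"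
    by (intro product_prob_spaceI \<omega>.prob_space_axioms)
  interpret X: product_prob_space "\<lambda>_. \<xi>" "UNIV :: nat list set"
    by (intro product_prob_spaceI \<xi>.prob_space_axioms)
  interpret WX: pair_prob_space "\<Pi>\<^sub>M u\<in>(UNIV :: nat list set). \<omega>" "\<Pi>\<^sub>M u\<in>(UNIV :: nat list set). \<xi>" ..
  show ?thesis
  proof (rule Q.PiM_eq)
    show "sets (distr (ubgw_law p \<omega> \<xi>) (PiM UNIV (\<lambda>_. borel)) coords) = sets (PiM UNIV (coord_law p \<omega> \<xi>))"
      by (simp add: sets_coord_law rd cong: sets_PiM_cong)
    fix J and F :: "kind \<times> nat list \<Rightarrow> real set"
    assume J: "finite J" "\<And>j. j \<in> J \<Longrightarrow> F j \<in> sets (coord_law p \<omega> \<xi> j)"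
    then have F: "\<And>j. j \<in> J \<Longrightarrow> F j \<in> sets borel" by (simp add: sets_coord_law rd)
    define S where "S k = {u. (k, u) \<in> J}" for k
    have S: "finite (S k)" for k
      unfolding S_def using J(1) finite_vimageI[of J "Pair k"] by (simp add: inj_on_def vimage_def)
    have J_eq: "J = Pair Deg ` S Deg \<union> (Pair Edge ` S Edge \<union> Pair Vert ` S Vert)"
    proof (intro equalityI subsetI)
      fix j assume "j \<in> J"
      then show "j \<in> Pair Deg ` S Deg \<union> (Pair Edge ` S Edge \<union> Pair Vert ` S Vert)"
        by (cases j; cases "fst j") (auto simp: S_def)
    qed (auto simp: S_def)
    let ?B = "\<lambda>M k G. prod_emb UNIV M (S k) (Pi\<^sub>E (S k) G)"
    let ?BC = "?B ?PC Deg (\<lambda>u. real -` F (Deg, u))"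
    let ?BW = "?B (\<lambda>_. \<omega>) Edge (\<lambda>u. F (Edge, u))"
    let ?BX = "?B (\<lambda>_. \<xi>) Vert (\<lambda>u. F (Vert, u))"
    have meas: "?BC \<in> sets (PiM UNIV ?PC)" "?BW \<in> sets (\<Pi>\<^sub>M u\<in>UNIV. \<omega>)" "?BX \<in> sets (\<Pi>\<^sub>M u\<in>UNIV. \<xi>)"
      using S F by (auto intro!: sets_PiM_I simp: S_def)
    have "prod_emb UNIV (coord_law p \<omega> \<xi>) J (Pi\<^sub>E J F) \<in> sets (PiM UNIV (coord_law p \<omega> \<xi>))"
      using J by (intro sets_PiM_I) auto
    then have box: "prod_emb UNIV (coord_law p \<omega> \<xi>) J (Pi\<^sub>E J F) \<in> sets (PiM UNIV (\<lambda>_. borel))"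
      by (simp add: sets_coord_law rd cong: sets_PiM_cong)
    have "emeasure (distr (ubgw_law p \<omega> \<xi>) (PiM UNIV (\<lambda>_. borel)) coords)
        (prod_emb UNIV (coord_law p \<omega> \<xi>) J (Pi\<^sub>E J F)) =
      emeasure (ubgw_law p \<omega> \<xi>)
        (coords -` prod_emb UNIV (coord_law p \<omega> \<xi>) J (Pi\<^sub>E J F) \<inter> space (ubgw_law p \<omega> \<xi>))"
      using box rd by (intro emeasure_distr coords_measurable)
    also have "coords -` prod_emb UNIV (coord_law p \<omega> \<xi>) J (Pi\<^sub>E J F) \<inter> space (ubgw_law p \<omega> \<xi>) =
      ?BC \<times> (?BW \<times> ?BX)"
    proof -
      have "space (coord_law p \<omega> \<xi> j) = UNIV" for j
        using sets_eq_imp_space_eq[OF sets_coord_law[OF rd]] by simp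
      then have box_mem: "f \<in> prod_emb UNIV (coord_law p \<omega> \<xi>) J (Pi\<^sub>E J F) \<longleftrightarrow> (\<forall>j\<in>J. f j \<in> F j)" for f
        by (auto simp: prod_emb_def PiE_def Pi_def)
      have "coords (c, w, x) \<in> prod_emb UNIV (coord_law p \<omega> \<xi>) J (Pi\<^sub>E J F) \<longleftrightarrow>
          (\<forall>u\<in>S Deg. real (c u) \<in> F (Deg, u)) \<and> (\<forall>u\<in>S Edge. w u \<in> F (Edge, u)) \<and>
          (\<forall>u\<in>S Vert. x u \<in> F (Vert, u))" for c w x
        unfolding box_mem by (subst J_eq) (simp add: ball_Un coords_def)
      moreover have "c \<in> ?BC \<longleftrightarrow> (\<forall>u\<in>S Deg. real (c u) \<in> F (Deg, u))"
        "w \<in> ?BW \<longleftrightarrow> (\<forall>u\<in>S Edge. w u \<in> F (Edge, u))"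
        "x \<in> ?BX \<longleftrightarrow> (\<forall>u\<in>S Vert. x u \<in> F (Vert, u))" for c w x
        by (auto simp: prod_emb_def PiE_def Pi_def)
      moreover have "space (ubgw_law p \<omega> \<xi>) = UNIV"
        by (simp add: ubgw_law_def space_pair_measure space_PiM)
      ultimately show ?thesis
        by (intro set_eqI) (simp only: split_paired_all vimage_eq Int_UNIV_right mem_Times_iff fst_conv snd_conv)
    qed
    also have "emeasure (ubgw_law p \<omega> \<xi>) (?BC \<times> (?BW \<times> ?BX)) =
      emeasure (PiM UNIV ?PC) ?BC * (emeasure (\<Pi>\<^sub>M u\<in>UNIV. \<omega>) ?BW * emeasure (\<Pi>\<^sub>M u\<in>UNIV. \<xi>) ?BX)"
      unfolding ubgw_law_def
      using meas by (simp add: WX.emeasure_pair_measure_Times X.emeasure_pair_measure_Times)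
    also have "\<dots> = (\<Prod>u\<in>S Deg. emeasure (?PC u) (real -` F (Deg, u))) *
      ((\<Prod>u\<in>S Edge. emeasure \<omega> (F (Edge, u))) * (\<Prod>u\<in>S Vert. emeasure \<xi> (F (Vert, u))))"
      using S F by (subst C.emeasure_PiM_emb W.emeasure_PiM_emb X.emeasure_PiM_emb; simp add: S_def)+
    also have "\<dots> = (\<Prod>j\<in>J. emeasure (coord_law p \<omega> \<xi> j) (F j))"
    proof -
      have "emeasure (coord_law p \<omega> \<xi> (Deg, u)) (F (Deg, u)) = emeasure (?PC u) (real -` F (Deg, u))"
        if "u \<in> S Deg" for u
        using that F[of "(Deg, u)"] unfolding coord_law_def S_def
        by (simp add: emeasure_distr)
      then show ?thesis
        unfolding J_eq using S
        by (subst prod.union_disjoint, simp, simp, force, subst prod.union_disjoint, simp, simp, force)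
          (simp add: prod.reindex inj_on_def coord_law_def)
    qed
    finally show "emeasure (distr (ubgw_law p \<omega> \<xi>) (PiM UNIV (\<lambda>_. borel)) coords)
        (prod_emb UNIV (coord_law p \<omega> \<xi>) J (Pi\<^sub>E J F)) =
      (\<Prod>j\<in>J. emeasure (coord_law p \<omega> \<xi> j) (F j))" .
  qed
qed


section \<open>Laws of messages and almost sure properties of independent labels\<close>

locale tree_vars = prob_space +
  fixes X :: "kind \<times> nat list \<Rightarrow> 'a \<Rightarrow> real" and p :: "nat pmf" and \<omega> \<xi> :: "real measure"
  assumes rd: "real_distribution \<omega>" "real_distribution \<xi>"
    and indep: "indep_vars (\<lambda>_. borel) X UNIV"
    and law: "\<And>j. distr M borel (X j) = coord_law p \<omega> \<xi> j"
    and omega_atomless: "atoms \<omega> = {}"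
begin

definition Y :: "'a \<Rightarrow> coords" where "Y z = (\<lambda>j. X j z)"

lemma X_measurable [measurable]: "X j \<in> borel_measurable M"
  using indep by (cases j) (simp add: indep_vars_def2)

lemma Y_measurable: "Y \<in> measurable M (PiM UNIV (\<lambda>_. borel))"
  unfolding Y_def by (rule measurable_PiM_single') (auto simp: space_PiM)

lemma subtree_fun_measurable:
  "subtree_fun h \<Longrightarrow> (\<lambda>z. h u (Y z)) \<in> borel_measurable M"
  using measurable_compose[OF Y_measurable subtree_funD(1)[of h u UNIV]] by simp

lemma distr_Y: "distr M (PiM UNIV (\<lambda>_. borel)) Y = PiM UNIV (coord_law p \<omega> \<xi>)"
  using indep_vars_iff_distr_eq_PiM[where I = UNIV and M' = "\<lambda>_. borel" and X = X] indep law
  by (simp add: Y_def[abs_def] restrict_def)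

text \<open>An edge weight is independent of every function of the other labels.\<close>

lemma distr_edge_minus:
  assumes q: "q \<in> borel_measurable (PiM (- {(Edge, v)}) (\<lambda>_. borel))"
    and restrict: "\<And>f. q (restrict f (- {(Edge, v)})) = q f"
  shows "distr M borel (\<lambda>z. X (Edge, v) z - q (Y z)) = diff_law \<omega> (distr M borel (\<lambda>z. q (Y z)))"
    and "(\<lambda>z. q (Y z)) \<in> borel_measurable M"
proof -
  let ?j = "(Edge, v)"
  have "indep_var (PiM {?j} (\<lambda>_. borel)) (\<lambda>z. restrict (\<lambda>i. X i z) {?j})
      (PiM (- {?j}) (\<lambda>_. borel)) (\<lambda>z. restrict (\<lambda>i. X i z) (- {?j}))"
    by (rule indep_var_restrict[OF indep]) auto
  from indep_var_compose[OF this _ q, of "\<lambda>f. f ?j" borel]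
  have ind: "indep_var borel (X ?j) borel (\<lambda>z. q (Y z))"
    by (simp add: comp_def restrict[of "Y _", unfolded Y_def] Y_def)
  show qm: "(\<lambda>z. q (Y z)) \<in> borel_measurable M"
    using indep_var_rv2[OF ind] .
  have "diff_law \<omega> (distr M borel (\<lambda>z. q (Y z))) =
      distr (distr M borel (X ?j) \<Otimes>\<^sub>M distr M borel (\<lambda>z. q (Y z))) borel (\<lambda>(w, z). w - z)"
    by (simp add: diff_law_def law coord_law_def)
  also have "\<dots> = distr (distr M (borel \<Otimes>\<^sub>M borel) (\<lambda>z. (X ?j z, q (Y z)))) borel (\<lambda>(w, z). w - z)"
    using ind by (simp add: indep_var_distribution_eq)
  also have "\<dots> = distr M borel (\<lambda>z. X ?j z - q (Y z))"
    using qm by (subst distr_distr) (auto simp: comp_def)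
  finally show "distr M borel (\<lambda>z. X ?j z - q (Y z)) = diff_law \<omega> (distr M borel (\<lambda>z. q (Y z)))" ..
qed

text \<open>The difference has an atomless law and so avoids 0. Every tie takes this form once one
  edge weight is isolated.\<close>

lemma AE_edge_neq:
  assumes q: "q \<in> borel_measurable (PiM (- {(Edge, v)}) (\<lambda>_. borel))"
    and restrict: "\<And>f. q (restrict f (- {(Edge, v)})) = q f"
  shows "AE z in M. X (Edge, v) z \<noteq> q (Y z)"
proof -
  note [measurable] = distr_edge_minus(2)[OF assms]
  let ?\<nu> = "distr M borel (\<lambda>z. q (Y z))"
  have \<nu>: "real_distribution ?\<nu>" by (rule real_distribution_distr) simp
  then interpret d: real_distribution "diff_law \<omega> ?\<nu>"
    by (rule real_distribution_diff_law[OF rd(1)])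
  have "emeasure (distr M borel (\<lambda>z. X (Edge, v) z - q (Y z))) {0} = 0"
    unfolding distr_edge_minus(1)[OF assms]
    by (simp add: d.emeasure_eq_measure diff_law_atomless[OF rd(1) \<nu> omega_atomless])
  then have "emeasure M ((\<lambda>z. X (Edge, v) z - q (Y z)) -` {0} \<inter> space M) = 0"
    by (subst (asm) emeasure_distr) auto
  then show ?thesis
    by (subst AE_iff_measurable[OF _ refl]) (auto simp: vimage_def Int_def conj_commute)
qed

text \<open>Below a non-root vertex all degrees are size-biased, so shifting by a non-empty word
  turns the law of the labels into one that does not depend on the word; \<open>[0]\<close> stands
  for any such word.\<close>

lemma law_subtree_fun:
  assumes h: "subtree_fun h" and "v \<noteq> []" "v' \<noteq> []"
  shows "distr M borel (\<lambda>z. h v (Y z)) = distr M borel (\<lambda>z. h v' (Y z))"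
proof -
  have "distr M borel (\<lambda>z. h v (Y z)) =
      distr (PiM UNIV (\<lambda>(k, u). coord_law p \<omega> \<xi> (k, [0]))) borel (h [])" if "v \<noteq> []" for v
  proof -
    let ?s = "\<lambda>j :: kind \<times> nat list. (fst j, v @ snd j)"
    have eq: "(\<lambda>j. coord_law p \<omega> \<xi> (?s j)) = (\<lambda>(k, u). coord_law p \<omega> \<xi> (k, [0]))"
      using that by (auto simp: fun_eq_iff coord_law_def split: kind.split)
    have sh: "shift v f = (\<lambda>n. f (?s n))" for f
      by (auto simp: shift_def fun_eq_iff)
    have "distr (PiM UNIV (coord_law p \<omega> \<xi>)) (PiM UNIV (\<lambda>j. coord_law p \<omega> \<xi> (?s j))) (shift v) =
        PiM UNIV (\<lambda>j. coord_law p \<omega> \<xi> (?s j))"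
      using distr_PiM_reindex[of UNIV "coord_law p \<omega> \<xi>" ?s UNIV] rd
      by (simp add: prob_space_coord_law inj_on_def sh[abs_def] prod_eq_iff restrict_def)
    note reindex = this
    have "sets (PiM UNIV (\<lambda>j. coord_law p \<omega> \<xi> (?s j))) = sets (PiM UNIV (\<lambda>_. borel))"
      "sets (PiM UNIV (coord_law p \<omega> \<xi>)) = sets (PiM UNIV (\<lambda>_. borel))"
      using rd by (auto intro!: sets_PiM_cong simp: sets_coord_law)
    note sets = this
    have shm: "shift v \<in> measurable (PiM UNIV (\<lambda>_. borel)) (PiM UNIV (\<lambda>_. borel))"
      unfolding sh[abs_def] by (rule measurable_PiM_single') (auto simp: space_PiM)
    have hm: "h [] \<in> borel_measurable (PiM UNIV (\<lambda>_. borel))"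
      by (rule subtree_funD(1)[OF h]) simp
    have "distr M borel (\<lambda>z. h v (Y z)) = distr M borel (\<lambda>z. h [] (shift v (Y z)))"
      using h unfolding subtree_fun_def by metis
    also have "\<dots> = distr (distr (PiM UNIV (coord_law p \<omega> \<xi>)) (PiM UNIV (\<lambda>_. borel)) (shift v)) borel (h [])"
      unfolding distr_Y[symmetric] using Y_measurable shm hm
      by (simp add: distr_distr comp_def measurable_comp[OF Y_measurable shm, unfolded comp_def])
    also have "distr (PiM UNIV (coord_law p \<omega> \<xi>)) (PiM UNIV (\<lambda>_. borel)) (shift v) =
        distr (PiM UNIV (coord_law p \<omega> \<xi>)) (PiM UNIV (\<lambda>j. coord_law p \<omega> \<xi> (?s j))) (shift v)"
      using sets by (intro distr_cong) auto
    finally show ?thesis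
      using reindex eq by simp
  qed
  then show ?thesis using assms by metis
qed

end

context tree_vars
begin

abbreviation offspring :: "nat list \<Rightarrow> nat pmf" where
  "offspring u \<equiv> (if u = [] then p else size_biased p)"

lemma degs_measurable [measurable]: "(\<lambda>z. degs (Y z) u) \<in> measurable M (count_space UNIV)"
  unfolding degs_def Y_def by measurable

lemma prob_degs: "prob {z \<in> space M. degs (Y z) u = k} = pmf (offspring u) k"
proof -
  have [measurable]: "{y :: real. nat \<lfloor>y\<rfloor> = k} \<in> sets borel" by measurable
  have "prob {z \<in> space M. degs (Y z) u = k} = measure (distr M borel (X (Deg, u))) {y. nat \<lfloor>y\<rfloor> = k}"
    by (subst measure_distr) (auto simp: degs_def Y_def intro!: arg_cong[where f = prob])
  also have "\<dots> = measure (measure_pmf (offspring u)) {k}"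
    unfolding law coord_law_def by (simp add: measure_distr vimage_def)
  finally show ?thesis by (simp add: pmf.rep_eq)
qed

lemma prob_vertex: "A \<in> sets borel \<Longrightarrow> prob {z \<in> space M. X (Vert, u) z \<in> A} = measure \<xi> A"
  using law[of "(Vert, u)"] measure_distr[OF X_measurable[of "(Vert, u)"], of A]
  by (simp add: coord_law_def vimage_def Int_def conj_commute)

text \<open>Given \<open>k\<close> children, the vertex weight and the \<open>k\<close> offers come
  from disjoint blocks of labels, which yields a product; summing over \<open>k\<close> produces the
  generating function.\<close>

lemma prob_relax_step:
  assumes h: "subtree_fun h" and A [measurable]: "A \<in> sets borel"
    and s: "\<And>i. prob {z \<in> space M. X (Edge, u @ [i]) z - h (u @ [i]) (Y z) \<in> A} = s"
  shows "prob {z \<in> space M. X (Vert, u) z \<in> A \<and>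
      (\<forall>i<degs (Y z) u. X (Edge, u @ [i]) z - h (u @ [i]) (Y z) \<in> A)} =
    measure \<xi> A * gf (offspring u) s"
proof -
  note [measurable] = subtree_fun_measurable[OF h]
  let ?V = "\<lambda>i z. X (Edge, u @ [i]) z - h (u @ [i]) (Y z)"
  define E where "E k = {z \<in> space M. degs (Y z) u = k \<and> X (Vert, u) z \<in> A \<and> (\<forall>i<k. ?V i z \<in> A)}" for k
  \<comment> \<open>Block 0 is the degree of \<open>u\<close>, block 1 its weight, and block i + 2
    everything that enters the offer of child \<open>i\<close>.\<close>
  define blk where "blk j = (case j of 0 \<Rightarrow> {(Deg, u)} | Suc 0 \<Rightarrow> {(Vert, u)}
    | Suc (Suc i) \<Rightarrow> insert (Edge, u @ [i]) (subtree_coords (u @ [i])))" for j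
  define S where "S k j = (case j of 0 \<Rightarrow> {f \<in> space (PiM (blk j) (\<lambda>_. borel)). degs f u = k}
    | Suc 0 \<Rightarrow> {f \<in> space (PiM (blk j) (\<lambda>_. borel)). f (Vert, u) \<in> A}
    | Suc (Suc i) \<Rightarrow> {f \<in> space (PiM (blk j) (\<lambda>_. borel)). f (Edge, u @ [i]) - h (u @ [i]) f \<in> A})" for k j
  have "disjoint_family blk"
    unfolding disjoint_family_on_def blk_def
    by (auto simp: subtree_coords_def split: nat.splits) (auto simp: prefix_def)
  then have ind: "indep_vars (\<lambda>j. PiM (blk j) (\<lambda>_. borel)) (\<lambda>j z. restrict (\<lambda>i. X i z) (blk j)) UNIV"
    by (intro indep_vars_restrict[OF indep]) auto
  have S_meas: "S k j \<in> sets (PiM (blk j) (\<lambda>_. borel))" for k j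
  proof -
    consider "j = 0" | "j = Suc 0" | i where "j = Suc (Suc i)"
      by (metis not0_implies_Suc)
    then show ?thesis
    proof cases
      case 1
      have [measurable]: "(\<lambda>f. degs f u) \<in> measurable (PiM (blk 0) (\<lambda>_. borel)) (count_space UNIV)"
        by (rule measurable_degs) (simp add: blk_def)
      show ?thesis unfolding S_def 1 by simp
    next
      case 2
      have [measurable]: "(Vert, u) \<in> blk (Suc 0)" by (simp add: blk_def)
      show ?thesis unfolding S_def 2 by simp
    next
      case (3 i)
      have [measurable]: "(Edge, u @ [i]) \<in> blk (Suc (Suc i))" by (simp add: blk_def)
      have [measurable]: "h (u @ [i]) \<in> borel_measurable (PiM (blk (Suc (Suc i))) (\<lambda>_. borel))"
        by (rule subtree_funD(1)[OF h]) (auto simp: blk_def)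
      show ?thesis unfolding S_def 3 by simp
    qed
  qed
  have vimage: "(\<lambda>z. restrict (\<lambda>i. X i z) (blk 0)) -` S k 0 \<inter> space M = {z \<in> space M. degs (Y z) u = k}"
    "(\<lambda>z. restrict (\<lambda>i. X i z) (blk (Suc 0))) -` S k (Suc 0) \<inter> space M = {z \<in> space M. X (Vert, u) z \<in> A}"
    "(\<lambda>z. restrict (\<lambda>i. X i z) (blk (Suc (Suc i)))) -` S k (Suc (Suc i)) \<inter> space M = {z \<in> space M. ?V i z \<in> A}"
    for k i
  proof -
    have "h (u @ [i]) (restrict (\<lambda>i. X i z) (blk (Suc (Suc i)))) = h (u @ [i]) (Y z)" for z
      unfolding Y_def[symmetric] by (rule subtree_funD(2)[OF h]) (auto simp: blk_def)
    then show "(\<lambda>z. restrict (\<lambda>i. X i z) (blk (Suc (Suc i)))) -` S k (Suc (Suc i)) \<inter> space M =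
        {z \<in> space M. ?V i z \<in> A}"
      by (auto simp: S_def space_PiM blk_def)
  qed (auto simp: S_def space_PiM blk_def degs_def Y_def)
  have E_prob: "prob (E k) = measure \<xi> A * (pmf (offspring u) k * s ^ k)" for k
  proof -
    let ?P = "\<lambda>j. (\<lambda>z. restrict (\<lambda>i. X i z) (blk j)) -` S k j \<inter> space M"
    have "E k = (\<Inter>j\<in>{..<Suc (Suc k)}. ?P j)"
    proof -
      have "(\<Inter>j\<in>{..<Suc (Suc k)}. ?P j) = ?P 0 \<inter> (?P (Suc 0) \<inter> (\<Inter>i\<in>{..<k}. ?P (Suc (Suc i)) ) \<inter> space M)"
        unfolding lessThan_Suc_eq_insert_0 by auto
      also have "\<dots> = E k"
        unfolding vimage E_def by auto
      finally show ?thesis ..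
    qed
    also have "prob (\<Inter>j\<in>{..<Suc (Suc k)}. ?P j) = (\<Prod>j\<in>{..<Suc (Suc k)}. prob (?P j))"
      by (rule indep_varsD[OF ind]) (auto simp: S_meas)
    also have "\<dots> = measure \<xi> A * (pmf (offspring u) k * s ^ k)"
      unfolding prod.lessThan_Suc_shift o_def vimage prob_degs prob_vertex[OF A] s by simp
    finally show ?thesis .
  qed
  have "{z \<in> space M. X (Vert, u) z \<in> A \<and> (\<forall>i<degs (Y z) u. ?V i z \<in> A)} = (\<Union>k. E k)"
    by (auto simp: E_def)
  moreover have "(\<lambda>k. prob (E k)) sums prob (\<Union>k. E k)"
  proof (rule finite_measure_UNION)
    show "range E \<subseteq> events"
    proof safe
      fix k show "E k \<in> events" unfolding E_def by measurable
    qed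
    show "disjoint_family E" by (auto simp: disjoint_family_on_def E_def)
  qed
  moreover have "0 \<le> s" "s \<le> 1" using s[of 0] by auto
  then have "(\<lambda>k. prob (E k)) sums (measure \<xi> A * gf (offspring u) s)"
    unfolding E_prob by (intro sums_mult gf_sums)
  ultimately show ?thesis by (metis sums_unique2)
qed

text \<open>As \<open>u\<close> is not the root, a message at its child has the law of the message
  at \<open>u\<close>, so the recursion closes up to an equation between two laws. It is applied to
  \<open>lo\<close> and \<open>up\<close> in both orders.\<close>

lemma prob_relax_less:
  assumes h: "subtree_fun h" and u: "u \<noteq> []"
    and rec: "\<And>f. h' u f = relax (degs f) (\<lambda>v. f (Edge, v)) (\<lambda>v. f (Vert, v)) (\<lambda>v. h v f) u"
  shows "prob {z \<in> space M. h' u (Y z) < t} = measure \<xi> {..<t} *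
    gf (size_biased p) (cdf (diff_law \<omega> (distr M borel (\<lambda>z. h u (Y z)))) t)"
proof -
  note [measurable] = subtree_fun_measurable[OF h]
  let ?\<nu> = "distr M borel (\<lambda>z. h u (Y z))"
  have \<nu>: "real_distribution ?\<nu>" by (rule real_distribution_distr) simp
  have V: "prob {z \<in> space M. X (Edge, u @ [i]) z - h (u @ [i]) (Y z) \<in> {..<t}} =
      cdf (diff_law \<omega> ?\<nu>) t" for i
  proof -
    have sub: "subtree_coords (u @ [i]) \<subseteq> - {(Edge, u @ [i])}"
      by (auto simp: subtree_coords_def)
    have "prob {z \<in> space M. X (Edge, u @ [i]) z - h (u @ [i]) (Y z) \<in> {..<t}} =
        measure (distr M borel (\<lambda>z. X (Edge, u @ [i]) z - h (u @ [i]) (Y z))) {..<t}"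
      by (subst measure_distr) (auto intro!: arg_cong[where f = prob])
    also have "\<dots> = measure (diff_law \<omega> ?\<nu>) {..<t}"
      unfolding distr_edge_minus(1)[OF subtree_funD[OF h sub]]
      using law_subtree_fun[OF h _ u, of "u @ [i]"] by simp
    also have "\<dots> = cdf (diff_law \<omega> ?\<nu>) t"
      by (intro measure_lessThan_eq_cdf real_distribution_diff_law diff_law_atomless rd \<nu> omega_atomless)
    finally show ?thesis .
  qed
  have "{z \<in> space M. h' u (Y z) < t} = {z \<in> space M. X (Vert, u) z \<in> {..<t} \<and>
      (\<forall>i<degs (Y z) u. X (Edge, u @ [i]) z - h (u @ [i]) (Y z) \<in> {..<t})}"
    unfolding rec relax_less_iff by (simp add: Y_def)
  then show ?thesis
    using prob_relax_step[OF h _ V] u by simp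
qed

text \<open>Ordered variables with equal laws agree almost surely: a strict inequality would leave a
  rational \<open>r\<close> between them, and each such event has probability P(lo < r) - P(up < r)
  = 0.\<close>

lemma AE_lo_eq_up:
  assumes p: "integrable (measure_pmf p) real" "0 < measure_pmf.expectation p real"
    and "locally_convex_under_max \<omega>" "bdd_below (msupport \<xi>)" and v: "v \<noteq> []"
  shows "AE z in M. coord_lo v (Y z) = coord_up v (Y z)"
proof -
  note [measurable] = subtree_fun_measurable[OF subtree_fun_lo] subtree_fun_measurable[OF subtree_fun_up]
  let ?\<mu> = "distr M borel (\<lambda>z. coord_lo v (Y z))"
  let ?\<nu> = "distr M borel (\<lambda>z. coord_up v (Y z))"
  have \<mu>: "measure ?\<mu> {..<t} = prob {z \<in> space M. coord_lo v (Y z) < t}" for t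
    by (subst measure_distr) (auto intro!: arg_cong[where f = prob])
  have \<nu>: "measure ?\<nu> {..<t} = prob {z \<in> space M. coord_up v (Y z) < t}" for t
    by (subst measure_distr) (auto intro!: arg_cong[where f = prob])
  have le: "coord_lo v f \<le> coord_up v f" for f
    unfolding coord_lo_def coord_up_def by (rule lo_le_up)
  have eq: "measure ?\<mu> {..<t} = measure ?\<nu> {..<t}" for t
  proof (rule alternating_fixed_point_unique[OF p rd])
    show "real_distribution ?\<mu>" "real_distribution ?\<nu>"
      by (rule real_distribution_distr, simp)+
    show "measure ?\<mu> {..<t} = measure \<xi> {..<t} * gf (size_biased p) (cdf (diff_law \<omega> ?\<nu>) t)" for t
      unfolding \<mu> by (rule prob_relax_less[OF subtree_fun_up v])
        (simp add: coord_lo_def coord_up_def[abs_def] lo_eq_relax_up[symmetric])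
    show "measure ?\<nu> {..<t} = measure \<xi> {..<t} * gf (size_biased p) (cdf (diff_law \<omega> ?\<mu>) t)" for t
      unfolding \<nu> by (rule prob_relax_less[OF subtree_fun_lo v])
        (simp add: coord_up_def coord_lo_def[abs_def] up_eq_relax_lo[symmetric])
    show "measure ?\<nu> {..<t} \<le> measure ?\<mu> {..<t}" for t
      unfolding \<mu> \<nu> by (rule finite_measure_mono) (auto intro: le_less_trans[OF le])
  qed (use assms omega_atomless in auto)
  have "AE z in M. \<forall>r::rat. \<not> (coord_lo v (Y z) < of_rat r \<and> of_rat r \<le> coord_up v (Y z))"
  proof (subst AE_all_countable, rule allI)
    fix r :: rat
    let ?t = "of_rat r :: real"
    have "prob ({z \<in> space M. coord_lo v (Y z) < ?t} - {z \<in> space M. coord_up v (Y z) < ?t}) = 0"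
      using eq[of ?t] unfolding \<mu> \<nu>
      by (subst finite_measure_Diff) (auto intro: le_less_trans[OF le])
    then show "AE z in M. \<not> (coord_lo v (Y z) < ?t \<and> ?t \<le> coord_up v (Y z))"
      by (subst (asm) prob_eq_0) (auto simp: not_less elim: AE_mp)
  qed
  then show ?thesis
  proof eventually_elim
    case (elim z)
    show ?case
    proof (rule ccontr)
      assume "coord_lo v (Y z) \<noteq> coord_up v (Y z)"
      then have "coord_lo v (Y z) < coord_up v (Y z)" using le[of "Y z"] by simp
      then show False using of_rat_dense elim by (meson less_imp_le)
    qed
  qed
qed

text \<open>The two sides can be rearranged so that one edge weight stands alone: neither the
  message at its lower end nor a sibling's subtree involves it. The third part serves the uniqueness
  of the limit.\<close>

lemma AE_no_ties:
  "AE z in M. \<forall>u i. X (Edge, u @ [i]) z - coord_lo (u @ [i]) (Y z) \<noteq> X (Vert, u) z"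
  "AE z in M. \<forall>u i j. i \<noteq> j \<longrightarrow> X (Edge, u @ [i]) z - coord_lo (u @ [i]) (Y z) \<noteq>
     X (Edge, u @ [j]) z - coord_lo (u @ [j]) (Y z)"
  "AE z in M. inj (\<lambda>u. X (Edge, u) z)"
proof -
  have sub: "subtree_coords (u @ [i]) \<subseteq> - {(Edge, u @ [i])}" for u i
    by (auto simp: subtree_coords_def)
  have sub': "subtree_coords (u @ [j]) \<subseteq> - {(Edge, u @ [i])}" if "i \<noteq> j" for u i j
    using that by (auto simp: subtree_coords_def)
  have "AE z in M. X (Edge, u @ [i]) z \<noteq> (\<lambda>f. coord_lo (u @ [i]) f + f (Vert, u)) (Y z)" for u i
  proof (rule AE_edge_neq)
    note [measurable] = subtree_funD(1)[OF subtree_fun_lo sub, of u i]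
    have [measurable]: "(Vert, u) \<in> - {(Edge, u @ [i])}" by simp
    show "(\<lambda>f. coord_lo (u @ [i]) f + f (Vert, u)) \<in> borel_measurable (PiM (- {(Edge, u @ [i])}) (\<lambda>_. borel))"
      by measurable
    show "coord_lo (u @ [i]) (restrict f (- {(Edge, u @ [i])})) + restrict f (- {(Edge, u @ [i])}) (Vert, u) =
        coord_lo (u @ [i]) f + f (Vert, u)" for f
      unfolding subtree_funD(2)[OF subtree_fun_lo sub] by simp
  qed
  note vertex = this
  have "AE z in M. X (Edge, u @ [i]) z - coord_lo (u @ [i]) (Y z) \<noteq> X (Vert, u) z" for u i
    using vertex[of u i] by eventually_elim (auto simp: Y_def)
  then show "AE z in M. \<forall>u i. X (Edge, u @ [i]) z - coord_lo (u @ [i]) (Y z) \<noteq> X (Vert, u) z"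
    by (simp add: AE_all_countable)
  have "AE z in M. X (Edge, u @ [i]) z \<noteq>
      (\<lambda>f. coord_lo (u @ [i]) f + (f (Edge, u @ [j]) - coord_lo (u @ [j]) f)) (Y z)" if "i \<noteq> j" for u i j
  proof (rule AE_edge_neq)
    note [measurable] = subtree_funD(1)[OF subtree_fun_lo sub, of u i]
      subtree_funD(1)[OF subtree_fun_lo sub'[OF that], of u]
    have [measurable]: "(Edge, u @ [j]) \<in> - {(Edge, u @ [i])}" using that by simp
    show "(\<lambda>f. coord_lo (u @ [i]) f + (f (Edge, u @ [j]) - coord_lo (u @ [j]) f))
        \<in> borel_measurable (PiM (- {(Edge, u @ [i])}) (\<lambda>_. borel))"
      by measurable
    show "coord_lo (u @ [i]) (restrict f (- {(Edge, u @ [i])})) +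
        (restrict f (- {(Edge, u @ [i])}) (Edge, u @ [j]) -
          coord_lo (u @ [j]) (restrict f (- {(Edge, u @ [i])}))) =
        coord_lo (u @ [i]) f + (f (Edge, u @ [j]) - coord_lo (u @ [j]) f)" for f
      unfolding subtree_funD(2)[OF subtree_fun_lo sub] subtree_funD(2)[OF subtree_fun_lo sub'[OF that]]
      using that by simp
  qed
  note edges = this
  have "AE z in M. i \<noteq> j \<longrightarrow> X (Edge, u @ [i]) z - coord_lo (u @ [i]) (Y z) \<noteq>
     X (Edge, u @ [j]) z - coord_lo (u @ [j]) (Y z)" for u i j
  proof (cases "i = j")
    case False
    show ?thesis
      using edges[OF False, of u] by eventually_elim (auto simp: Y_def)
  qed simp
  then show "AE z in M. \<forall>u i j. i \<noteq> j \<longrightarrow> X (Edge, u @ [i]) z - coord_lo (u @ [i]) (Y z) \<noteq>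
     X (Edge, u @ [j]) z - coord_lo (u @ [j]) (Y z)"
    by (simp add: AE_all_countable)
  have "AE z in M. X (Edge, u) z \<noteq> (\<lambda>f. f (Edge, v)) (Y z)" if "u \<noteq> v" for u v
  proof (rule AE_edge_neq)
    have [measurable]: "(Edge, v) \<in> - {(Edge, u)}" using that by simp
    show "(\<lambda>f. f (Edge, v)) \<in> borel_measurable (PiM (- {(Edge, u)}) (\<lambda>_. borel))" by measurable
  qed (use that in simp)
  note weights = this
  have "AE z in M. u \<noteq> v \<longrightarrow> X (Edge, u) z \<noteq> X (Edge, v) z" for u v
    using weights[of u v] by (cases "u = v") (simp_all add: Y_def)
  then have "AE z in M. \<forall>u v. u \<noteq> v \<longrightarrow> X (Edge, u) z \<noteq> X (Edge, v) z"
    by (simp add: AE_all_countable)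
  then show "AE z in M. inj (\<lambda>u. X (Edge, u) z)"
    by eventually_elim (auto simp: inj_def)
qed

end

section \<open>Truncated trees and uniqueness\<close>

text \<open>With distinct edge weights an isomorphism of balls cannot move an edge.\<close>

lemma decorated_limit_unique:
  assumes conv: "decorated_converges_locally G Dn (uh_graph (c, w, x)) D"
      "decorated_converges_locally G Dn (uh_graph (c, w, x)) D'"
    and inj: "inj w" and sub: "D \<subseteq> edges (uh_graph (c, w, x))" "D' \<subseteq> edges (uh_graph (c, w, x))"
  shows "D = D'"
proof -
  let ?T = "uh_graph (c, w, x)"
  have "e \<in> D \<longleftrightarrow> e \<in> D'" if e: "e \<in> edges ?T" for e
  proof -
    obtain u i where ui: "e = {u, u @ [i]}" "u @ [i] \<in> uh_verts c"
      using e unfolding edges_uh_graph by blast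
    define H where "H = length u"
    have eH: "e \<subseteq> ball_verts H ?T"
      using ui by (auto simp: ball_verts_uh_graph H_def uh_verts_snoc)
    obtain N N' where "\<forall>n\<ge>N. decorated_isomorphic (gball H (G n)) (config_ball H (G n) (Dn n))
          (gball H ?T) (config_ball H ?T D)"
        "\<forall>n\<ge>N'. decorated_isomorphic (gball H (G n)) (config_ball H (G n) (Dn n))
          (gball H ?T) (config_ball H ?T D')"
      using conv unfolding decorated_converges_locally_def by metis
    then obtain n where "decorated_isomorphic (gball H (G n)) (config_ball H (G n) (Dn n))
          (gball H ?T) (config_ball H ?T D)"
        "decorated_isomorphic (gball H (G n)) (config_ball H (G n) (Dn n))
          (gball H ?T) (config_ball H ?T D')"
      by (meson max.cobounded1 max.cobounded2)
    then obtain f f' where f: "wgraph_iso f (gball H (G n)) (gball H ?T)"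
        "\<forall>e\<in>edges (gball H (G n)). e \<in> config_ball H (G n) (Dn n) \<longleftrightarrow> f ` e \<in> config_ball H ?T D"
      and f': "wgraph_iso f' (gball H (G n)) (gball H ?T)"
        "\<forall>e\<in>edges (gball H (G n)). e \<in> config_ball H (G n) (Dn n) \<longleftrightarrow> f' ` e \<in> config_ball H ?T D'"
      unfolding decorated_isomorphic_def by blast
    have "f ` verts (gball H (G n)) = verts (gball H ?T)"
      using f(1) by (auto simp: wgraph_iso_def bij_betw_def)
    then have "u \<in> f ` verts (gball H (G n))" "u @ [i] \<in> f ` verts (gball H (G n))"
      using eH ui(1) by simp_all
    then obtain a b where ab: "a \<in> verts (gball H (G n))" "b \<in> verts (gball H (G n))"
        "f a = u" "f b = u @ [i]"
      by (elim imageE) metis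
    have "e \<in> edges (gball H ?T)" using e eH by simp
    then have e0: "{a, b} \<in> edges (gball H (G n))"
      using f(1) ab ui(1) unfolding wgraph_iso_def by auto
    then have "{f' a, f' b} \<in> edges (gball H ?T)"
      using f'(1) ab unfolding wgraph_iso_def by blast
    then have e': "{f' a, f' b} \<in> edges ?T" "{f' a, f' b} \<subseteq> ball_verts H ?T" by simp_all
    \<comment> \<open>Both isomorphisms preserve the weight of the edge {a, b}; as tree weights are
      distinct, both map it to \<open>e\<close>, so \<open>D\<close> and \<open>D'\<close> inherit
      the same answer from \<open>Dn n\<close>.\<close>
    have "ew (gball H (G n)) {a, b} = ew (gball H ?T) (f ` {a, b})"
      "ew (gball H (G n)) {a, b} = ew (gball H ?T) (f' ` {a, b})"
      using f(1) f'(1) e0 unfolding wgraph_iso_def by blast+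
    then have "ew ?T {f' a, f' b} = ew ?T e"
      using ab ui(1) by simp
    moreover obtain v j where vj: "{f' a, f' b} = {v, v @ [j]}"
      using e'(1) unfolding edges_uh_graph by blast
    ultimately have "w (v @ [j]) = w (u @ [i])"
      by (simp only: ui(1) uh_edge_weight)
    then have "{f' a, f' b} = e"
      using inj vj ui(1) by (auto dest: injD)
    then show ?thesis
      using f(2)[rule_format, OF e0] f'(2)[rule_format, OF e0] ab ui(1) eH
      by (simp add: config_ball_def)
  qed
  then show ?thesis using sub by blast
qed

section \<open>Finite truncations of the tree and a measurable choice of their optima\<close>

definition words :: "nat \<Rightarrow> nat list set" where
  "words n = {u. length u \<le> n \<and> set u \<subseteq> {..<n}}"

lemma finite_words: "finite (words n)"
  unfolding words_def using finite_lists_length_le[of "{..<n}" n] by (simp add: conj_commute)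

lemma words_snocD: "u @ [i] \<in> words n \<Longrightarrow> u \<in> words n"
  by (simp add: words_def)

lemma Nil_in_words: "[] \<in> words n"
  by (simp add: words_def)

text \<open>The cut uses a finite set of words that does not depend on the labels. As
  \<open>from_nat\<close> inverts \<open>to_nat\<close> only on its range, the last condition on
  edges selects the canonical copy of each tree edge.\<close>

definition truncation :: "nat \<Rightarrow> uh_labels \<Rightarrow> nat wgraph" where
  "truncation n L =
     \<lparr> verts = to_nat ` (verts (uh_graph L) \<inter> words n),
       edges = {e. from_nat ` e \<in> edges (uh_graph L) \<and> from_nat ` e \<subseteq> words n \<and>
         e = to_nat ` (from_nat ` e :: nat list set)},
       ew = (\<lambda>e. ew (uh_graph L) (from_nat ` e)),
       vw = (\<lambda>v. vw (uh_graph L) (from_nat v)),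
       root = to_nat ([] :: nat list) \<rparr>"

lemma simps_truncation [simp]:
  "verts (truncation n (c, w, x)) = to_nat ` (uh_verts c \<inter> words n)"
  "ew (truncation n L) e = ew (uh_graph L) (from_nat ` e)"
  "vw (truncation n (c, w, x)) v = x (from_nat v)"
  "root (truncation n L) = to_nat ([] :: nat list)"
  by (simp_all add: truncation_def)

lemma mem_edges_truncation:
  "e \<in> edges (truncation n L) \<longleftrightarrow> from_nat ` e \<in> edges (uh_graph L) \<and>
     from_nat ` e \<subseteq> words n \<and> e = to_nat ` (from_nat ` e :: nat list set)"
  by (simp add: truncation_def)

lemma edge_truncation:
  "{to_nat u, to_nat v} \<in> edges (truncation n L) \<longleftrightarrow>
     {u, v} \<in> edges (uh_graph L) \<and> u \<in> words n \<and> v \<in> words n"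
  by (auto simp: mem_edges_truncation)

lemma edge_truncation_cases:
  assumes "e \<in> edges (truncation n (c, w, x))"
  obtains u i where "e = {to_nat u, to_nat (u @ [i])}" "u @ [i] \<in> uh_verts c" "u @ [i] \<in> words n"
proof -
  have "from_nat ` e \<in> edges (uh_graph (c, w, x))"
    using assms by (simp only: mem_edges_truncation)
  then obtain u i where ui: "from_nat ` e = {u, u @ [i]}" "u @ [i] \<in> uh_verts c"
    unfolding edges_uh_graph by (elim CollectE exE conjE)
  have "e = to_nat ` (from_nat ` e :: nat list set)" "from_nat ` e \<subseteq> words n"
    using assms by (simp_all only: mem_edges_truncation)
  then have "e = to_nat ` {u, u @ [i]}" "u @ [i] \<in> words n"
    unfolding ui(1) by simp_all
  then show ?thesis using ui(2) that by simp
qed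

lemma weighted_graph_truncation: "weighted_graph (truncation n L)"
  and finite_truncation: "finite (verts (truncation n L))"
proof -
  obtain c w x where L: "L = (c, w, x)" by (cases L) auto
  show fin: "finite (verts (truncation n L))"
    using finite_words by (simp add: L)
  have sub: "edges (truncation n L) \<subseteq>
      {{u, v} |u v. u \<in> verts (truncation n L) \<and> v \<in> verts (truncation n L) \<and> u \<noteq> v}"
  proof
    fix e assume "e \<in> edges (truncation n L)"
    then obtain u i where "e = {to_nat u, to_nat (u @ [i])}" "u @ [i] \<in> uh_verts c" "u @ [i] \<in> words n"
      unfolding L by (rule edge_truncation_cases)
    then show "e \<in> {{u, v} |u v. u \<in> verts (truncation n L) \<and> v \<in> verts (truncation n L) \<and> u \<noteq> v}"
      by (intro CollectI exI[of _ "to_nat u"] exI[of _ "to_nat (u @ [i])"])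
        (auto simp: L uh_verts_snoc dest: words_snocD)
  qed
  moreover have "finite (edges (truncation n L))"
    by (rule finite_subset[of _ "Pow (verts (truncation n L))"]) (use sub fin in \<open>auto simp: subset_iff\<close>)
  ultimately show "weighted_graph (truncation n L)"
    by (auto simp: weighted_graph_def L Nil_in_words uh_verts_def)
qed

lemma adj_truncation_length:
  "(to_nat ([] :: nat list), a) \<in> adj (truncation n (c, w, x)) ^^ j \<Longrightarrow>
    \<exists>v :: nat list. a = to_nat v \<and> length v \<le> j"
proof (induction j arbitrary: a)
  case (Suc j)
  then obtain y where y: "(to_nat ([] :: nat list), y) \<in> adj (truncation n (c, w, x)) ^^ j"
    "{y, a} \<in> edges (truncation n (c, w, x))" by auto
  then obtain v :: "nat list" where v: "y = to_nat v" "length v \<le> j" using Suc.IH by blast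
  obtain u :: "nat list" and i where "{y, a} = {to_nat u, to_nat (u @ [i])}"
    using y(2) by (rule edge_truncation_cases) (erule that)
  then have "a = to_nat (v @ [i]) \<or> v = u @ [i] \<and> a = to_nat u"
    using v(1) by (auto simp: doubleton_eq_iff)
  then show ?case using v(2) by auto
qed auto

lemma adj_truncation_root:
  "v \<in> uh_verts c \<Longrightarrow> v \<in> words n \<Longrightarrow>
    (to_nat ([] :: nat list), to_nat v) \<in> adj (truncation n (c, w, x)) ^^ length v"
proof (induction v rule: rev_induct)
  case (snoc i u)
  have "{to_nat u, to_nat (u @ [i])} \<in> edges (truncation n (c, w, x))"
    using snoc.prems uh_edgeI[of u c i w x] words_snocD[of u i n]
    by (simp add: edge_truncation uh_verts_snoc)
  then show ?case using snoc words_snocD[of u i n] by (auto simp: uh_verts_snoc)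
qed simp

lemma ball_verts_truncation:
  "ball_verts H (truncation n (c, w, x)) = to_nat ` {u \<in> uh_verts c. length u \<le> H + 1 \<and> u \<in> words n}"
proof (intro equalityI subsetI)
  fix a assume a: "a \<in> ball_verts H (truncation n (c, w, x))"
  then obtain u where u: "a = to_nat u" "u \<in> uh_verts c" "u \<in> words n"
    by (auto simp: ball_verts_def)
  obtain j where "j \<le> H + 1" "(to_nat ([] :: nat list), a) \<in> adj (truncation n (c, w, x)) ^^ j"
    using a unfolding ball_verts_def gdist_le_iff by auto
  then have "length u \<le> H + 1"
    using adj_truncation_length[of a j n c w x] u(1) by auto
  then show "a \<in> to_nat ` {u \<in> uh_verts c. length u \<le> H + 1 \<and> u \<in> words n}"
    using u by simp
next
  fix a assume "a \<in> to_nat ` {u \<in> uh_verts c. length u \<le> H + 1 \<and> u \<in> words n}"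
  then obtain u where u: "a = to_nat u" "u \<in> uh_verts c" "u \<in> words n" "length u \<le> H + 1" by auto
  then have "gdist (truncation n (c, w, x)) (to_nat ([] :: nat list)) a \<le> enat (H + 1)"
    unfolding gdist_le_iff using adj_truncation_root by blast
  then show "a \<in> ball_verts H (truncation n (c, w, x))"
    using u by (simp add: ball_verts_def)
qed

lemma truncation_converges: "converges_locally (\<lambda>n. truncation n L) (uh_graph L)"
  unfolding converges_locally_def
proof
  fix H
  obtain c w x where L: "L = (c, w, x)" by (cases L) auto
  let ?B = "{u \<in> uh_verts c. length u \<le> H + 1}"
  have fin: "finite ?B" by (rule finite_uh_verts_le)
  \<comment> \<open>\<open>Suc H\<close> covers the lengths of the words of the ball and the maximum
    covers their letters; 0 keeps the set non-empty when the ball is only the root.\<close>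
  define N where "N = Suc (H + Max (insert 0 (\<Union>u\<in>?B. set u)))"
  have B_words: "u \<in> words n" if "u \<in> ?B" "N \<le> n" for u n
  proof -
    have "k < n" if "k \<in> set u" for k
    proof -
      have "k \<le> Max (insert 0 (\<Union>u\<in>?B. set u))"
        using fin that \<open>u \<in> ?B\<close> by (intro Max_ge) auto
      then show ?thesis using \<open>N \<le> n\<close> by (simp add: N_def)
    qed
    then show ?thesis using that by (auto simp: words_def N_def)
  qed
  show "\<exists>N. \<forall>n\<ge>N. wgraph_isomorphic (gball H (truncation n L)) (gball H (uh_graph L))"
  proof (intro exI allI impI)
    fix n assume n: "N \<le> n"
    have ball: "ball_verts H (truncation n L) = to_nat ` ?B"
      unfolding L ball_verts_truncation using B_words[OF _ n] by auto
    have ball_T: "ball_verts H (uh_graph L) = ?B"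
      unfolding L by (rule ball_verts_uh_graph)
    have "bij_betw from_nat (to_nat ` ?B) ?B"
      by (rule bij_betwI[of _ _ _ to_nat]) auto
    moreover have "{to_nat u, to_nat v} \<in> edges (truncation n L) \<longleftrightarrow> {u, v} \<in> edges (uh_graph L)"
      if "u \<in> ?B" "v \<in> ?B" for u v
      using B_words[OF that(1) n] B_words[OF that(2) n] by (simp add: edge_truncation)
    ultimately have "wgraph_iso from_nat (gball H (truncation n L)) (gball H (uh_graph L))"
      unfolding wgraph_iso_def simps_gball ball ball_T by (auto simp: L)
    then show "wgraph_isomorphic (gball H (truncation n L)) (gball H (uh_graph L))"
      unfolding wgraph_isomorphic_def by blast
  qed
qed

definition candidates :: "nat \<Rightarrow> nat set set set" where
  "candidates n = Pow (Pow (to_nat ` words n))"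

lemma finite_candidates: "finite (candidates n)"
  unfolding candidates_def using finite_words by simp

text \<open>For fixed \<open>D\<close> the random tree enters only through finitely many edge
  events, which makes being a configuration a measurable event.\<close>

lemma md_config_truncation_iff:
  "md_config (truncation n L) D \<longleftrightarrow> D \<in> candidates n \<and> (\<forall>e\<in>D. e \<in> edges (truncation n L)) \<and>
     (\<forall>e\<in>D. \<forall>e'\<in>D. e \<inter> e' \<noteq> {} \<longrightarrow> e = e')"
proof
  assume md: "md_config (truncation n L) D"
  have "e \<in> Pow (to_nat ` words n)" if "e \<in> D" for e
  proof -
    have "e \<in> edges (truncation n L)" using md that unfolding md_config_def by blast
    then have "from_nat ` e \<subseteq> words n" "e = to_nat ` (from_nat ` e :: nat list set)"
      unfolding mem_edges_truncation by blast+
    then show ?thesis by (metis Pow_iff image_mono)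
  qed
  moreover have "D \<subseteq> edges (truncation n L)" using md unfolding md_config_def by blast
  ultimately show "D \<in> candidates n \<and> (\<forall>e\<in>D. e \<in> edges (truncation n L)) \<and>
      (\<forall>e\<in>D. \<forall>e'\<in>D. e \<inter> e' \<noteq> {} \<longrightarrow> e = e')"
    using md_config_unique[OF weighted_graph_truncation md] unfolding candidates_def by blast
next
  assume D: "D \<in> candidates n \<and> (\<forall>e\<in>D. e \<in> edges (truncation n L)) \<and>
     (\<forall>e\<in>D. \<forall>e'\<in>D. e \<inter> e' \<noteq> {} \<longrightarrow> e = e')"
  show "md_config (truncation n L) D"
    unfolding md_config_def
  proof (intro conjI ballI impI)
    fix v e e' assume "e \<in> D" "e' \<in> D" "v \<in> e \<and> v \<in> e'"
    then have "e \<inter> e' \<noteq> {}" by blast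
    then show "e = e'" using D \<open>e \<in> D\<close> \<open>e' \<in> D\<close> by simp
  qed (use D in blast)
qed

lemma md_weight_truncation:
  "md_weight (truncation n (c, w, x)) D = (\<Sum>e\<in>D. ew (uh_graph (c, w, x)) (from_nat ` e)) +
     (\<Sum>u\<in>words n. if u \<in> uh_verts c \<and> (\<forall>e\<in>D. to_nat u \<notin> e) then x u else 0)"
proof -
  have "monomers (truncation n (c, w, x)) D =
      to_nat ` {u \<in> words n. u \<in> uh_verts c \<and> (\<forall>e\<in>D. to_nat u \<notin> e)}"
    by (auto simp: monomers_def)
  then have "(\<Sum>v\<in>monomers (truncation n (c, w, x)) D. x (from_nat v)) =
      (\<Sum>u\<in>{u \<in> words n. u \<in> uh_verts c \<and> (\<forall>e\<in>D. to_nat u \<notin> e)}. x u)"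
    by (simp add: sum.reindex inj_on_def)
  then show ?thesis
    using finite_words by (simp add: md_weight_def sum.inter_filter)
qed

text \<open>The first optimum in a list that is the same for all labels. An arbitrary optimum for
  each outcome would give no control over measurability.\<close>

definition truncation_optimum :: "nat \<Rightarrow> uh_labels \<Rightarrow> nat set set" where
  "truncation_optimum n L =
     the (find (optimal_md (truncation n L)) (SOME Ds. set Ds = candidates n))"

lemma set_candidates: "set (SOME Ds. set Ds = candidates n) = candidates n"
  by (rule someI_ex) (rule finite_list[OF finite_candidates])

lemma optimal_truncation_optimum: "optimal_md (truncation n L) (truncation_optimum n L)"
proof -
  let ?C = "{D. md_config (truncation n L) D}"
  have fin: "finite ?C"
    by (rule finite_subset[OF _ finite_candidates[of n]]) (auto simp: md_config_truncation_iff)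
  have "{} \<in> ?C" by (simp add: md_config_def)
  then have "Max (md_weight (truncation n L) ` ?C) \<in> md_weight (truncation n L) ` ?C"
    using fin by (intro Max_in) auto
  then obtain D where D: "D \<in> ?C" "md_weight (truncation n L) D = Max (md_weight (truncation n L) ` ?C)"
    by auto
  then have "optimal_md (truncation n L) D"
    using fin by (auto simp: optimal_md_def)
  moreover have "D \<in> candidates n" using D by (simp add: md_config_truncation_iff)
  ultimately obtain D' where "find (optimal_md (truncation n L)) (SOME Ds. set Ds = candidates n) = Some D'"
    using find_None_iff[of "optimal_md (truncation n L)" "SOME Ds. set Ds = candidates n"]
      set_candidates[of n] by (cases "find (optimal_md (truncation n L)) (SOME Ds. set Ds = candidates n)") auto
  moreover from this have "optimal_md (truncation n L) D'" by (metis find_Some_iff)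
  ultimately show ?thesis by (simp add: truncation_optimum_def)
qed

lemma coords_simps [simp]:
  "coords L (Deg, u) = real (fst L u)" "coords L (Edge, u) = fst (snd L) u"
  "coords L (Vert, u) = snd (snd L) u"
  by (simp_all add: coords_def case_prod_beta)

section \<open>The random tree: measurability, existence and uniqueness of the limit\<close>

locale random_tree = prob_space +
  fixes T :: "'a \<Rightarrow> uh_labels" and p :: "nat pmf" and \<omega> \<xi> :: "real measure"
  assumes distributions: "real_distribution \<omega>" "real_distribution \<xi>"
    and tree: "weighted_ubgw_tree p \<omega> \<xi> M T" and atomless: "atoms \<omega> = {}"
begin

lemma distr_coords_T: "distr M (PiM UNIV (\<lambda>_. borel)) (\<lambda>z. coords (T z)) = PiM UNIV (coord_law p \<omega> \<xi>)"
  and coords_T_measurable: "(\<lambda>z. coords (T z)) \<in> measurable M (PiM UNIV (\<lambda>_. borel))"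
proof -
  have T: "T \<in> measurable M (ubgw_law p \<omega> \<xi>)" "distr M (ubgw_law p \<omega> \<xi>) T = ubgw_law p \<omega> \<xi>"
    using tree by (auto simp: weighted_ubgw_tree_def)
  note c = coords_measurable[OF distributions, of p]
  show "(\<lambda>z. coords (T z)) \<in> measurable M (PiM UNIV (\<lambda>_. borel))"
    using measurable_comp[OF T(1) c] by (simp add: comp_def)
  show "distr M (PiM UNIV (\<lambda>_. borel)) (\<lambda>z. coords (T z)) = PiM UNIV (coord_law p \<omega> \<xi>)"
    using distr_distr[OF c T(1)] unfolding T(2) distr_coords[OF distributions]
    by (simp add: comp_def)
qed

sublocale tree_vars M "\<lambda>j z. coords (T z) j" p \<omega> \<xi>
proof (intro tree_vars.intro tree_vars_axioms.intro)
  have meas: "(\<lambda>z. coords (T z) j) \<in> borel_measurable M" for j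
    using measurable_compose[OF coords_T_measurable measurable_component_singleton[of j UNIV]] by simp
  interpret Q: product_prob_space "coord_law p \<omega> \<xi>" UNIV
    by (intro product_prob_spaceI prob_space_coord_law distributions)
  show law: "distr M borel (\<lambda>z. coords (T z) j) = coord_law p \<omega> \<xi> j" for j
  proof -
    have "distr M borel (\<lambda>z. coords (T z) j) =
        distr (distr M (PiM UNIV (\<lambda>_. borel)) (\<lambda>z. coords (T z))) borel (\<lambda>f. f j)"
      by (subst distr_distr[OF _ coords_T_measurable]) (auto simp: comp_def)
    also have "\<dots> = distr (PiM UNIV (coord_law p \<omega> \<xi>)) (coord_law p \<omega> \<xi> j) (\<lambda>f. f j)"
      unfolding distr_coords_T using sets_coord_law[OF distributions] by (intro distr_cong) auto
    also have "\<dots> = coord_law p \<omega> \<xi> j" by (rule Q.PiM_component) simp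
    finally show ?thesis .
  qed
  show "indep_vars (\<lambda>_. borel) (\<lambda>j z. coords (T z) j) UNIV"
    using indep_vars_iff_distr_eq_PiM[where I = UNIV and M' = "\<lambda>_. borel" and X = "\<lambda>j z. coords (T z) j"]
      meas law distr_coords_T by (simp add: restrict_def)
qed (rule distributions atomless prob_space_axioms)+

abbreviation "cT z \<equiv> fst (T z)"
abbreviation "wT z \<equiv> fst (snd (T z))"
abbreviation "xT z \<equiv> snd (snd (T z))"

lemma T_eq: "T z = (cT z, wT z, xT z)" by simp

lemma Y_eq: "degs (Y z) = cT z" "Y z (Edge, u) = wT z u" "Y z (Vert, u) = xT z u"
  by (simp_all add: Y_def degs_def fun_eq_iff)

lemma lo_up_eq: "coord_lo u (Y z) = lo (cT z) (wT z) (xT z) u" "coord_up u (Y z) = up (cT z) (wT z) (xT z) u"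
  by (simp_all add: coord_lo_def coord_up_def Y_eq)

lemma measurable_labels [measurable]:
  "(\<lambda>z. cT z u) \<in> measurable M (count_space UNIV)"
  "(\<lambda>z. wT z u) \<in> borel_measurable M" "(\<lambda>z. xT z u) \<in> borel_measurable M"
  using degs_measurable[of u] X_measurable[of "(Edge, u)"] X_measurable[of "(Vert, u)"]
  by (simp_all add: Y_eq)

lemma measurable_lo [measurable]: "(\<lambda>z. lo (cT z) (wT z) (xT z) u) \<in> borel_measurable M"
  using subtree_fun_measurable[OF subtree_fun_lo, of u] by (simp add: lo_up_eq)

lemma measurable_uh_verts [measurable]: "Measurable.pred M (\<lambda>z. u \<in> uh_verts (cT z))"
  unfolding uh_verts_def by simp

lemma measurable_taken [measurable]: "Measurable.pred M (\<lambda>z. taken (cT z) (wT z) (xT z) u)"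
proof (induction u rule: rev_induct)
  case (snoc i u)
  note [measurable] = snoc
  show ?case unfolding taken_snoc prefers_def by measurable
qed simp

lemma measurable_edges [measurable]: "Measurable.pred M (\<lambda>z. e \<in> edges (uh_graph (T z)))"
proof -
  have "e \<in> edges (uh_graph (T z)) \<longleftrightarrow> (\<exists>u i. e = {u, u @ [i]} \<and> u @ [i] \<in> uh_verts (cT z))" for z
    by (subst T_eq) (auto simp only: edges_uh_graph mem_Collect_eq)
  then show ?thesis by simp
qed

lemma measurable_ew [measurable]: "(\<lambda>z. ew (uh_graph (T z)) e) \<in> borel_measurable M"
  by (simp add: uh_graph_def case_prod_beta)

lemma random_config_tree_config: "random_config M (\<lambda>z. uh_graph (T z)) (\<lambda>z. tree_config (T z))"
  unfolding random_config_def
proof (intro conjI ballI allI)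
  fix e :: "nat list set"
  have "e \<in> tree_config (T z) \<longleftrightarrow> (\<exists>u i. e = {u, u @ [i]} \<and> u @ [i] \<in> uh_verts (cT z) \<and>
      taken (cT z) (wT z) (xT z) (u @ [i]))" for z
  proof -
    have "e \<in> tree_config (T z) \<Longrightarrow> e \<in> edges (uh_graph (T z))"
      using md_config_tree_config[of "T z"] unfolding md_config_def by blast
    then show ?thesis
      using edge_mem_tree_config[of _ _ "cT z" "wT z" "xT z"] edges_uh_graph[of "cT z" "wT z" "xT z"]
      by auto
  qed
  then show "{z \<in> space M. e \<in> tree_config (T z)} \<in> sets M" by simp
qed (rule md_config_tree_config)

lemma AE_generic:
  assumes "integrable (measure_pmf p) real" "0 < measure_pmf.expectation p real"
    and "locally_convex_under_max \<omega>" "bdd_below (msupport \<xi>)"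
  shows "AE z in M. generic (T z)"
proof -
  have "AE z in M. \<forall>v. v \<noteq> [] \<longrightarrow> coord_lo v (Y z) = coord_up v (Y z)"
    using AE_lo_eq_up[OF assms] by (subst AE_all_countable) (auto intro: AE_impI)
  then show ?thesis
    using AE_no_ties(1,2)
  proof eventually_elim
    case (elim z)
    then show ?case
      by (simp add: generic_def case_prod_beta lo_up_eq)
  qed
qed

lemma AE_inj_weights: "AE z in M. inj (wT z)"
  using AE_no_ties(3) by simp

lemma limit_of_optima_tree_config:
  assumes "AE z in M. generic (T z)"
  shows "limit_of_optima M (\<lambda>z. uh_graph (T z)) (\<lambda>z. tree_config (T z))"
  unfolding limit_of_optima_def
proof (intro allI impI, elim conjE)
  fix G :: "nat \<Rightarrow> 'a \<Rightarrow> nat wgraph" and Dn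
  assume G: "\<forall>n. random_finite_graph M (G n)"
    and conv: "AE z in M. converges_locally (\<lambda>n. G n z) (uh_graph (T z))"
    and opt: "\<forall>n. AE z in M. optimal_md (G n z) (Dn n z)"
  have "AE z in M. \<forall>n. optimal_md (G n z) (Dn n z)"
    using opt by (simp add: AE_all_countable)
  then show "AE z in M. decorated_converges_locally (\<lambda>n. G n z) (\<lambda>n. Dn n z) (uh_graph (T z)) (tree_config (T z))"
    using AE_space conv assms
  proof eventually_elim
    case (elim z)
    then show ?case
      using G by (intro optima_converge_locally) (auto simp: random_finite_graph_def)
  qed
qed

lemma measurable_truncation_edges [measurable]:
  "Measurable.pred M (\<lambda>z. e \<in> edges (truncation n (T z)))"
  unfolding mem_edges_truncation by measurable

lemma measurable_truncation_verts [measurable]: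
  "Measurable.pred M (\<lambda>z. v \<in> verts (truncation n (T z)))"
proof -
  have "v \<in> verts (truncation n (T z)) \<longleftrightarrow>
      (\<exists>u. v = to_nat u \<and> u \<in> uh_verts (cT z) \<and> u \<in> words n)" for z
    by (subst T_eq) (auto simp only: simps_truncation)
  then show ?thesis by simp
qed

lemma random_truncation: "random_finite_graph M (\<lambda>z. truncation n (T z))"
  unfolding random_finite_graph_def
proof (intro conjI allI ballI)
  fix v
  have eq: "vw (truncation n (T z)) v = xT z (from_nat v)" for z
    by (subst T_eq) (simp only: simps_truncation)
  show "(\<lambda>z. if v \<in> verts (truncation n (T z)) then vw (truncation n (T z)) v else 0) \<in> borel_measurable M"
    unfolding eq by measurable
  show "(\<lambda>z. if e \<in> edges (truncation n (T z)) then ew (truncation n (T z)) e else 0) \<in> borel_measurable M" for e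
    unfolding simps_truncation(2) by measurable
qed (simp_all add: weighted_graph_truncation finite_truncation)

lemma measurable_truncation_optimal:
  "Measurable.pred M (\<lambda>z. optimal_md (truncation n (T z)) D)"
proof (cases "D \<in> candidates n")
  case True
  have fin: "finite D" if "D \<in> candidates n" for D
    using that finite_words unfolding candidates_def by (auto intro: finite_subset)
  have config [measurable]: "Measurable.pred M (\<lambda>z. md_config (truncation n (T z)) D)" if "D \<in> candidates n" for D
    unfolding md_config_truncation_iff using fin[OF that] by measurable
  have weight [measurable]: "(\<lambda>z. md_weight (truncation n (T z)) D) \<in> borel_measurable M"
    if "D \<in> candidates n" for D
  proof -
    have "md_weight (truncation n (T z)) D = (\<Sum>e\<in>D. ew (uh_graph (T z)) (from_nat ` e)) +
     (\<Sum>u\<in>words n. if u \<in> uh_verts (cT z) \<and> (\<forall>e\<in>D. to_nat u \<notin> e) then xT z u else 0)" for z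
      using md_weight_truncation[of n "cT z" "wT z" "xT z" D] by simp
    then show ?thesis using fin[OF that] by simp
  qed
  have "optimal_md (truncation n (T z)) D \<longleftrightarrow> md_config (truncation n (T z)) D \<and>
      (\<forall>D'\<in>candidates n. md_config (truncation n (T z)) D' \<longrightarrow>
        md_weight (truncation n (T z)) D' \<le> md_weight (truncation n (T z)) D)" for z
    unfolding optimal_md_def by (auto simp: md_config_truncation_iff)
  then show ?thesis
    using True finite_candidates[of n] by simp
next
  case False
  then have "\<not> optimal_md (truncation n (T z)) D" for z
    by (simp add: optimal_md_def md_config_truncation_iff)
  then show ?thesis by simp
qed

text \<open>The list is fixed, so the search is a finite nest of case distinctions on measurable
  events.\<close>

lemma measurable_find:
  assumes P: "\<And>D. Measurable.pred M (\<lambda>z. P z D)"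
  shows "Measurable.pred M (\<lambda>z. e \<in> the (find (P z) Ds))"
proof (induction Ds)
  case (Cons D Ds)
  note [measurable] = Cons P
  have "e \<in> the (find (P z) (D # Ds)) \<longleftrightarrow> (if P z D then e \<in> D else e \<in> the (find (P z) Ds))" for z
    by simp
  then show ?case by simp
qed simp

lemma random_config_truncation_optimum:
  "random_config M (\<lambda>z. truncation n (T z)) (\<lambda>z. truncation_optimum n (T z))"
  unfolding random_config_def
proof (intro conjI ballI allI)
  show "md_config (truncation n (T z)) (truncation_optimum n (T z))" for z
    using optimal_truncation_optimum by (simp add: optimal_md_def)
  show "{z \<in> space M. e \<in> truncation_optimum n (T z)} \<in> sets M" for e
    unfolding truncation_optimum_def
    using measurable_find[where P = "\<lambda>z. optimal_md (truncation n (T z))",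
        OF measurable_truncation_optimal]
    by (simp add: pred_def)
qed

text \<open>Applied to the truncations with their selected optima, the defining property makes
  \<open>D\<close> and \<open>D'\<close> limits of one and the same decorated sequence.\<close>

lemma limit_of_optima_unique:
  assumes "random_config M (\<lambda>z. uh_graph (T z)) D" "limit_of_optima M (\<lambda>z. uh_graph (T z)) D"
    and "random_config M (\<lambda>z. uh_graph (T z)) D'" "limit_of_optima M (\<lambda>z. uh_graph (T z)) D'"
  shows "AE z in M. D' z = D z"
proof -
  have *: "AE z in M. decorated_converges_locally (\<lambda>n. truncation n (T z))
      (\<lambda>n. truncation_optimum n (T z)) (uh_graph (T z)) (D z)"
    if "limit_of_optima M (\<lambda>z. uh_graph (T z)) D" for D
    using that[unfolded limit_of_optima_def, rule_format, of "\<lambda>n z. truncation n (T z)"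
        "\<lambda>n z. truncation_optimum n (T z)"]
    by (simp add: random_truncation random_config_truncation_optimum truncation_converges
        optimal_truncation_optimum)
  show ?thesis
    using *[OF assms(2)] *[OF assms(4)] AE_inj_weights AE_space
  proof eventually_elim
    case (elim z)
    have "md_config (uh_graph (T z)) (D z)" "md_config (uh_graph (T z)) (D' z)"
      using assms(1,3) elim(4) by (simp_all add: random_config_def)
    then have "D z \<subseteq> edges (uh_graph (T z))" "D' z \<subseteq> edges (uh_graph (T z))"
      by (simp_all add: md_config_def)
    then show ?case
      using elim decorated_limit_unique[of _ _ "cT z" "wT z" "xT z" "D' z" "D z"] by simp
  qed
qed

end

theorem theorem1:
  fixes M :: "'s measure"
    and \<pi> :: "nat pmf"
    and \<omega> \<xi> :: "real measure"
    and T :: "'s \<Rightarrow> uh_labels"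
  assumes prob: "prob_space M"
    and mean: "integrable (measure_pmf \<pi>) real" "0 < measure_pmf.expectation \<pi> real"
    and distributions: "real_distribution \<omega>" "real_distribution \<xi>"
    and tree: "weighted_ubgw_tree \<pi> \<omega> \<xi> M T"
    and xi_bounded: "bdd_below (msupport \<xi>)"
    and xi_atoms: "atoms \<xi> = {} \<or> atoms \<xi> = {Inf (msupport \<xi>)}"
    and omega_atoms: "atoms \<omega> = {}"
    and omega_support: "locally_convex_under_max \<omega>"
    and second_moment: "integrable (measure_pmf \<pi>) (\<lambda>k. (real k)\<^sup>2)"
  shows "\<exists>D. random_config M (\<lambda>z. uh_graph (T z)) D \<and>
             limit_of_optima M (\<lambda>z. uh_graph (T z)) D \<and>
             (\<forall>D'. random_config M (\<lambda>z. uh_graph (T z)) D' \<and>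
                   limit_of_optima M (\<lambda>z. uh_graph (T z)) D' \<longrightarrow>
                   (AE z in M. D' z = D z))"
proof -
  interpret random_tree M T \<pi> \<omega> \<xi>
    by (intro random_tree.intro random_tree_axioms.intro prob distributions tree omega_atoms)
  have "limit_of_optima M (\<lambda>z. uh_graph (T z)) (\<lambda>z. tree_config (T z))"
    by (intro limit_of_optima_tree_config AE_generic mean omega_support xi_bounded)
  then show ?thesis
    using random_config_tree_config limit_of_optima_unique by blast
qed

end
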